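(* Let $(\lambda_k)$ be a sequence of positive numbers with $\lambda_k\to0$ as $k\to\infty$. Then the family $(\mathcal J_{\lambda_k})_k$ is weakly equi-coercive on $X=H^1(\Omega)\times H^1(\Omega)$: for every $t\in\mathbb{R}$ there exists a weakly compact set $K_t\subset X$ such that $\{z\in X:\mathcal J_{\lambda_k}(z)\le t\}\subset K_t$ for every $k$.
   Context: $\Omega\subset\mathbb{R}^d$, $d\in\{1,2,3\}$, is a bounded Lipschitz domain; $\|\cdot\|_q$ is the $L^q(\Omega)$ norm. Fix $\delta>0$. For $C\in H^1(\Omega)$ set $C^+=\max\{C,0\}$, $C^-=\min\{C,0\}$, $N=\delta^2+\int_\Omega C^+dx$, $P=\delta^2-\int_\Omega C^-dx$, $n(V)=N e^{-V}/\int_\Omega e^{-V}dx$, $p(V)=P e^{V}/\int_\Omega e^{V}dx$. Let $\mathcal P=\{v\in L^1(\Omega):\int_\Omega v\,dx=0\}$, $b(v)=N\ln\big(\tfrac1{|\Omega|}\int_\Omega e^{-v}dx\big)+P\ln\big(\tfrac1{|\Omega|}\int_\Omega e^{v}dx\big)+\int_\Omega Cv\,dx$, $\Sigma=\{v\in\mathcal P: b(v)<+\infty,\ \nabla v\in L^2(\Omega)\}$. $U_{\mathrm{ad}}\subset H^1(\Omega)$ is an admissible set with the property that every subset bounded with respect to $\|\nabla\cdot\|_2$ is bounded in $H^1(\Omega)$. For $\lambda\ge0$, $\langle e_\lambda(V,C),\varphi\rangle=\lambda^2\int_\Omega\nabla V\cdot\nabla\varphi\,dx+\int_\Omega(-n(V)+p(V)+C)\varphi\,dx$;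 $\Pi_\lambda=\{(V,C)\in\Sigma\times U_{\mathrm{ad}}: e_\lambda(V,C)=0 \text{ in } H^1(\Omega)^*\}$; $\chi_{\Pi_\lambda}=0$ on $\Pi_\lambda$ and $+\infty$ elsewhere on $X$. The cost is $J(V,C)=\frac12\|n(V)-n_d\|_2^2+\frac12\|p(V)-p_d\|_2^2+\frac\sigma2\|\nabla(C-C_{\mathrm{ref}})\|_2^2$ with given $n_d,p_d\in L^2(\Omega)$, $C_{\mathrm{ref}}\in H^1(\Omega)$, $\sigma>0$, and $\mathcal J_\lambda=J+\chi_{\Pi_\lambda}:X\to\mathbb{R}\cup\{+\infty\}$. *)

theory Defs
  imports "HOL-Analysis.Analysis"
begin

fun Ck :: "nat \<Rightarrow> ('a::euclidean_space \<Rightarrow> real) \<Rightarrow> bool" where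
  "Ck 0 f = continuous_on UNIV f"
| "Ck (Suc k) f = ((\<forall>x. f differentiable (at x)) \<and>
      (\<forall>b\<in>Basis. Ck k (\<lambda>x. frechet_derivative f (at x) b)))"

definition smooth_fun :: "('a::euclidean_space \<Rightarrow> real) \<Rightarrow> bool" where
  "smooth_fun f \<longleftrightarrow> (\<forall>k. Ck k f)"

definition test_fun :: "'a::euclidean_space set \<Rightarrow> ('a \<Rightarrow> real) \<Rightarrow> bool" where
  "test_fun \<Omega> \<phi> \<longleftrightarrow> smooth_fun \<phi> \<and> compact (closure {x. \<phi> x \<noteq> 0})
      \<and> closure {x. \<phi> x \<noteq> 0} \<subseteq> \<Omega>"

section \<open>Lebesgue and Sobolev spaces on \<Omega> (functions as representatives)\<close>

definition L1 :: "'a::euclidean_space set \<Rightarrow> ('a \<Rightarrow> real) set" where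
  "L1 \<Omega> = {f. integrable (lebesgue_on \<Omega>) f}"

definition L2 :: "'a::euclidean_space set \<Rightarrow> ('a \<Rightarrow> real) set" where
  "L2 \<Omega> = {f. f \<in> borel_measurable (lebesgue_on \<Omega>) \<and>
               integrable (lebesgue_on \<Omega>) (\<lambda>x. (f x)\<^sup>2)}"

definition L2v :: "'a::euclidean_space set \<Rightarrow> ('a \<Rightarrow> 'a) set" where
  "L2v \<Omega> = {G. G \<in> borel_measurable (lebesgue_on \<Omega>) \<and>
               integrable (lebesgue_on \<Omega>) (\<lambda>x. (norm (G x))\<^sup>2)}"

definition is_weak_grad :: "'a::euclidean_space set \<Rightarrow> ('a \<Rightarrow> real) \<Rightarrow> ('a \<Rightarrow> 'a) \<Rightarrow> bool" where
  "is_weak_grad \<Omega> u G \<longleftrightarrow> (\<forall>\<phi>. test_fun \<Omega> \<phi> \<longrightarrow> (\<forall>b\<in>Basis.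
      (\<integral>x. u x * frechet_derivative \<phi> (at x) b \<partial>lebesgue_on \<Omega>)
        = - (\<integral>x. (G x \<bullet> b) * \<phi> x \<partial>lebesgue_on \<Omega>)))"

definition weak_grad :: "'a::euclidean_space set \<Rightarrow> ('a \<Rightarrow> real) \<Rightarrow> ('a \<Rightarrow> 'a)" where
  "weak_grad \<Omega> u = (SOME G. G \<in> L2v \<Omega> \<and> is_weak_grad \<Omega> u G)"

definition H1 :: "'a::euclidean_space set \<Rightarrow> ('a \<Rightarrow> real) set" where
  "H1 \<Omega> = {u \<in> L2 \<Omega>. \<exists>G\<in>L2v \<Omega>. is_weak_grad \<Omega> u G}"

definition L2norm :: "'a::euclidean_space set \<Rightarrow> ('a \<Rightarrow> real) \<Rightarrow> real" where
  "L2norm \<Omega> f = sqrt (\<integral>x. (f x)\<^sup>2 \<partial>lebesgue_on \<Omega>)"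

definition grad_norm :: "'a::euclidean_space set \<Rightarrow> ('a \<Rightarrow> real) \<Rightarrow> real" where
  "grad_norm \<Omega> u = sqrt (\<integral>x. (norm (weak_grad \<Omega> u x))\<^sup>2 \<partial>lebesgue_on \<Omega>)"

definition H1_inner :: "'a::euclidean_space set \<Rightarrow> ('a \<Rightarrow> real) \<Rightarrow> ('a \<Rightarrow> real) \<Rightarrow> real" where
  "H1_inner \<Omega> u v = (\<integral>x. u x * v x \<partial>lebesgue_on \<Omega>)
      + (\<integral>x. weak_grad \<Omega> u x \<bullet> weak_grad \<Omega> v x \<partial>lebesgue_on \<Omega>)"

definition H1_norm :: "'a::euclidean_space set \<Rightarrow> ('a \<Rightarrow> real) \<Rightarrow> real" where
  "H1_norm \<Omega> u = sqrt (H1_inner \<Omega> u u)"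

definition Xsp :: "'a::euclidean_space set \<Rightarrow> (('a \<Rightarrow> real) \<times> ('a \<Rightarrow> real)) set" where
  "Xsp \<Omega> = H1 \<Omega> \<times> H1 \<Omega>"

definition X_inner :: "'a::euclidean_space set \<Rightarrow> (('a \<Rightarrow> real) \<times> ('a \<Rightarrow> real))
     \<Rightarrow> (('a \<Rightarrow> real) \<times> ('a \<Rightarrow> real)) \<Rightarrow> real" where
  "X_inner \<Omega> z w = H1_inner \<Omega> (fst z) (fst w) + H1_inner \<Omega> (snd z) (snd w)"

text \<open>Weak topology on X: initial topology of all functionals \<open>z \<mapsto> \<langle>z,w\<rangle>_X\<close>, \<open>w \<in> X\<close>
  (by Riesz these are all continuous linear functionals).\<close>
definition weak_top_X :: "'a::euclidean_space set \<Rightarrow> (('a \<Rightarrow> real) \<times> ('a \<Rightarrow> real)) topology" where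
  "weak_top_X \<Omega> = topology_generated_by
     {{z \<in> Xsp \<Omega>. X_inner \<Omega> z w \<in> U} | w U. w \<in> Xsp \<Omega> \<and> open U}"

definition lipschitz_domain :: "'a::euclidean_space set \<Rightarrow> bool" where
  "lipschitz_domain \<Omega> \<longleftrightarrow> open \<Omega> \<and> connected \<Omega> \<and> \<Omega> \<noteq> {} \<and> bounded \<Omega> \<and>
     (\<forall>x\<in>frontier \<Omega>. \<exists>r>0. \<exists>e::'a. \<exists>g::'a \<Rightarrow> real. \<exists>L.
        norm e = 1 \<and> L-lipschitz_on {y. y \<bullet> e = 0} g \<and>
        \<Omega> \<inter> ball x r = {y \<in> ball x r. y \<bullet> e < g (y - (y \<bullet> e) *\<^sub>R e)})"

definition Nc :: "'a::euclidean_space set \<Rightarrow> real \<Rightarrow> ('a \<Rightarrow> real) \<Rightarrow> real" where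
  "Nc \<Omega> \<delta> C = \<delta>\<^sup>2 + (\<integral>x. max (C x) 0 \<partial>lebesgue_on \<Omega>)"

definition Pc :: "'a::euclidean_space set \<Rightarrow> real \<Rightarrow> ('a \<Rightarrow> real) \<Rightarrow> real" where
  "Pc \<Omega> \<delta> C = \<delta>\<^sup>2 - (\<integral>x. min (C x) 0 \<partial>lebesgue_on \<Omega>)"

definition nV :: "'a::euclidean_space set \<Rightarrow> real \<Rightarrow> ('a \<Rightarrow> real) \<Rightarrow> ('a \<Rightarrow> real) \<Rightarrow> 'a \<Rightarrow> real" where
  "nV \<Omega> \<delta> C V x = Nc \<Omega> \<delta> C * exp (- V x) / (\<integral>y. exp (- V y) \<partial>lebesgue_on \<Omega>)"

definition pV :: "'a::euclidean_space set \<Rightarrow> real \<Rightarrow> ('a \<Rightarrow> real) \<Rightarrow> ('a \<Rightarrow> real) \<Rightarrow> 'a \<Rightarrow> real" where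
  "pV \<Omega> \<delta> C V x = Pc \<Omega> \<delta> C * exp (V x) / (\<integral>y. exp (V y) \<partial>lebesgue_on \<Omega>)"

definition Pset :: "'a::euclidean_space set \<Rightarrow> ('a \<Rightarrow> real) set" where
  "Pset \<Omega> = {v \<in> L1 \<Omega>. (\<integral>x. v x \<partial>lebesgue_on \<Omega>) = 0}"

definition b_fun :: "'a::euclidean_space set \<Rightarrow> real \<Rightarrow> ('a \<Rightarrow> real) \<Rightarrow> ('a \<Rightarrow> real) \<Rightarrow> ereal" where
  "b_fun \<Omega> \<delta> C v =
    (if (\<integral>\<^sup>+x. ennreal (exp (- v x)) \<partial>lebesgue_on \<Omega>) < \<infinity> \<and>
        (\<integral>\<^sup>+x. ennreal (exp (v x)) \<partial>lebesgue_on \<Omega>) < \<infinity> \<and>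
        integrable (lebesgue_on \<Omega>) (\<lambda>x. C x * v x)
     then ereal (Nc \<Omega> \<delta> C * ln ((1 / measure lebesgue \<Omega>) * (\<integral>x. exp (- v x) \<partial>lebesgue_on \<Omega>))
               + Pc \<Omega> \<delta> C * ln ((1 / measure lebesgue \<Omega>) * (\<integral>x. exp (v x) \<partial>lebesgue_on \<Omega>))
               + (\<integral>x. C x * v x \<partial>lebesgue_on \<Omega>))
     else \<infinity>)"

definition Sigma_set :: "'a::euclidean_space set \<Rightarrow> real \<Rightarrow> ('a \<Rightarrow> real) \<Rightarrow> ('a \<Rightarrow> real) set" where
  "Sigma_set \<Omega> \<delta> C = {v \<in> Pset \<Omega>. b_fun \<Omega> \<delta> C v < \<infinity> \<and> (\<exists>G\<in>L2v \<Omega>. is_weak_grad \<Omega> v G)}"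

text \<open>\<open>e_\<lambda>(V,C) = 0\<close> in \<open>H^1(\<Omega>)^*\<close>: the pairing with every \<open>\<phi> \<in> H^1\<close> is defined and vanishes.\<close>
definition e_zero :: "'a::euclidean_space set \<Rightarrow> real \<Rightarrow> real \<Rightarrow> ('a \<Rightarrow> real) \<Rightarrow> ('a \<Rightarrow> real) \<Rightarrow> bool" where
  "e_zero \<Omega> \<delta> lam V C \<longleftrightarrow> (\<forall>\<phi>\<in>H1 \<Omega>.
     integrable (lebesgue_on \<Omega>) (\<lambda>x. (- nV \<Omega> \<delta> C V x + pV \<Omega> \<delta> C V x + C x) * \<phi> x) \<and>
     lam\<^sup>2 * (\<integral>x. weak_grad \<Omega> V x \<bullet> weak_grad \<Omega> \<phi> x \<partial>lebesgue_on \<Omega>)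
       + (\<integral>x. (- nV \<Omega> \<delta> C V x + pV \<Omega> \<delta> C V x + C x) * \<phi> x \<partial>lebesgue_on \<Omega>) = 0)"

definition Pi_lam :: "'a::euclidean_space set \<Rightarrow> real \<Rightarrow> ('a \<Rightarrow> real) set \<Rightarrow> real
     \<Rightarrow> (('a \<Rightarrow> real) \<times> ('a \<Rightarrow> real)) set" where
  "Pi_lam \<Omega> \<delta> Uad lam = {(V, C). V \<in> Sigma_set \<Omega> \<delta> C \<and> C \<in> Uad \<and> e_zero \<Omega> \<delta> lam V C}"

definition sqnorm :: "'a::euclidean_space set \<Rightarrow> ('a \<Rightarrow> real) \<Rightarrow> ereal" where
  "sqnorm \<Omega> f = enn2ereal (\<integral>\<^sup>+x. ennreal ((f x)\<^sup>2) \<partial>lebesgue_on \<Omega>)"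

definition grad_sqnorm :: "'a::euclidean_space set \<Rightarrow> ('a \<Rightarrow> real) \<Rightarrow> ereal" where
  "grad_sqnorm \<Omega> u = enn2ereal (\<integral>\<^sup>+x. ennreal ((norm (weak_grad \<Omega> u x))\<^sup>2) \<partial>lebesgue_on \<Omega>)"

definition Jcost :: "'a::euclidean_space set \<Rightarrow> real \<Rightarrow> ('a \<Rightarrow> real) \<Rightarrow> ('a \<Rightarrow> real) \<Rightarrow> real
     \<Rightarrow> ('a \<Rightarrow> real) \<Rightarrow> ('a \<Rightarrow> real) \<times> ('a \<Rightarrow> real) \<Rightarrow> ereal" where
  "Jcost \<Omega> \<delta> nd pd \<sigma> Cref z =
     (let V = fst z; C = snd z in
        ereal (1/2) * sqnorm \<Omega> (\<lambda>x. nV \<Omega> \<delta> C V x - nd x)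
      + ereal (1/2) * sqnorm \<Omega> (\<lambda>x. pV \<Omega> \<delta> C V x - pd x)
      + ereal (\<sigma>/2) * grad_sqnorm \<Omega> (\<lambda>x. C x - Cref x))"

definition J_lam :: "'a::euclidean_space set \<Rightarrow> real \<Rightarrow> ('a \<Rightarrow> real) set \<Rightarrow> ('a \<Rightarrow> real) \<Rightarrow> ('a \<Rightarrow> real)
     \<Rightarrow> real \<Rightarrow> ('a \<Rightarrow> real) \<Rightarrow> real \<Rightarrow> ('a \<Rightarrow> real) \<times> ('a \<Rightarrow> real) \<Rightarrow> ereal" where
  "J_lam \<Omega> \<delta> Uad nd pd \<sigma> Cref lam z =
     (if z \<in> Pi_lam \<Omega> \<delta> Uad lam then Jcost \<Omega> \<delta> nd pd \<sigma> Cref z else \<infinity>)"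

definition admissible :: "'a::euclidean_space set \<Rightarrow> ('a \<Rightarrow> real) set \<Rightarrow> bool" where
  "admissible \<Omega> Uad \<longleftrightarrow> Uad \<subseteq> H1 \<Omega> \<and>
     (\<forall>S\<subseteq>Uad. (\<exists>M. \<forall>u\<in>S. grad_norm \<Omega> u \<le> M) \<longrightarrow> (\<exists>M. \<forall>u\<in>S. H1_norm \<Omega> u \<le> M))"

end

theory Submission
  imports Defs "HOL-Computational_Algebra.Polynomial"
begin

text \<open>
  For a stationary state the product \<open>n p\<close> is a constant \<open>\<kappa>\<close>.  Testing the Poisson equation
  with the decreasing function \<open>n / (n + \<epsilon>)\<close> of \<open>V\<close>, for \<open>\<epsilon> = \<delta>\<^sup>2 / (2 |\<Omega>|)\<close>, gives
  \<open>\<kappa> \<ge> \<epsilon>\<^sup>2\<close> independently of \<open>\<lambda>\<close>: the charge \<open>N\<close> exceeds the integral of \<open>C\<^sup>+\<close> by \<open>\<delta>\<^sup>2\<close>.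
  Hence \<open>n + p \<ge> \<delta>\<^sup>2 / |\<Omega>|\<close>.  Testing with \<open>T (p - n) + T C\<close>, where \<open>T s = k arctan (s / k)\<close>,
  makes the zero-order term nonnegative by monotonicity, so the factor \<open>\<lambda>\<^sup>2\<close> drops out; \<open>k \<rightarrow> \<infinity>\<close>
  yields \<open>(\<delta>\<^sup>2 / |\<Omega>|) \<parallel>\<nabla>V\<parallel> \<le> \<parallel>\<nabla>C\<parallel>\<close>.  Up to an additive constant \<open>V\<close> equals \<open>ln (p / n) / 2\<close>, whose
  modulus is at most \<open>(n + p) / \<surd>\<kappa>\<close>; as \<open>V\<close> has mean zero, the \<open>L\<^sup>2\<close> bounds that the cost
  provides for \<open>n\<close> and \<open>p\<close> control \<open>V\<close> in \<open>L\<^sup>2\<close>, without a Poincare inequality.  So sublevel sets lie in a ball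
  of \<open>X\<close>, which is weakly compact.
\<close>

section \<open>Smooth bump functions\<close>

text \<open>\<open>V\<close> is only an H^1 function with integrable exponentials, so
  \<open>n\<close>, \<open>p\<close> and \<open>p - n\<close> are not known to lie in H^1 and are
  not directly available as test functions. The test functions used are built from
  \<open>F (V x)\<close> and \<open>F (C x)\<close> with \<open>F\<close> of class C^1 and
  \<open>F'\<close> bounded: a logistic function of \<open>V\<close> for the bound on \<kappa>, and
  an arctan of \<open>p - n\<close>, whose derivative decays quadratically and so beats the growth
  of \<open>p + n\<close>. The chain rule is therefore needed exactly for such \<open>F\<close>; it
  is obtained by mollifying near the support of a test function. \<open>weak_grad\<close> is an
  arbitrary choice among fields that agree almost everywhere. Every formula for it rests on
  uniqueness, hence on the fundamental lemma of the calculus of variations, for which the mollifiers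
  serve once more. Elements of X are functions, not classes: \<open>X_inner\<close> is degenerate
  and points equal almost everywhere are not separated by the weak topology. Compactness of balls is
  therefore proved for complete semi-inner product spaces, by Riesz and Tychonoff. The cost sees
  only the gradient of \<open>C\<close>; its L^2 size is controlled through the admissibility of
  \<open>Uad\<close>.\<close>

definition flat :: "real poly \<Rightarrow> real \<Rightarrow> real" where
  "flat p t = (if t > 0 then poly p (1 / t) * exp (- (1 / t)) else 0)"

lemma tendsto_poly_exp_neg: "((\<lambda>s. poly p s * exp (- s)) \<longlongrightarrow> (0::real)) at_top"
proof -
  have "((\<lambda>s. \<Sum>i\<le>degree p. coeff p i * (s ^ i / exp s)) \<longlongrightarrow> (\<Sum>i\<le>degree p. coeff p i * 0)) at_top"
    by (intro tendsto_intros tendsto_power_div_exp_0)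
  then show ?thesis
    by (simp add: poly_altdef exp_minus sum_distrib_right divide_inverse mult.assoc)
qed

text \<open>The polynomial parameter makes the family closed under differentiation: for t > 0 the
  derivative of p(1/t) exp(-1/t) is t^(-2) (p - p')(1/t) exp(-1/t). Smoothness of all orders follows
  from this first-order statement.\<close>

lemma flat_has_field_derivative:
  "(flat p has_field_derivative flat ([:0, 0, 1:] * (p - pderiv p)) t) (at t)"
proof (cases t "0::real" rule: linorder_cases)
  case less
  have "((\<lambda>_. 0) has_field_derivative 0) (at t)" by simp
  then have "(flat p has_field_derivative 0) (at t)"
    by (rule has_field_derivative_transform_within_open[where S="{..<0}"])
       (use less in \<open>auto simp: flat_def\<close>)
  then show ?thesis using less by (simp add: flat_def)
next
  case greater
  have "((\<lambda>t. poly p (1 / t) * exp (- (1 / t))) has_field_derivative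
      flat ([:0, 0, 1:] * (p - pderiv p)) t) (at t)"
    using greater
    by (auto intro!: derivative_eq_intros DERIV_chain2[OF poly_DERIV] simp: flat_def field_simps power2_eq_square)
  then show ?thesis
    by (rule has_field_derivative_transform_within_open[where S="{0<..}"])
       (use greater in \<open>auto simp: flat_def\<close>)
next
  case equal
  have l: "((\<lambda>h. flat p h / h) \<longlongrightarrow> 0) (at_left 0)"
    by (rule tendsto_eventually) (auto simp: eventually_at_filter flat_def)
  \<comment> \<open>\<open>pCons 0 p\<close> is the polynomial s p(s); at s = 1/h its extra factor
    is the division by h in the difference quotient.\<close>
  have "((\<lambda>h. poly (pCons 0 p) (inverse h) * exp (- inverse h)) \<longlongrightarrow> 0) (at_right (0::real))"
    by (rule filterlim_compose[OF tendsto_poly_exp_neg filterlim_inverse_at_top_right])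
  then have r: "((\<lambda>h. flat p h / h) \<longlongrightarrow> 0) (at_right 0)"
    by (rule Lim_transform_eventually) (auto simp: eventually_at_filter flat_def field_simps)
  have "((\<lambda>h. flat p h / h) \<longlongrightarrow> 0) (at 0)"
    using l r by (rule filterlim_split_at)
  then show ?thesis using equal by (simp add: has_field_derivative_iff flat_def)
qed

lemma flat_1_nonneg: "flat 1 t \<ge> 0"
  and flat_1_pos_iff: "flat 1 t > 0 \<longleftrightarrow> t > 0"
  by (auto simp: flat_def)

section \<open>Closure properties of C^k functions\<close>

lemma Ck_Suc_D: "Ck (Suc k) f \<Longrightarrow> Ck k f"
proof (induction k arbitrary: f)
  case 0
  then show ?case
    by (auto intro!: continuous_at_imp_continuous_on differentiable_imp_continuous_within)
next
  case (Suc k)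
  then show ?case by (metis Ck.simps(2))
qed

lemma Ck_const: "Ck k (\<lambda>_. c)"
  by (induction k arbitrary: c) auto

lemma Ck_inner: "Ck k (\<lambda>x. x \<bullet> c)"
proof (cases k)
  case (Suc j)
  have "frechet_derivative (\<lambda>x. x \<bullet> c) (at x) = (\<lambda>h. h \<bullet> c)" for x :: 'a
    by (rule frechet_derivative_at[symmetric]) (auto intro!: derivative_eq_intros)
  then show ?thesis using Suc
    by (auto simp: Ck_const intro!: derivative_intros bounded_linear_imp_differentiable bounded_linear_inner_left)
qed (auto intro!: continuous_intros)

lemma Ck_add: "Ck k f \<Longrightarrow> Ck k g \<Longrightarrow> Ck k (\<lambda>x. f x + g x)"
proof (induction k arbitrary: f g)
  case (Suc k)
  have "frechet_derivative (\<lambda>x. f x + g x) (at x) = (\<lambda>h. frechet_derivative f (at x) h + frechet_derivative g (at x) h)" for x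
    using Suc.prems by (intro frechet_derivative_at[symmetric]) (auto intro!: derivative_eq_intros simp: frechet_derivative_works)
  then show ?case using Suc by auto
qed (auto intro: continuous_intros)

text \<open>The product rule also contains the undifferentiated factors, so the induction step needs
  them at the lower order; \<open>Ck_Suc_D\<close> supplies this.\<close>

lemma Ck_mult: "Ck k f \<Longrightarrow> Ck k g \<Longrightarrow> Ck k (\<lambda>x. f x * g x)"
proof (induction k arbitrary: f g)
  case (Suc k)
  have "frechet_derivative (\<lambda>x. f x * g x) (at x) =
     (\<lambda>h. f x * frechet_derivative g (at x) h + frechet_derivative f (at x) h * g x)" for x
    using Suc.prems by (intro frechet_derivative_at[symmetric] has_derivative_mult) (auto simp: frechet_derivative_works)
  moreover have "Ck k f" "Ck k g" using Suc.prems Ck_Suc_D by blast+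
  ultimately show ?case using Suc by (auto intro!: Ck_add)
qed (auto intro: continuous_intros)

text \<open>The induction covers all \<open>p\<close> at once, because differentiating replaces
  \<open>p\<close> by another polynomial and brings out a partial derivative of \<open>f\<close>,
  again of class C^k.\<close>

lemma Ck_flat_comp:
  assumes "\<And>j. Ck j f" shows "Ck k (\<lambda>x. flat p (f x))"
proof (induction k arbitrary: p)
  case 0
  have "continuous_on UNIV (flat p)"
    using flat_has_field_derivative DERIV_continuous_on by blast
  moreover have "continuous_on UNIV f" using assms[of 0] by simp
  ultimately show ?case by (auto intro: continuous_on_compose2)
next
  case (Suc k)
  have df: "(f has_derivative frechet_derivative f (at x)) (at x)" for x
    using assms[of 1] by (auto simp: frechet_derivative_works)
  have d: "((\<lambda>x. flat p (f x)) has_derivative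
     (\<lambda>h. flat ([:0, 0, 1:] * (p - pderiv p)) (f x) * frechet_derivative f (at x) h)) (at x)" for x
    using has_derivative_compose[OF df flat_has_field_derivative[unfolded has_field_derivative_def]] .
  have "frechet_derivative (\<lambda>x. flat p (f x)) (at x) = 
     (\<lambda>h. flat ([:0, 0, 1:] * (p - pderiv p)) (f x) * frechet_derivative f (at x) h)" for x
    using frechet_derivative_at[OF d] by simp
  moreover have "Ck k (\<lambda>x. frechet_derivative f (at x) b)" if "b \<in> Basis" for b
    using assms[of "Suc k"] that by simp
  moreover have "(\<lambda>x. flat p (f x)) differentiable (at x)" for x
    using d unfolding differentiable_def by blast
  ultimately show ?case using Suc by (auto intro!: Ck_mult)
qed

text \<open>The classical exp(-1/(e^2 - |x|^2)) on the ball of radius e, extended by zero. The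
  squared norm keeps the inner function polynomial in the coordinates, hence smooth at the
  origin.\<close>

definition bump :: "real \<Rightarrow> 'a::euclidean_space \<Rightarrow> real" where
  "bump e x = flat 1 (e\<^sup>2 - x \<bullet> x)"

lemma Ck_sum: "finite S \<Longrightarrow> (\<And>i. i \<in> S \<Longrightarrow> Ck k (f i)) \<Longrightarrow> Ck k (\<lambda>x. \<Sum>i\<in>S. f i x)"
  by (induction S rule: finite_induct) (auto simp: Ck_const intro: Ck_add)

lemma Ck_diff_inner_self: "Ck k (\<lambda>y. c - (x - y) \<bullet> (x - y))"
proof -
  have "Ck k (\<lambda>y. c + (- (x \<bullet> x) + (2 * (y \<bullet> x) + (-1) * (\<Sum>b\<in>Basis. (y \<bullet> b) * (y \<bullet> b)))))"
    by (intro Ck_add Ck_mult Ck_const Ck_inner Ck_sum) auto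
  then show ?thesis
    by (simp add: euclidean_inner[symmetric] inner_diff inner_commute algebra_simps)
qed

lemma smooth_bump: "smooth_fun (\<lambda>y. bump e (x - y))"
  unfolding smooth_fun_def bump_def by (intro allI Ck_flat_comp Ck_diff_inner_self)

section \<open>Convolution and approximation in L1\<close>

lemma lborel_distr_add_right: "distr lborel borel (\<lambda>x. x + c) = (lborel :: 'a::euclidean_space measure)"
  using lborel_distr_plus[of c] by (simp add: add.commute[of c] cong: distr_cong)

lemma lborel_distr_reflect: "distr lborel borel (\<lambda>x. c - x) = (lborel :: 'a::euclidean_space measure)"
proof -
  have "lborel = density (distr lborel borel (\<lambda>x. c + (-1) *\<^sub>R x)) (\<lambda>_. \<bar>-1::real\<bar> ^ DIM('a))"
    by (rule lborel_affine) simp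
  then show ?thesis by (simp add: density_1)
qed

lemma
  fixes f :: "'a::euclidean_space \<Rightarrow> real"
  assumes f: "f \<in> borel_measurable borel"
  shows integrable_lborel_shift: "integrable lborel (\<lambda>x. f (x + c)) \<longleftrightarrow> integrable lborel f"
    and integral_lborel_shift: "(\<integral>x. f (x + c) \<partial>lborel) = (\<integral>x. f x \<partial>lborel)"
    and integrable_lborel_reflect: "integrable lborel (\<lambda>x. f (c - x)) \<longleftrightarrow> integrable lborel f"
    and integral_lborel_reflect: "(\<integral>x. f (c - x) \<partial>lborel) = (\<integral>x. f x \<partial>lborel)"
  using f integrable_distr_eq[of "\<lambda>x. x + c" lborel borel f] integral_distr[of "\<lambda>x. x + c" lborel borel f]
    integrable_distr_eq[of "\<lambda>x. c - x" lborel borel f] integral_distr[of "\<lambda>x. c - x" lborel borel f]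
  by (simp_all add: lborel_distr_add_right lborel_distr_reflect)

section \<open>Density of continuous functions and continuity of translations in L^1\<close>

lemma integrable_lborel_bounded_support:
  fixes h :: "'a::euclidean_space \<Rightarrow> real"
  assumes "h \<in> borel_measurable borel" "\<And>x. \<bar>h x\<bar> \<le> M" "\<And>x. norm x > R \<Longrightarrow> h x = 0"
  shows "integrable lborel h"
proof (rule Bochner_Integration.integrable_bound)
  show "integrable lborel (\<lambda>x::'a. M * indicator (cball 0 R) x)"
    by (intro integrable_mult_right integrable_real_indicator) (use emeasure_lborel_cball_finite in auto)
  show "AE x in lborel. norm (h x) \<le> norm (M * indicator (cball 0 R) x)"
  proof (rule AE_I2)
    fix x
    show "norm (h x) \<le> norm (M * indicator (cball 0 R) x)"
      using assms(2)[of x] assms(3)[of x] by (cases "norm x > R") auto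
  qed
qed (use assms in auto)

text \<open>Half of the error goes into truncating \<open>f\<close> in value (\<open>cl m\<close>)
  and in space (\<open>ch m\<close>), the other half into replacing the truncated function by a
  continuous one; both steps are dominated convergence.\<close>

lemma integrable_approx_continuous:
  fixes f :: "'a::euclidean_space \<Rightarrow> real"
  assumes f: "integrable lborel f" and e: "e > 0"
  obtains g R where "continuous_on UNIV g" "\<And>x. norm x > R \<Longrightarrow> g x = 0" "integrable lborel g"
    "(\<integral>x. \<bar>f x - g x\<bar> \<partial>lborel) < e"
proof -
  define cl where "cl m s = max (- real m) (min (real m) s)" for m and s :: real
  define ch where "ch m x = max 0 (min 1 (real m + 1 - norm x))" for m and x :: 'a
  have cl_bound: "\<bar>cl m s\<bar> \<le> real m" "\<bar>cl m s\<bar> \<le> \<bar>s\<bar>" for m s by (auto simp: cl_def)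
  have ch_bound: "0 \<le> ch m x" "ch m x \<le> 1" for m x by (auto simp: ch_def)
  have ch_supp: "ch m x = 0" if "norm x > real m + 1" for m x using that by (auto simp: ch_def)
  have cl_cont: "isCont (cl m) s" for m s
    unfolding cl_def by (intro continuous_intros)
  have ch_cont: "continuous_on UNIV (ch m)" for m unfolding ch_def by (intro continuous_intros)
  have [measurable]: "f \<in> borel_measurable borel" using f by auto
  have [measurable]: "cl m \<in> borel_measurable borel" "ch m \<in> borel_measurable borel" for m
    using ch_cont by (auto intro!: borel_measurable_continuous_onI continuous_at_imp_continuous_on[OF ballI, OF cl_cont])
  have bd: "\<bar>cl m s * ch m x\<bar> \<le> real m" "\<bar>cl m s * ch m x\<bar> \<le> \<bar>s\<bar>" for m s x
    using cl_bound[of m s] ch_bound[of m x] mult_left_le[of "ch m x" "\<bar>cl m s\<bar>"] by (auto simp: abs_mult)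
  have "(\<lambda>m. \<integral>x. \<bar>f x - cl m (f x) * ch m x\<bar> \<partial>lborel) \<longlonglongrightarrow> (\<integral>x. 0 \<partial>(lborel :: 'a measure))"
  proof (rule integral_dominated_convergence[where w="\<lambda>x. 2 * \<bar>f x\<bar>"])
    show "AE x in lborel. (\<lambda>m. \<bar>f x - cl m (f x) * ch m x\<bar>) \<longlonglongrightarrow> 0"
    proof (rule AE_I2, rule tendsto_eventually)
      fix x
      obtain m0 :: nat where m0: "real m0 \<ge> max \<bar>f x\<bar> (norm x)" using real_arch_simple by blast
      show "\<forall>\<^sub>F m in sequentially. \<bar>f x - cl m (f x) * ch m x\<bar> = 0"
        using eventually_ge_at_top[of m0]
      proof eventually_elim
        case (elim m)
        then have "real m \<ge> real m0" by simp
        then have "real m \<ge> \<bar>f x\<bar>" "real m \<ge> norm x" using m0 by linarith+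
        then show ?case by (auto simp: cl_def ch_def)
      qed
    qed
    show "AE x in lborel. norm \<bar>f x - cl m (f x) * ch m x\<bar> \<le> 2 * \<bar>f x\<bar>" for m
      using bd by (intro AE_I2) (smt (verit) real_norm_def)
  qed (use f in auto)
  then have "\<forall>\<^sub>F m in sequentially. (\<integral>x. \<bar>f x - cl m (f x) * ch m x\<bar> \<partial>lborel) < e/2"
    using e by (intro order_tendstoD) auto
  then obtain m where m: "(\<integral>x. \<bar>f x - cl m (f x) * ch m x\<bar> \<partial>lborel) < e/2"
    by (meson eventually_happens sequentially_bot)
  have "f measurable_on UNIV"
    by (intro lebesgue_measurable_imp_measurable_on measurable_completion) auto
  then obtain N g where N: "negligible N" and g: "\<And>n. continuous_on UNIV (g n)"
    and lim: "\<And>x. x \<notin> N \<Longrightarrow> (\<lambda>n. g n x) \<longlonglongrightarrow> f x"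
    unfolding measurable_on_def by auto
  have aeN: "AE x in lborel. x \<notin> N"
  proof -
    have "AE x in lebesgue. x \<notin> N" using N by (auto simp: negligible_iff_null_sets intro: AE_not_in)
    then show ?thesis using AE_completion_iff by blast
  qed
  \<comment> \<open>The \<open>g n\<close> converge to \<open>f\<close> off a negligible set but
    have no common bound. Truncating them like \<open>f\<close> gives the bound m and a common ball
    outside which they vanish.\<close>
  define h where "h n x = cl m (g n x) * ch m x" for n x
  have h_cont: "continuous_on UNIV (h n)" for n
    unfolding h_def using g cl_cont ch_cont
    by (intro continuous_intros continuous_on_compose2[of UNIV "cl m" UNIV "g n"])
       (auto intro: continuous_at_imp_continuous_on)
  then have h_meas[measurable]: "h n \<in> borel_measurable borel" for n by (rule borel_measurable_continuous_onI)
  have h_supp: "h n x = 0" if "norm x > real m + 1" for n x using ch_supp[OF that] by (simp add: h_def)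
  have h_int: "integrable lborel (h n)" for n
    by (rule integrable_lborel_bounded_support[where M="real m" and R="real m + 1"])
       (use h_supp bd in \<open>auto simp: h_def\<close>)
  have f_int: "integrable lborel (\<lambda>x. cl m (f x) * ch m x)"
    by (rule Bochner_Integration.integrable_bound[OF f]) (use bd in auto)
  have "(\<lambda>n. \<integral>x. \<bar>cl m (f x) * ch m x - h n x\<bar> \<partial>lborel) \<longlonglongrightarrow> (\<integral>x. 0 \<partial>(lborel :: 'a measure))"
  proof (rule integral_dominated_convergence[where w="\<lambda>x. 2 * real m * indicator (cball 0 (real m + 1)) x"])
    show "AE x in lborel. (\<lambda>n. \<bar>cl m (f x) * ch m x - h n x\<bar>) \<longlonglongrightarrow> 0"
      using aeN
    proof eventually_elim
      case (elim x)
      have "(\<lambda>n. cl m (g n x)) \<longlonglongrightarrow> cl m (f x)"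
        using isCont_tendsto_compose[OF cl_cont lim[OF elim]] .
      then have "(\<lambda>n. \<bar>cl m (f x) * ch m x - h n x\<bar>) \<longlonglongrightarrow> \<bar>cl m (f x) * ch m x - cl m (f x) * ch m x\<bar>"
        unfolding h_def by (intro tendsto_intros)
      then show ?case by simp
    qed
    show "AE x in lborel. norm \<bar>cl m (f x) * ch m x - h n x\<bar> \<le> 2 * real m * indicator (cball 0 (real m + 1)) x" for n
    proof (rule AE_I2)
      fix x
      show "norm \<bar>cl m (f x) * ch m x - h n x\<bar> \<le> 2 * real m * indicator (cball 0 (real m + 1)) x"
        using bd(1)[of m "f x" x] bd(1)[of m "g n x" x] ch_supp[of m x]
        by (cases "norm x > real m + 1") (auto simp: h_def)
    qed
    show "integrable lborel (\<lambda>x. 2 * real m * indicator (cball (0::'a) (real m + 1)) x)"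
      by (intro integrable_mult_right integrable_real_indicator) (use emeasure_lborel_cball_finite in auto)
  qed auto
  then have "\<forall>\<^sub>F n in sequentially. (\<integral>x. \<bar>cl m (f x) * ch m x - h n x\<bar> \<partial>lborel) < e/2"
    using e by (intro order_tendstoD) auto
  then obtain n where n: "(\<integral>x. \<bar>cl m (f x) * ch m x - h n x\<bar> \<partial>lborel) < e/2"
    by (meson eventually_happens sequentially_bot)
  have "(\<integral>x. \<bar>f x - h n x\<bar> \<partial>lborel) \<le> (\<integral>x. \<bar>f x - cl m (f x) * ch m x\<bar> + \<bar>cl m (f x) * ch m x - h n x\<bar> \<partial>lborel)"
    by (rule integral_mono) (use f f_int h_int in auto)
  also have "\<dots> = (\<integral>x. \<bar>f x - cl m (f x) * ch m x\<bar> \<partial>lborel) + (\<integral>x. \<bar>cl m (f x) * ch m x - h n x\<bar> \<partial>lborel)"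
    by (rule Bochner_Integration.integral_add) (use f f_int h_int in auto)
  finally have "(\<integral>x. \<bar>f x - h n x\<bar> \<partial>lborel) < e" using m n by linarith
  then show ?thesis using that h_cont h_supp h_int by blast
qed

text \<open>An e/3 argument: \<open>f\<close> is exchanged for a continuous \<open>g\<close> both
  before and after the shift, at equal cost by translation invariance, and uniform continuity of
  \<open>g\<close> does the rest.\<close>

lemma integral_translation_continuous:
  fixes f :: "'a::euclidean_space \<Rightarrow> real"
  assumes f: "integrable lborel f" and e: "e > 0"
  obtains d where "d > 0" "\<And>y. norm y < d \<Longrightarrow> (\<integral>x. \<bar>f (x - y) - f x\<bar> \<partial>lborel) \<le> e"
proof -
  obtain g R where gc: "continuous_on UNIV g" and gs: "\<And>x. norm x > R \<Longrightarrow> g x = 0"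
    and gi: "integrable lborel g" and fg: "(\<integral>x. \<bar>f x - g x\<bar> \<partial>lborel) < e/3"
    using integrable_approx_continuous[OF f, of "e/3"] e by auto
  define v where "v = measure lborel (cball (0::'a) (R+1))"
  have v: "v \<ge> 0" by (simp add: v_def)
  \<comment> \<open>Shifts are kept shorter than 1: outside the ball of radius R + 1 both x and x -
    y lie where \<open>g\<close> vanishes, and inside it x - y stays in the ball of radius R + 2.
    The later denominator v + 1 is positive even if v = 0.\<close>
  have "uniformly_continuous_on (cball 0 (R+2)) g"
    by (intro compact_uniformly_continuous continuous_on_subset[OF gc]) auto
  then obtain d where d: "d > 0" and dd: "\<And>x x'. x \<in> cball 0 (R+2) \<Longrightarrow> x' \<in> cball 0 (R+2) \<Longrightarrow> dist x' x < d
     \<Longrightarrow> dist (g x') (g x) < e/3/(v+1)"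
    unfolding uniformly_continuous_on_def using e v
    by (metis add_nonneg_pos divide_pos_pos zero_less_numeral zero_less_one)
  have [measurable]: "f \<in> borel_measurable borel" "g \<in> borel_measurable borel" using f gi by auto
  have "(\<integral>x. \<bar>f (x - y) - f x\<bar> \<partial>lborel) \<le> e" if y: "norm y < min d 1" for y
  proof -
    have sh: "integrable lborel (\<lambda>x. f (x - y))" "integrable lborel (\<lambda>x. g (x - y))"
      using f gi integrable_lborel_shift[of f "-y"] integrable_lborel_shift[of g "-y"] by auto
    have pt: "\<bar>g (x - y) - g x\<bar> \<le> e/3/(v+1) * indicator (cball 0 (R+1)) x" for x
    proof (cases "x \<in> cball 0 (R+1)")
      case True
      have "norm (x - y) \<le> norm x + norm y" by (rule norm_triangle_ineq4)
      then have "x - y \<in> cball 0 (R+2)" "x \<in> cball 0 (R+2)" using True y by auto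
      from dd[OF this(2) this(1)] show ?thesis using True y by (auto simp: dist_norm)
    next
      case False
      have "norm x \<le> norm (x - y) + norm y" using norm_triangle_ineq[of "x - y" y] by simp
      then have "norm (x - y) > R" "norm x > R" using False y by auto
      then show ?thesis using gs False by auto
    qed
    have ii: "integrable lborel (\<lambda>x. e/3/(v+1) * indicator (cball (0::'a) (R+1)) x)"
      by (intro integrable_mult_right integrable_real_indicator) (use emeasure_lborel_cball_finite in auto)
    have "(\<integral>x. \<bar>f (x - y) - f x\<bar> \<partial>lborel) \<le>
      (\<integral>x. (\<bar>f (x - y) - g (x - y)\<bar> + e/3/(v+1) * indicator (cball 0 (R+1)) x) + \<bar>f x - g x\<bar> \<partial>lborel)"
    proof (rule integral_mono)
      fix x show "\<bar>f (x - y) - f x\<bar> \<le> (\<bar>f (x - y) - g (x - y)\<bar> + e/3/(v+1) * indicator (cball 0 (R+1)) x) + \<bar>f x - g x\<bar>"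
        using pt[of x] by linarith
    qed (use sh f gi ii in auto)
    also have "\<dots> = (\<integral>x. \<bar>f (x - y) - g (x - y)\<bar> \<partial>lborel) + e/3/(v+1) * v + (\<integral>x. \<bar>f x - g x\<bar> \<partial>lborel)"
      using sh f gi ii by (simp add: v_def)
    also have "(\<integral>x. \<bar>f (x - y) - g (x - y)\<bar> \<partial>lborel) = (\<integral>x. \<bar>f x - g x\<bar> \<partial>lborel)"
      using integral_lborel_shift[of "\<lambda>x. \<bar>f x - g x\<bar>" "-y"] by simp
    also have "e/3/(v+1) * v \<le> e/3"
      using v e by (simp add: field_simps)
    finally show ?thesis using fg by linarith
  qed
  then show ?thesis using that[of "min d 1"] d by auto
qed

definition convol :: "('a::euclidean_space \<Rightarrow> real) \<Rightarrow> ('a \<Rightarrow> real) \<Rightarrow> 'a \<Rightarrow> real" where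
  "convol f k x = (\<integral>y. f y * k (x - y) \<partial>lborel)"

text \<open>Since \<open>k\<close> has mass 1, the difference of the convolution and
  \<open>f\<close> is the \<open>k\<close>-average of f(x - y) - f(x). Tonelli puts the x-integral
  inside, where it is at most e on the support of \<open>k\<close>. Arguing with nonnegative
  integrals makes integrability of the convolution a conclusion instead of a premise.\<close>

lemma convol_L1_close:
  fixes f k :: "'a::euclidean_space \<Rightarrow> real"
  assumes f: "integrable lborel f" and k: "integrable lborel k" "\<And>x. 0 \<le> k x" "\<And>x. k x \<le> M"
    "(\<integral>x. k x \<partial>lborel) = 1" and supp: "\<And>x. norm x \<ge> d \<Longrightarrow> k x = 0"
    and e: "\<And>y. norm y < d \<Longrightarrow> (\<integral>x. \<bar>f (x - y) - f x\<bar> \<partial>lborel) \<le> e"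
  shows "integrable lborel (convol f k)" "(\<integral>x. \<bar>convol f k x - f x\<bar> \<partial>lborel) \<le> e"
proof -
  have [measurable]: "f \<in> borel_measurable borel" "k \<in> borel_measurable borel" using f k by auto
  have "d > 0"
  proof (rule ccontr)
    assume "\<not> d > 0"
    then have "k = (\<lambda>_. 0)" using supp by (intro ext) (smt (verit) norm_ge_zero)
    then show False using k(4) by simp
  qed
  have e0: "0 \<le> e" using e[of 0] \<open>d > 0\<close> by simp
  have [measurable]: "convol f k \<in> borel_measurable borel"
    unfolding convol_def by measurable
  have fs: "integrable lborel (\<lambda>y. f (x - y))" for x using f integrable_lborel_reflect[of f x] by simp
  have fk: "integrable lborel (\<lambda>y. f (x - y) * k y)" for x
  proof (rule Bochner_Integration.integrable_bound[of _ "\<lambda>y. M * f (x - y)"])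
    show "AE y in lborel. norm (f (x - y) * k y) \<le> norm (M * f (x - y))"
    proof (rule AE_I2)
      fix y
      have "\<bar>k y\<bar> \<le> \<bar>M\<bar>" using k(2,3)[of y] by linarith
      then show "norm (f (x - y) * k y) \<le> norm (M * f (x - y))"
        by (simp add: abs_mult mult.commute[of "\<bar>f (x - y)\<bar>"] mult_right_mono)
    qed
  qed (use fs in auto)
  have cv: "convol f k x - f x = (\<integral>y. (f (x - y) - f x) * k y \<partial>lborel)" for x
  proof -
    have "convol f k x = (\<integral>y. f (x - y) * k y \<partial>lborel)"
      unfolding convol_def using integral_lborel_reflect[of "\<lambda>y. f y * k (x - y)" x] by simp
    moreover have "f x = (\<integral>y. f x * k y \<partial>lborel)" using k(4) by simp
    ultimately show ?thesis
      using Bochner_Integration.integral_diff[OF fk[of x] integrable_mult_right[OF k(1), of "f x"]]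
      by (simp add: left_diff_distrib)
  qed
  have "(\<integral>\<^sup>+x. ennreal \<bar>convol f k x - f x\<bar> \<partial>lborel) \<le> (\<integral>\<^sup>+x. (\<integral>\<^sup>+y. ennreal (\<bar>f (x - y) - f x\<bar> * k y) \<partial>lborel) \<partial>lborel)"
  proof (rule nn_integral_mono)
    fix x
    have i: "integrable lborel (\<lambda>y. (f (x - y) - f x) * k y)"
      using fk[of x] k(1) by (simp add: left_diff_distrib)
    show "ennreal \<bar>convol f k x - f x\<bar> \<le> (\<integral>\<^sup>+y. ennreal (\<bar>f (x - y) - f x\<bar> * k y) \<partial>lborel)"
      using integral_norm_bound_ennreal[OF i] k(2) by (simp add: cv abs_mult)
  qed
  also have "\<dots> = (\<integral>\<^sup>+y. (\<integral>\<^sup>+x. ennreal (\<bar>f (x - y) - f x\<bar> * k y) \<partial>lborel) \<partial>lborel)"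
    by (rule lborel_pair.Fubini') measurable
  also have "\<dots> \<le> (\<integral>\<^sup>+y. ennreal e * ennreal (k y) \<partial>lborel)"
  proof (rule nn_integral_mono)
    fix y
    have "integrable lborel (\<lambda>x. f (x - y))" using f integrable_lborel_shift[of f "-y"] by simp
    then have "(\<integral>\<^sup>+x. ennreal \<bar>f (x - y) - f x\<bar> \<partial>lborel) = ennreal (\<integral>x. \<bar>f (x - y) - f x\<bar> \<partial>lborel)"
      using f by (intro nn_integral_eq_integral) auto
    moreover have "(\<integral>\<^sup>+x. ennreal (\<bar>f (x - y) - f x\<bar> * k y) \<partial>lborel) = (\<integral>\<^sup>+x. ennreal \<bar>f (x - y) - f x\<bar> \<partial>lborel) * ennreal (k y)"
      using k(2) by (simp add: ennreal_mult nn_integral_multc)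
    ultimately show "(\<integral>\<^sup>+x. ennreal (\<bar>f (x - y) - f x\<bar> * k y) \<partial>lborel) \<le> ennreal e * ennreal (k y)"
      using e[of y] supp[of y] by (cases "norm y < d") (auto intro!: mult_right_mono ennreal_leI)
  qed
  also have "\<dots> = ennreal e"
    using k nn_integral_eq_integral[OF k(1)] by (simp add: nn_integral_cmult)
  finally have le: "(\<integral>\<^sup>+x. ennreal \<bar>convol f k x - f x\<bar> \<partial>lborel) \<le> ennreal e" .
  have i: "integrable lborel (\<lambda>x. convol f k x - f x)"
    using le by (intro integrableI_bounded) (auto intro: le_less_trans)
  from Bochner_Integration.integrable_add[OF i f] show "integrable lborel (convol f k)" by simp
  have "ennreal (\<integral>x. \<bar>convol f k x - f x\<bar> \<partial>lborel) \<le> ennreal e"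
    using le nn_integral_eq_integral[of lborel "\<lambda>x. \<bar>convol f k x - f x\<bar>"] i by simp
  then show "(\<integral>x. \<bar>convol f k x - f x\<bar> \<partial>lborel) \<le> e" using e0 by simp
qed

section \<open>Mollifiers\<close>

text \<open>Each radius is normalised by its own integral instead of rescaling one profile, so no
  change of variables occurs.\<close>

definition mollifier :: "real \<Rightarrow> 'a::euclidean_space \<Rightarrow> real" where
  "mollifier e x = bump e x / (\<integral>y. bump e (y::'a) \<partial>lborel)"

lemma smooth_fun_continuous: "smooth_fun f \<Longrightarrow> continuous_on UNIV f"
  unfolding smooth_fun_def by (metis Ck.simps(1))

lemma smooth_fun_has_derivative: "smooth_fun f \<Longrightarrow> (f has_derivative frechet_derivative f (at x)) (at x)"
  unfolding smooth_fun_def by (metis Ck.simps(2) frechet_derivative_works)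

lemma smooth_fun_continuous_partial:
  "smooth_fun f \<Longrightarrow> b \<in> Basis \<Longrightarrow> continuous_on UNIV (\<lambda>x. frechet_derivative f (at x) b)"
  unfolding smooth_fun_def by (metis Ck.simps)

lemma smooth_fun_has_directional_derivative:
  assumes "smooth_fun f"
  shows "((\<lambda>t. f (x + t *\<^sub>R b)) has_real_derivative frechet_derivative f (at (x + t *\<^sub>R b)) b) (at t)"
proof -
  have "((\<lambda>t. x + t *\<^sub>R b) has_derivative (\<lambda>h. h *\<^sub>R b)) (at t)"
    by (auto intro!: derivative_eq_intros)
  from has_derivative_compose[OF this smooth_fun_has_derivative[OF assms]]
  have "((\<lambda>t. f (x + t *\<^sub>R b)) has_derivative (\<lambda>h. frechet_derivative f (at (x + t *\<^sub>R b)) (h *\<^sub>R b))) (at t)" .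
  moreover have "linear (frechet_derivative f (at (x + t *\<^sub>R b)))"
    using smooth_fun_has_derivative[OF assms] by (rule has_derivative_linear)
  ultimately show ?thesis
    unfolding has_field_derivative_def by (simp add: linear_cmul mult_commute_abs)
qed

lemma continuous_compact_support_bounded:
  fixes h :: "'a::euclidean_space \<Rightarrow> real"
  assumes "continuous_on UNIV h" "compact K" "\<And>x. x \<notin> K \<Longrightarrow> h x = 0"
  obtains M where "M \<ge> 0" "\<And>x. \<bar>h x\<bar> \<le> M"
proof -
  have "bounded (h ` K)"
    by (intro compact_imp_bounded compact_continuous_image continuous_on_subset[OF assms(1)]) (use assms in auto)
  then obtain M where M: "\<And>x. x \<in> K \<Longrightarrow> \<bar>h x\<bar> \<le> M" unfolding bounded_iff by auto
  show ?thesis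
  proof (rule that[of "max M 0"])
    fix x show "\<bar>h x\<bar> \<le> max M 0" using M[of x] assms(3)[of x] by (cases "x \<in> K") auto
  qed simp
qed

lemma frechet_derivative_eq_0_outside:
  assumes "closed K" "\<And>x. x \<notin> K \<Longrightarrow> h x = 0" "x \<notin> K"
  shows "frechet_derivative h (at x) b = (0::real)"
proof -
  have "((\<lambda>_. 0::real) has_derivative (\<lambda>_. 0)) (at x)" by simp
  then have "(h has_derivative (\<lambda>_. 0)) (at x)"
    by (rule has_derivative_transform_within_open[where s="-K"]) (use assms in auto)
  then have "frechet_derivative h (at x) = (\<lambda>_. 0)" by (metis frechet_derivative_at)
  then show ?thesis by simp
qed

lemma bump_eq_0: "e > 0 \<Longrightarrow> norm x \<ge> e \<Longrightarrow> bump e x = 0"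
  using power_mono[of e "norm x" 2] by (simp add: bump_def flat_def power2_norm_eq_inner)

lemma bump_nonneg: "bump e x \<ge> 0"
  by (simp add: bump_def flat_1_nonneg)

lemma bump_pos: "norm x < e \<Longrightarrow> bump e x > 0"
  using power_strict_mono[of "norm x" e 2] by (simp add: bump_def flat_1_pos_iff power2_norm_eq_inner)

lemma bump_minus: "bump e (- x) = bump e x"
  by (simp add: bump_def)

lemma integral_bump_pos:
  assumes "e > 0"
  shows "integrable lborel (bump e :: 'a::euclidean_space \<Rightarrow> real)" "(\<integral>x. bump e (x::'a) \<partial>lborel) > 0"
proof -
  have c: "continuous_on UNIV (bump e :: 'a \<Rightarrow> real)"
    using smooth_fun_continuous[OF smooth_bump[of e "0::'a"]] by (simp add: bump_minus)
  obtain M where M: "\<And>x::'a. \<bar>bump e x\<bar> \<le> M"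
    by (rule continuous_compact_support_bounded[OF c, of "cball 0 e"]) (auto simp: bump_eq_0[OF assms])
  show i: "integrable lborel (bump e :: 'a \<Rightarrow> real)"
    by (rule integrable_lborel_bounded_support[of _ M e])
       (use M c in \<open>auto intro: borel_measurable_continuous_onI simp: bump_eq_0[OF assms]\<close>)
  have "(\<integral>x. bump e (x::'a) \<partial>lborel) \<noteq> 0"
  proof
    assume "(\<integral>x. bump e (x::'a) \<partial>lborel) = 0"
    then have "AE x::'a in lborel. bump e x = 0"
      using integral_nonneg_eq_0_iff_AE[OF i] bump_nonneg by auto
    then have "AE x::'a in lborel. x \<notin> ball 0 e"
      by eventually_elim (use bump_pos in fastforce)
    then have "AE x::'a in lebesgue. x \<notin> ball 0 e" by (rule AE_completion)
    then have "negligible (ball (0::'a) e)"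
      using AE_iff_null_sets[of "ball 0 e" "lebesgue :: 'a measure"] by (simp add: negligible_iff_null_sets)
    then show False using open_not_negligible[of "ball (0::'a) e"] assms by auto
  qed
  moreover have "(\<integral>x. bump e (x::'a) \<partial>lborel) \<ge> 0" by (intro Bochner_Integration.integral_nonneg bump_nonneg)
  ultimately show "(\<integral>x. bump e (x::'a) \<partial>lborel) > 0" by simp
qed

lemma smooth_mollifier: "smooth_fun (\<lambda>y. mollifier e (x - y))"
proof -
  have "Ck k (\<lambda>y. bump e (x - y) * (1 / (\<integral>y. bump e (y::'a) \<partial>lborel)))" for k
    using smooth_bump[of e x] by (intro Ck_mult Ck_const) (auto simp: smooth_fun_def)
  then show ?thesis by (simp add: smooth_fun_def mollifier_def)
qed

lemma smooth_mollifier_0: "smooth_fun (mollifier e)"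
  using smooth_mollifier[of e 0] by (simp add: mollifier_def[abs_def] bump_minus)

lemma mollifier_eq_0: "e > 0 \<Longrightarrow> norm x \<ge> e \<Longrightarrow> mollifier e x = 0"
  by (simp add: mollifier_def bump_eq_0)

lemma mollifier_nonneg: "e > 0 \<Longrightarrow> mollifier e x \<ge> 0"
  using integral_bump_pos(2) by (auto simp: mollifier_def intro!: divide_nonneg_pos bump_nonneg)

lemma integrable_mollifier: "e > 0 \<Longrightarrow> integrable lborel (mollifier e)"
  unfolding mollifier_def[abs_def] using integral_bump_pos(1) by auto

lemma integral_mollifier: "e > 0 \<Longrightarrow> (\<integral>x. mollifier e (x::'a::euclidean_space) \<partial>lborel) = 1"
  using integral_bump_pos(2)[of e, where 'a='a] by (simp add: mollifier_def)

lemma mollifier_bounded: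
  assumes "e > 0" obtains M where "\<And>x::'a::euclidean_space. \<bar>mollifier e x\<bar> \<le> M"
  by (rule continuous_compact_support_bounded[OF smooth_fun_continuous[OF smooth_mollifier_0], of "cball 0 e"])
     (auto simp: mollifier_eq_0[OF assms])

lemma test_fun_mollifier:
  assumes "e > 0" "cball x e \<subseteq> \<Omega>"
  shows "test_fun \<Omega> (\<lambda>y. mollifier e (x - y))"
proof -
  have "{y. mollifier e (x - y) \<noteq> 0} \<subseteq> cball x e"
  proof
    fix y assume "y \<in> {y. mollifier e (x - y) \<noteq> 0}"
    then have "\<not> norm (x - y) \<ge> e" using mollifier_eq_0[OF assms(1), of "x - y"] by auto
    then show "y \<in> cball x e" by (simp add: dist_norm)
  qed
  then have "closure {y. mollifier e (x - y) \<noteq> 0} \<subseteq> cball x e"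
    by (rule closure_minimal) simp
  moreover have "compact (cball x e)" by simp
  ultimately show ?thesis unfolding test_fun_def
    using smooth_mollifier assms compact_Int_closed[of "cball x e" "closure {y. mollifier e (x - y) \<noteq> 0}"]
    by (auto simp: Int_absorb1)
qed

text \<open>An instance of \<open>convol_L1_close\<close> with a crude constant: every translate of
  \<open>f\<close> is within twice the L^1 norm of \<open>f\<close>.\<close>

lemma integrable_convol_mollifier:
  fixes f :: "'a::euclidean_space \<Rightarrow> real"
  assumes f: "integrable lborel f" and e: "e > 0"
  shows "integrable lborel (convol f (mollifier e))"
proof -
  obtain M where M: "\<And>x::'a. \<bar>mollifier e x\<bar> \<le> M" using mollifier_bounded[OF e] by auto
  have [measurable]: "f \<in> borel_measurable borel" using f by auto
  have "(\<integral>x. \<bar>f (x - y) - f x\<bar> \<partial>lborel) \<le> 2 * (\<integral>x. \<bar>f x\<bar> \<partial>lborel)" for y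
  proof -
    have i: "integrable lborel (\<lambda>x. f (x - y))" using f integrable_lborel_shift[of f "-y"] by simp
    have "(\<integral>x. \<bar>f (x - y) - f x\<bar> \<partial>lborel) \<le> (\<integral>x. \<bar>f (x - y)\<bar> + \<bar>f x\<bar> \<partial>lborel)"
      by (rule integral_mono) (use f i in auto)
    also have "\<dots> = (\<integral>x. \<bar>f (x - y)\<bar> \<partial>lborel) + (\<integral>x. \<bar>f x\<bar> \<partial>lborel)"
      by (rule Bochner_Integration.integral_add) (use f i in auto)
    also have "(\<integral>x. \<bar>f (x - y)\<bar> \<partial>lborel) = (\<integral>x. \<bar>f x\<bar> \<partial>lborel)"
      using integral_lborel_shift[of "\<lambda>x. \<bar>f x\<bar>" "-y"] by simp
    finally show ?thesis by simp
  qed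
  then show ?thesis
  proof (intro convol_L1_close(1)[OF f integrable_mollifier[OF e] mollifier_nonneg[OF e] _ integral_mollifier[OF e]])
    show "mollifier e x \<le> M" for x :: 'a using M[of x] by linarith
    show "mollifier e x = 0" if "norm x \<ge> e" for x :: 'a using that e by (intro mollifier_eq_0) auto
  qed
qed

lemma convol_mollifier_tendsto:
  fixes f :: "'a::euclidean_space \<Rightarrow> real"
  assumes f: "integrable lborel f"
  shows "(\<lambda>n. \<integral>x. \<bar>convol f (mollifier (1 / Suc n)) x - f x\<bar> \<partial>lborel) \<longlonglongrightarrow> 0"
proof (rule tendstoI)
  fix e :: real assume e: "e > 0"
  obtain d where d: "d > 0" "\<And>y. norm y < d \<Longrightarrow> (\<integral>x. \<bar>f (x - y) - f x\<bar> \<partial>lborel) \<le> e/2"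
    using integral_translation_continuous[OF f, of "e/2"] e by auto
  have "\<forall>\<^sub>F n in sequentially. 1 / Suc n < d"
    using LIMSEQ_inverse_real_of_nat order_tendstoD(2)[of _ 0 sequentially d] d(1) by (simp add: inverse_eq_divide)
  then show "\<forall>\<^sub>F n in sequentially. dist (\<integral>x. \<bar>convol f (mollifier (1 / Suc n)) x - f x\<bar> \<partial>lborel) 0 < e"
  proof eventually_elim
    case (elim n)
    obtain M where M: "\<And>x::'a. \<bar>mollifier (1 / Suc n) x\<bar> \<le> M" using mollifier_bounded[of "1 / Suc n"] by auto
    have "(\<integral>x. \<bar>convol f (mollifier (1 / Suc n)) x - f x\<bar> \<partial>lborel) \<le> e/2"
    proof (rule convol_L1_close(2)[OF f integrable_mollifier mollifier_nonneg _ integral_mollifier _ d(2)])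
      show "mollifier (1 / Suc n) x \<le> M" for x :: 'a using M[of x] by linarith
      show "mollifier (1 / Suc n) x = 0" if "norm x \<ge> d" for x :: 'a using that elim by (intro mollifier_eq_0) auto
    qed auto
    then show ?case using e by simp
  qed
qed

text \<open>Weak gradients live on \<open>lebesgue_on \<Omega>\<close>, whereas convolutions are
  formed from Borel functions on the whole space. The passage takes a Borel representative extended
  by zero; \<open>integral_lebesgue_on_eq_lborel\<close> transfers the integrals.\<close>

lemma lebesgue_on_borel_rep:
  fixes f :: "'a::euclidean_space \<Rightarrow> real"
  assumes \<Omega>: "open \<Omega>" and f: "integrable (lebesgue_on \<Omega>) f"
  obtains g where "g \<in> borel_measurable borel" "integrable lborel g" "\<And>x. x \<notin> \<Omega> \<Longrightarrow> g x = 0"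
    "AE x in lborel. x \<in> \<Omega> \<longrightarrow> f x = g x"
proof -
  have [measurable]: "\<Omega> \<in> sets borel" using \<Omega> by simp
  have i: "integrable lebesgue (\<lambda>x. indicator \<Omega> x *\<^sub>R f x)"
    using f by (subst (asm) integrable_restrict_space) (use \<Omega> in auto)
  then obtain g where g[measurable]: "g \<in> borel_measurable lborel" and ae: "AE x in lborel. indicator \<Omega> x *\<^sub>R f x = g x"
    using completion_ex_borel_measurable_real[OF borel_measurable_integrable] by blast
  have [measurable]: "g \<in> borel_measurable borel" using g by simp
  let ?g = "\<lambda>x. indicator \<Omega> x * g x"
  have eq: "AE x in lborel. indicator \<Omega> x *\<^sub>R f x = ?g x"
    using ae by eventually_elim (auto split: split_indicator)
  have "integrable lebesgue ?g"
    by (rule Bochner_Integration.integrable_cong_AE_imp[OF i])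
       (use AE_completion[OF eq] in \<open>auto intro!: measurable_completion\<close>)
  then have "integrable lborel ?g" by (subst (asm) integrable_completion) auto
  then show ?thesis
    by (intro that[of ?g]) (use eq in \<open>auto elim!: eventually_mono\<close>)
qed

lemma integral_lebesgue_on_eq_lborel:
  fixes f g :: "'a::euclidean_space \<Rightarrow> real"
  assumes \<Omega>: "open \<Omega>" and g: "g \<in> borel_measurable borel" "\<And>x. x \<notin> \<Omega> \<Longrightarrow> g x = 0"
    and ae: "AE x in lborel. x \<in> \<Omega> \<longrightarrow> f x = g x"
  shows "(\<integral>x. f x \<partial>lebesgue_on \<Omega>) = (\<integral>x. g x \<partial>lborel)"
proof -
  have eq: "AE x in lebesgue. indicator \<Omega> x *\<^sub>R f x = g x"
    using AE_completion[OF ae] by eventually_elim (use g(2) in \<open>auto split: split_indicator\<close>)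
  have gm: "g \<in> borel_measurable lebesgue" using g(1) by (intro measurable_completion) auto
  then have "(\<lambda>x. indicator \<Omega> x *\<^sub>R f x) \<in> borel_measurable lebesgue"
    by (rule borel_measurable_AE) (use eq in \<open>eventually_elim, simp\<close>)
  have "(\<integral>x. f x \<partial>lebesgue_on \<Omega>) = (\<integral>x. indicator \<Omega> x *\<^sub>R f x \<partial>lebesgue)"
    by (rule integral_restrict_space) (use \<Omega> in auto)
  also have "\<dots> = (\<integral>x. g x \<partial>lebesgue)"
    by (rule integral_cong_AE) fact+
  also have "\<dots> = (\<integral>x. g x \<partial>lborel)" using g(1) by (intro integral_completion) auto
  finally show ?thesis .
qed

section \<open>Directional derivatives of convolutions and the fundamental lemma\<close>

lemma real_derivative_bound_imp_lipschitz:
  fixes g g' :: "real \<Rightarrow> real"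
  assumes "\<And>t. (g has_real_derivative g' t) (at t)" "\<And>t. \<bar>g' t\<bar> \<le> M"
  shows "\<bar>g s - g t\<bar> \<le> M * \<bar>s - t\<bar>"
  using field_differentiable_bound[of UNIV g g' M s t] assms by auto

lemma difference_quotient_tendsto:
  fixes x b :: "'a::real_vector"
  assumes "\<And>t. ((\<lambda>t. g (x + t *\<^sub>R b)) has_real_derivative g' (x + t *\<^sub>R b)) (at t)"
    and h: "h \<longlonglongrightarrow> 0" "\<And>n. h n \<noteq> (0::real)"
  shows "(\<lambda>n. (g (x + h n *\<^sub>R b) - g x) / h n) \<longlonglongrightarrow> g' x"
proof -
  have "((\<lambda>s. (g (x + s *\<^sub>R b) - g x) / s) \<longlongrightarrow> g' x) (at 0)"
    using assms(1)[of 0] by (simp add: has_field_derivative_iff)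
  then show ?thesis
    using h unfolding tendsto_at_iff_sequentially comp_def by auto
qed

text \<open>The derivative falls on the kernel: its difference quotients are bounded by M through
  the mean value estimate, so M |f| dominates. One direction at a time is enough, as weak gradients
  are tested against single basis vectors.\<close>

lemma convol_has_directional_derivative:
  fixes f k k' :: "'a::euclidean_space \<Rightarrow> real"
  assumes f: "integrable lborel f" and [measurable]: "k \<in> borel_measurable borel" "k' \<in> borel_measurable borel"
    and kb: "\<And>x. \<bar>k x\<bar> \<le> M"
    and k': "\<And>x t. ((\<lambda>t. k (x + t *\<^sub>R b)) has_real_derivative k' (x + t *\<^sub>R b)) (at t)" and k'b: "\<And>x. \<bar>k' x\<bar> \<le> M"
  shows "((\<lambda>t. convol f k (x + t *\<^sub>R b)) has_real_derivative convol f k' (x + t *\<^sub>R b)) (at t)"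
proof -
  have [measurable]: "f \<in> borel_measurable borel" using f by auto
  define z where "z = x + t *\<^sub>R b"
  have ik: "integrable lborel (\<lambda>y. f y * k (z - y))" for z
    by (rule Bochner_Integration.integrable_bound[of _ "\<lambda>y. M * f y"])
       (use f in \<open>auto simp: abs_mult mult.commute[of "\<bar>f _\<bar>"] intro!: AE_I2 mult_right_mono order_trans[OF kb]\<close>)
  have "((\<lambda>s. (convol f k (x + (t + s) *\<^sub>R b) - convol f k (x + t *\<^sub>R b)) / s) \<longlongrightarrow> convol f k' (x + t *\<^sub>R b)) (at 0)"
    unfolding tendsto_at_iff_sequentially comp_def
  proof (intro allI impI)
    fix h :: "nat \<Rightarrow> real" assume h0: "\<forall>i. h i \<in> UNIV - {0}" and hl: "h \<longlonglongrightarrow> 0"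
    have h: "h i \<noteq> 0" for i using h0 by auto
    have eq: "(convol f k (x + (t + h n) *\<^sub>R b) - convol f k (x + t *\<^sub>R b)) / h n =
       (\<integral>y. f y * ((k ((z - y) + h n *\<^sub>R b) - k (z - y)) / h n) \<partial>lborel)" for n
    proof -
      have "x + (t + h n) *\<^sub>R b = z + h n *\<^sub>R b" by (simp add: z_def scaleR_add_left)
      then have "convol f k (x + (t + h n) *\<^sub>R b) - convol f k (x + t *\<^sub>R b) =
         (\<integral>y. f y * k (z + h n *\<^sub>R b - y) - f y * k (z - y) \<partial>lborel)"
        unfolding convol_def using Bochner_Integration.integral_diff[OF ik ik] by (simp add: z_def add.assoc)
      then have "(convol f k (x + (t + h n) *\<^sub>R b) - convol f k (x + t *\<^sub>R b)) / h n =
         (\<integral>y. (f y * k (z + h n *\<^sub>R b - y) - f y * k (z - y)) / h n \<partial>lborel)" by simp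
      also have "\<dots> = (\<integral>y. f y * ((k ((z - y) + h n *\<^sub>R b) - k (z - y)) / h n) \<partial>lborel)"
        by (intro Bochner_Integration.integral_cong refl) (simp add: algebra_simps diff_divide_distrib)
      finally show ?thesis .
    qed
    have "(\<lambda>n. \<integral>y. f y * ((k ((z - y) + h n *\<^sub>R b) - k (z - y)) / h n) \<partial>lborel) \<longlonglongrightarrow> (\<integral>y. f y * k' (z - y) \<partial>lborel)"
    proof (rule integral_dominated_convergence[where w="\<lambda>y. M * \<bar>f y\<bar>"])
      show "AE y in lborel. (\<lambda>n. f y * ((k ((z - y) + h n *\<^sub>R b) - k (z - y)) / h n)) \<longlonglongrightarrow> f y * k' (z - y)"
        by (intro AE_I2 tendsto_intros difference_quotient_tendsto k' hl h)
      show "AE y in lborel. norm (f y * ((k ((z - y) + h n *\<^sub>R b) - k (z - y)) / h n)) \<le> M * \<bar>f y\<bar>" for n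
      proof (rule AE_I2)
        fix y
        have "\<bar>k ((z - y) + h n *\<^sub>R b) - k (z - y)\<bar> \<le> M * \<bar>h n\<bar>"
          using real_derivative_bound_imp_lipschitz[OF k' k'b, of "z - y" "h n" 0] by simp
        then have "\<bar>(k ((z - y) + h n *\<^sub>R b) - k (z - y)) / h n\<bar> \<le> M"
          using h[of n] by (simp add: abs_divide divide_le_eq)
        then show "norm (f y * ((k ((z - y) + h n *\<^sub>R b) - k (z - y)) / h n)) \<le> M * \<bar>f y\<bar>"
          unfolding real_norm_def abs_mult by (subst mult.commute) (rule mult_right_mono, auto)
      qed
    qed (use f in auto)
    then show "(\<lambda>n. (convol f k (x + (t + h n) *\<^sub>R b) - convol f k (x + t *\<^sub>R b)) / h n) \<longlonglongrightarrow> convol f k' (x + t *\<^sub>R b)"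
      unfolding eq by (simp add: convol_def z_def)
  qed
  then show ?thesis by (simp add: DERIV_def)
qed

lemma convol_bounded:
  fixes f k :: "'a::euclidean_space \<Rightarrow> real"
  assumes f: "integrable lborel f" and kb: "\<And>x. \<bar>k x\<bar> \<le> M"
  shows "\<bar>convol f k x\<bar> \<le> M * (\<integral>y. \<bar>f y\<bar> \<partial>lborel)"
proof -
  have "M \<ge> 0" using kb[of 0] by linarith
  have "\<bar>convol f k x\<bar> \<le> (\<integral>y. \<bar>f y * k (x - y)\<bar> \<partial>lborel)"
    unfolding convol_def by (rule integral_abs_bound)
  also have "\<dots> \<le> (\<integral>y. M * \<bar>f y\<bar> \<partial>lborel)"
  proof (rule integral_mono_AE')
    show "AE y in lborel. \<bar>f y * k (x - y)\<bar> \<le> M * \<bar>f y\<bar>"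
      using kb by (intro AE_I2) (simp add: abs_mult mult.commute[of "\<bar>f _\<bar>"] mult_right_mono)
  qed (use f \<open>M \<ge> 0\<close> in auto)
  finally show ?thesis by simp
qed

text \<open>This is integration by parts once \<open>g\<close> is a product. Every difference
  quotient has integral zero by translation invariance, and dominated convergence on a ball passes
  to the derivative.\<close>

lemma integral_directional_derivative_eq_0:
  fixes g g' :: "'a::euclidean_space \<Rightarrow> real"
  assumes [measurable]: "g \<in> borel_measurable borel" "g' \<in> borel_measurable borel"
    and gb: "\<And>x. \<bar>g x\<bar> \<le> M" and g'b: "\<And>x. \<bar>g' x\<bar> \<le> M" and supp: "\<And>x. norm x > R \<Longrightarrow> g x = 0"
    and g': "\<And>x t. ((\<lambda>t. g (x + t *\<^sub>R b)) has_real_derivative g' (x + t *\<^sub>R b)) (at t)" and b: "norm b \<le> 1"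
  shows "(\<integral>x. g' x \<partial>lborel) = 0"
proof -
  define h where "h n = 1 / real (Suc n)" for n
  have h: "h n \<noteq> 0" "0 \<le> h n" "h n \<le> 1" for n by (auto simp: h_def)
  have hl: "h \<longlonglongrightarrow> 0" unfolding h_def using LIMSEQ_inverse_real_of_nat by (simp add: inverse_eq_divide)
  have gi: "integrable lborel g" by (rule integrable_lborel_bounded_support[OF _ gb supp]) auto
  have M0: "M \<ge> 0" using gb[of 0] by linarith
  have lim: "(\<lambda>n. \<integral>x. (g (x + h n *\<^sub>R b) - g x) / h n \<partial>lborel) \<longlonglongrightarrow> (\<integral>x. g' x \<partial>lborel)"
  proof (rule integral_dominated_convergence[where w="\<lambda>x. M * indicator (cball 0 (R+1)) x"])
    show "integrable lborel (\<lambda>x. M * indicator (cball (0::'a) (R+1)) x)"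
      by (intro integrable_mult_right integrable_real_indicator) (use emeasure_lborel_cball_finite in auto)
    show "AE x in lborel. (\<lambda>n. (g (x + h n *\<^sub>R b) - g x) / h n) \<longlonglongrightarrow> g' x"
      by (intro AE_I2 difference_quotient_tendsto g' hl h)
    show "AE x in lborel. norm ((g (x + h n *\<^sub>R b) - g x) / h n) \<le> M * indicator (cball 0 (R+1)) x" for n
    proof (rule AE_I2)
      fix x
      have "\<bar>g (x + h n *\<^sub>R b) - g x\<bar> \<le> M * \<bar>h n\<bar>"
        using real_derivative_bound_imp_lipschitz[OF g' g'b, of x "h n" 0] by simp
      then have 1: "\<bar>(g (x + h n *\<^sub>R b) - g x) / h n\<bar> \<le> M"
        using h(1)[of n] by (simp add: abs_divide divide_le_eq)
      have 2: "(g (x + h n *\<^sub>R b) - g x) / h n = 0" if "norm x > R + 1"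
      proof -
        have "norm (h n *\<^sub>R b) \<le> 1" using h(2,3)[of n] b by (simp add: mult_le_one)
        moreover have "norm x \<le> norm (x + h n *\<^sub>R b) + norm (h n *\<^sub>R b)"
          using norm_triangle_ineq4[of "x + h n *\<^sub>R b" "h n *\<^sub>R b"] by simp
        ultimately have "norm (x + h n *\<^sub>R b) > R" "norm x > R" using that by linarith+
        then show ?thesis using supp by simp
      qed
      show "norm ((g (x + h n *\<^sub>R b) - g x) / h n) \<le> M * indicator (cball 0 (R+1)) x"
        using 1 2 by (cases "norm x > R + 1") auto
    qed
  qed auto
  have "(\<integral>x. (g (x + h n *\<^sub>R b) - g x) / h n \<partial>lborel) = 0" for n
    using gi integrable_lborel_shift[of g "h n *\<^sub>R b"] integral_lborel_shift[of g "h n *\<^sub>R b"] by simp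
  from LIMSEQ_unique[OF lim[unfolded this] tendsto_const] show ?thesis .
qed

lemma test_funD:
  assumes "test_fun \<Omega> \<phi>"
  obtains K where "compact K" "K \<subseteq> \<Omega>" "\<And>x. x \<notin> K \<Longrightarrow> \<phi> x = 0" "smooth_fun \<phi>"
proof (rule that[of "closure {x. \<phi> x \<noteq> 0}"])
  show "\<phi> x = 0" if "x \<notin> closure {x. \<phi> x \<noteq> 0}" for x
    using that closure_subset[of "{x. \<phi> x \<noteq> 0}"] by auto
qed (use assms in \<open>auto simp: test_fun_def\<close>)

lemma test_fun_measurable:
  assumes "test_fun \<Omega> \<phi>"
  shows "\<phi> \<in> borel_measurable borel" "b \<in> Basis \<Longrightarrow> (\<lambda>x. frechet_derivative \<phi> (at x) b) \<in> borel_measurable borel"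
  using assms smooth_fun_continuous[of \<phi>] smooth_fun_continuous_partial[of \<phi> b]
  unfolding test_fun_def by (blast intro: borel_measurable_continuous_onI)+

lemma test_fun_bounded:
  assumes "test_fun \<Omega> \<phi>" "b \<in> Basis"
  obtains M where "M \<ge> 0" "\<And>x. \<bar>\<phi> x\<bar> \<le> M" "\<And>x. \<bar>frechet_derivative \<phi> (at x) b\<bar> \<le> M"
proof -
  obtain K where K: "compact K" "K \<subseteq> \<Omega>" "\<And>x. x \<notin> K \<Longrightarrow> \<phi> x = 0" and sm: "smooth_fun \<phi>"
    using test_funD[OF assms(1)] by blast
  obtain M1 where M1: "\<And>x. \<bar>\<phi> x\<bar> \<le> M1"
    using continuous_compact_support_bounded[OF smooth_fun_continuous[OF sm] K(1,3)] by blast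
  obtain M2 where M2: "\<And>x. \<bar>frechet_derivative \<phi> (at x) b\<bar> \<le> M2"
    by (rule continuous_compact_support_bounded[OF smooth_fun_continuous_partial[OF sm assms(2)] K(1)
          frechet_derivative_eq_0_outside[OF compact_imp_closed[OF K(1)] K(3)]]) blast+
  show ?thesis
  proof (rule that[of "max M1 M2"])
    show "max M1 M2 \<ge> 0" using M1[of 0] by linarith
    show "\<bar>\<phi> x\<bar> \<le> max M1 M2" "\<bar>frechet_derivative \<phi> (at x) b\<bar> \<le> max M1 M2" for x
      using M1[of x] M2[of x] by linarith+
  qed
qed

lemma AE_lebesgue_on_iff:
  assumes "open \<Omega>"
  shows "(AE x in lebesgue_on \<Omega>. P x) \<longleftrightarrow> (AE x in lborel. x \<in> \<Omega> \<longrightarrow> P x)"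
  using assms by (subst AE_restrict_space_iff) (auto simp: AE_completion_iff)

text \<open>A mollifier centred at x is itself a test function once its ball lies in \<Omega>, so
  the mollified \<open>g\<close> vanishes at x for small radii. Along a subsequence the mollified
  functions converge to \<open>g\<close> almost everywhere.\<close>

theorem fundamental_lemma_calculus_of_variations:
  fixes g :: "'a::euclidean_space \<Rightarrow> real"
  assumes \<Omega>: "open \<Omega>" and g: "integrable (lebesgue_on \<Omega>) g"
    and 0: "\<And>\<phi>. test_fun \<Omega> \<phi> \<Longrightarrow> (\<integral>x. g x * \<phi> x \<partial>lebesgue_on \<Omega>) = 0"
  shows "AE x in lebesgue_on \<Omega>. g x = 0"
proof -
  obtain g' where [measurable]: "g' \<in> borel_measurable borel" and g': "integrable lborel g'" "\<And>x. x \<notin> \<Omega> \<Longrightarrow> g' x = 0"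
    "AE x in lborel. x \<in> \<Omega> \<longrightarrow> g x = g' x"
    using lebesgue_on_borel_rep[OF \<Omega> g] by blast
  have z: "convol g' (mollifier e) x = 0" if e: "e > 0" and x: "cball x e \<subseteq> \<Omega>" for e x
  proof -
    have t: "test_fun \<Omega> (\<lambda>y. mollifier e (x - y))" by (rule test_fun_mollifier[OF that])
    have [measurable]: "(\<lambda>y. mollifier e (x - y)) \<in> borel_measurable borel" by (rule test_fun_measurable[OF t])
    have "0 = (\<integral>y. g y * mollifier e (x - y) \<partial>lebesgue_on \<Omega>)" using 0[OF t] by simp
    also have "\<dots> = (\<integral>y. g' y * mollifier e (x - y) \<partial>lborel)"
      by (rule integral_lebesgue_on_eq_lborel[OF \<Omega>]) (use g' in \<open>auto elim!: eventually_mono\<close>)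
    finally show ?thesis by (simp add: convol_def)
  qed
  have "(\<lambda>n. \<integral>x. norm (convol g' (mollifier (1 / Suc n)) x - g' x) \<partial>lborel) \<longlonglongrightarrow> 0"
    using convol_mollifier_tendsto[OF g'(1)] by simp
  then obtain r where r: "strict_mono r"
    and "AE x in lborel. (\<lambda>n. convol g' (mollifier (1 / Suc (r n))) x - g' x) \<longlonglongrightarrow> 0"
    using tendsto_L1_AE_subseq[of lborel "\<lambda>n x. convol g' (mollifier (1 / Suc n)) x - g' x"]
      integrable_convol_mollifier[OF g'(1)] g'(1) by auto
  from this(2) have "AE x in lborel. x \<in> \<Omega> \<longrightarrow> g' x = 0"
  proof eventually_elim
    case (elim x)
    show ?case
    proof
      assume "x \<in> \<Omega>"
      then obtain e where e: "e > 0" "cball x e \<subseteq> \<Omega>" using \<Omega> open_contains_cball by blast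
      have "(\<lambda>n. 1 / real (Suc (r n))) \<longlonglongrightarrow> 0"
        using LIMSEQ_subseq_LIMSEQ[OF LIMSEQ_inverse_real_of_nat r] by (simp add: inverse_eq_divide comp_def)
      then have "\<forall>\<^sub>F n in sequentially. 1 / real (Suc (r n)) < e" using e(1) by (rule order_tendstoD)
      then have "\<forall>\<^sub>F n in sequentially. convol g' (mollifier (1 / Suc (r n))) x - g' x = - g' x"
      proof eventually_elim
        case (elim n)
        have "cball x (1 / Suc (r n)) \<subseteq> \<Omega>" using elim e(2) by (meson less_imp_le order_trans subset_cball)
        then show ?case using z[of "1 / Suc (r n)" x] by simp
      qed
      then have "(\<lambda>n. - g' x) \<longlonglongrightarrow> 0" by (rule Lim_transform_eventually[OF elim])
      then show "g' x = 0" using LIMSEQ_unique[OF tendsto_const] by force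
    qed
  qed
  then have "AE x in lborel. x \<in> \<Omega> \<longrightarrow> g x = 0" using g'(3) by eventually_elim auto
  then show ?thesis using AE_lebesgue_on_iff[OF \<Omega>] by blast
qed

section \<open>The chain rule for weak gradients\<close>

text \<open>Used to exchange one factor of an integrand for its L^1 limit while the remaining
  factors are bounded or Lipschitz with constant \<open>B\<close>.\<close>

lemma tendsto_integral_L1_perturb:
  fixes p q d :: "nat \<Rightarrow> 'b \<Rightarrow> real"
  assumes "\<And>n. integrable M (p n)" "\<And>n. integrable M (q n)" "\<And>n. integrable M (d n)"
    and le: "\<And>n x. \<bar>p n x - q n x\<bar> \<le> B * \<bar>d n x\<bar>" and d: "(\<lambda>n. \<integral>x. \<bar>d n x\<bar> \<partial>M) \<longlonglongrightarrow> 0"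
    and q: "(\<lambda>n. \<integral>x. q n x \<partial>M) \<longlonglongrightarrow> L"
  shows "(\<lambda>n. \<integral>x. p n x \<partial>M) \<longlonglongrightarrow> L"
proof -
  have "\<bar>(\<integral>x. p n x \<partial>M) - (\<integral>x. q n x \<partial>M)\<bar> \<le> B * (\<integral>x. \<bar>d n x\<bar> \<partial>M)" for n
  proof -
    have "\<bar>(\<integral>x. p n x \<partial>M) - (\<integral>x. q n x \<partial>M)\<bar> = \<bar>\<integral>x. p n x - q n x \<partial>M\<bar>"
      using assms(1,2) by simp
    also have "\<dots> \<le> (\<integral>x. \<bar>p n x - q n x\<bar> \<partial>M)" by (rule integral_abs_bound)
    also have "\<dots> \<le> (\<integral>x. B * \<bar>d n x\<bar> \<partial>M)" by (rule integral_mono[OF _ _ le]) (use assms(1-3) in auto)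
    finally show ?thesis unfolding integral_mult_right_zero .
  qed
  then have "\<forall>\<^sub>F n in sequentially. norm ((\<integral>x. p n x \<partial>M) - (\<integral>x. q n x \<partial>M)) \<le> B * (\<integral>x. \<bar>d n x\<bar> \<partial>M)"
    unfolding real_norm_def by (rule always_eventually[OF allI])
  from Lim_null_comparison[OF this tendsto_mult_right_zero[OF d]]
  have "(\<lambda>n. (\<integral>x. p n x \<partial>M) - (\<integral>x. q n x \<partial>M)) \<longlonglongrightarrow> 0" .
  from tendsto_add[OF this q] show ?thesis by simp
qed

lemma convol_measurable:
  assumes [measurable]: "f \<in> borel_measurable borel" "k \<in> borel_measurable borel"
  shows "convol f k \<in> borel_measurable borel"
  unfolding convol_def by measurable

text \<open>Mollification commutes with the weak derivative at points farther than e from the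
  complement: test the definition with y \<mapsto> \<open>mollifier e (x - y)\<close>. Its
  y-derivative is minus the derivative of the kernel, which cancels the sign in
  \<open>is_weak_grad\<close>.\<close>

lemma is_weak_grad_convol_mollifier:
  assumes \<Omega>: "open \<Omega>" and w: "is_weak_grad \<Omega> u G" and b: "b \<in> Basis" and e: "e > 0" "cball x e \<subseteq> \<Omega>"
    and u': "u' \<in> borel_measurable borel" "\<And>x. x \<notin> \<Omega> \<Longrightarrow> u' x = 0" "AE x in lborel. x \<in> \<Omega> \<longrightarrow> u x = u' x"
    and g': "g' \<in> borel_measurable borel" "\<And>x. x \<notin> \<Omega> \<Longrightarrow> g' x = 0" "AE x in lborel. x \<in> \<Omega> \<longrightarrow> G x \<bullet> b = g' x"
  shows "convol u' (\<lambda>y. frechet_derivative (mollifier e) (at y) b) x = convol g' (mollifier e) x"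
proof -
  let ?d = "\<lambda>y. frechet_derivative (mollifier e) (at y) b"
  have t: "test_fun \<Omega> (\<lambda>y. mollifier e (x - y))" by (rule test_fun_mollifier[OF e])
  have fd: "frechet_derivative (\<lambda>y. mollifier e (x - y)) (at y) b = - ?d (x - y)" for y
  proof -
    have "((\<lambda>y. x - y) has_derivative (\<lambda>h. - h)) (at y)" by (auto intro!: derivative_eq_intros)
    from has_derivative_compose[OF this smooth_fun_has_derivative[OF smooth_mollifier_0]]
    have "((\<lambda>y. mollifier e (x - y)) has_derivative (\<lambda>h. frechet_derivative (mollifier e) (at (x - y)) (- h))) (at y)" .
    from frechet_derivative_at[OF this, symmetric]
    have "frechet_derivative (\<lambda>y. mollifier e (x - y)) (at y) b = frechet_derivative (mollifier e) (at (x - y)) (- b)" by simp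
    also have "\<dots> = - ?d (x - y)"
      using linear_neg[OF has_derivative_linear[OF smooth_fun_has_derivative[OF smooth_mollifier_0]]] .
    finally show ?thesis .
  qed
  have [measurable]: "(\<lambda>y. mollifier e (x - y)) \<in> borel_measurable borel" by (rule test_fun_measurable[OF t])
  have [measurable]: "?d \<in> borel_measurable borel"
    by (intro borel_measurable_continuous_onI smooth_fun_continuous_partial smooth_mollifier_0 b)
  note [measurable] = u'(1) g'(1)
  have "(\<integral>y. u y * frechet_derivative (\<lambda>y. mollifier e (x - y)) (at y) b \<partial>lebesgue_on \<Omega>)
     = - (\<integral>y. (G y \<bullet> b) * mollifier e (x - y) \<partial>lebesgue_on \<Omega>)"
    using w t b unfolding is_weak_grad_def by blast
  moreover have "(\<integral>y. u y * frechet_derivative (\<lambda>y. mollifier e (x - y)) (at y) b \<partial>lebesgue_on \<Omega>)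
     = (\<integral>y. u' y * (- ?d (x - y)) \<partial>lborel)"
    unfolding fd by (rule integral_lebesgue_on_eq_lborel[OF \<Omega>]) (use u' in \<open>auto elim!: eventually_mono\<close>)
  moreover have "(\<integral>y. (G y \<bullet> b) * mollifier e (x - y) \<partial>lebesgue_on \<Omega>) = (\<integral>y. g' y * mollifier e (x - y) \<partial>lborel)"
    by (rule integral_lebesgue_on_eq_lborel[OF \<Omega>]) (use g' in \<open>auto elim!: eventually_mono\<close>)
  ultimately show ?thesis by (simp add: convol_def)
qed

text \<open>For mollified \<open>u\<close> the identity is the classical chain rule plus integration
  by parts; the proof is the passage to the limit, for which \<open>F\<close> is Lipschitz and
  \<open>F'\<close> bounded and continuous.\<close>

theorem is_weak_grad_compose:
  fixes u :: "'a::euclidean_space \<Rightarrow> real"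
  assumes \<Omega>: "open \<Omega>" and u: "integrable (lebesgue_on \<Omega>) u"
    and G: "\<And>b. b \<in> Basis \<Longrightarrow> integrable (lebesgue_on \<Omega>) (\<lambda>x. G x \<bullet> b)" and w: "is_weak_grad \<Omega> u G"
    and F: "\<And>s. (F has_real_derivative F' s) (at s)" and F'c: "continuous_on UNIV F'" and F'b: "\<And>s. \<bar>F' s\<bar> \<le> M"
  shows "is_weak_grad \<Omega> (\<lambda>x. F (u x)) (\<lambda>x. F' (u x) *\<^sub>R G x)"
  unfolding is_weak_grad_def
proof (intro allI impI ballI)
  fix \<phi> and b :: 'a assume t: "test_fun \<Omega> \<phi>" and b: "b \<in> Basis"
  let ?d = "\<lambda>x. frechet_derivative \<phi> (at x) b"
  obtain u' where u'm[measurable]: "u' \<in> borel_measurable borel" and u': "integrable lborel u'" "\<And>x. x \<notin> \<Omega> \<Longrightarrow> u' x = 0"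
    "AE x in lborel. x \<in> \<Omega> \<longrightarrow> u x = u' x"
    using lebesgue_on_borel_rep[OF \<Omega> u] by blast
  obtain g' where g'm[measurable]: "g' \<in> borel_measurable borel" and g': "integrable lborel g'" "\<And>x. x \<notin> \<Omega> \<Longrightarrow> g' x = 0"
    "AE x in lborel. x \<in> \<Omega> \<longrightarrow> G x \<bullet> b = g' x"
    using lebesgue_on_borel_rep[OF \<Omega> G[OF b]] by blast
  obtain K where K: "compact K" "K \<subseteq> \<Omega>" "\<And>x. x \<notin> K \<Longrightarrow> \<phi> x = 0" and sm: "smooth_fun \<phi>"
    using test_funD[OF t] by blast
  have dK: "?d x = 0" if "x \<notin> K" for x
    using frechet_derivative_eq_0_outside[OF compact_imp_closed[OF K(1)] K(3) that] .
  obtain P where P: "P \<ge> 0" "\<And>x. \<bar>\<phi> x\<bar> \<le> P" "\<And>x. \<bar>?d x\<bar> \<le> P" using test_fun_bounded[OF t b] by blast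
  obtain R where R: "\<And>x. x \<in> K \<Longrightarrow> norm x \<le> R" using compact_imp_bounded[OF K(1)] unfolding bounded_iff by blast
  have M0: "M \<ge> 0" using F'b[of 0] by linarith
  note [measurable] = test_fun_measurable(1)[OF t] test_fun_measurable(2)[OF t b]
  have [measurable]: "F \<in> borel_measurable borel" "F' \<in> borel_measurable borel"
    using F F'c by (auto intro!: borel_measurable_continuous_onI DERIV_continuous_on)
  have Flip: "\<bar>F s - F t\<bar> \<le> M * \<bar>s - t\<bar>" for s t
    by (rule real_derivative_bound_imp_lipschitz[OF F F'b])
  have Fb: "\<bar>F s\<bar> \<le> \<bar>F 0\<bar> + M * \<bar>s\<bar>" for s using Flip[of s 0] by simp
  have F'cont: "isCont F' s" for s using F'c by (simp add: continuous_on_eq_continuous_at)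
  define k :: "nat \<Rightarrow> 'a \<Rightarrow> real" where "k n = mollifier (1 / Suc n)" for n
  define kd where "kd n x = frechet_derivative (k n) (at x) b" for n x
  have k_sm: "smooth_fun (k n)" for n unfolding k_def by (rule smooth_mollifier_0)
  have km[measurable]: "k n \<in> borel_measurable borel" for n
    by (intro borel_measurable_continuous_onI smooth_fun_continuous k_sm)
  have kdm[measurable]: "kd n \<in> borel_measurable borel" for n
    unfolding kd_def by (intro borel_measurable_continuous_onI smooth_fun_continuous_partial k_sm b)
  have k0: "k n x = 0" if "x \<notin> cball 0 (1 / Suc n)" for n x
    using that unfolding k_def by (intro mollifier_eq_0) auto
  have kb: "\<exists>Q\<ge>0. (\<forall>x. \<bar>k n x\<bar> \<le> Q) \<and> (\<forall>x. \<bar>kd n x\<bar> \<le> Q)" for n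
  proof -
    obtain Q1 where Q1: "Q1 \<ge> 0" "\<And>x. \<bar>k n x\<bar> \<le> Q1"
      using continuous_compact_support_bounded[OF smooth_fun_continuous[OF k_sm] compact_cball k0] by blast
    obtain Q2 where Q2: "Q2 \<ge> 0" "\<And>x. \<bar>kd n x\<bar> \<le> Q2"
      unfolding kd_def
      by (rule continuous_compact_support_bounded[OF smooth_fun_continuous_partial[OF k_sm b] compact_cball
           frechet_derivative_eq_0_outside[OF closed_cball k0]]) blast+
    show ?thesis
    proof (intro exI[of _ "max Q1 Q2"] conjI allI)
      show "\<bar>k n x\<bar> \<le> max Q1 Q2" "\<bar>kd n x\<bar> \<le> max Q1 Q2" for x using Q1(2)[of x] Q2(2)[of x] by linarith+
    qed (use Q1 in auto)
  qed
  define U where "U n = convol u' (k n)" for n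
  define W where "W n = convol g' (k n)" for n
  have Um[measurable]: "U n \<in> borel_measurable borel" and Wm[measurable]: "W n \<in> borel_measurable borel" for n
    unfolding U_def W_def by (rule convol_measurable; measurable)+
  have Ui: "integrable lborel (U n)" and Wi: "integrable lborel (W n)" for n
    unfolding U_def W_def k_def by (rule integrable_convol_mollifier, use u'(1) g'(1) in simp_all)+
  have UL: "(\<lambda>n. \<integral>x. \<bar>U n x - u' x\<bar> \<partial>lborel) \<longlonglongrightarrow> 0" and WL: "(\<lambda>n. \<integral>x. \<bar>W n x - g' x\<bar> \<partial>lborel) \<longlonglongrightarrow> 0"
    unfolding U_def W_def k_def by (rule convol_mollifier_tendsto, use u'(1) g'(1) in simp)+
  \<comment> \<open>The margin around the support of \<phi>: for radii below it, mollifying and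
    differentiating commute on all of \<open>K\<close>.\<close>
  obtain \<epsilon> where \<epsilon>: "\<epsilon> > 0" "(\<Union>x\<in>K. cball x \<epsilon>) \<subseteq> \<Omega>"
    using compact_subset_open_imp_cball_epsilon_subset[OF K(1) \<Omega> K(2)] by blast
  have parts: "(\<integral>x. F (U n x) * ?d x \<partial>lborel) = - (\<integral>x. F' (U n x) * W n x * \<phi> x \<partial>lborel)" if n: "1 / Suc n < \<epsilon>" for n
  proof -
    obtain Q where Q: "Q \<ge> 0" "\<And>x. \<bar>k n x\<bar> \<le> Q" "\<And>x. \<bar>kd n x\<bar> \<le> Q" using kb[of n] by blast
    define S where "S = Q * (\<integral>y. \<bar>u' y\<bar> \<partial>lborel)"
    define D where "D = convol u' (kd n)"
    have [measurable]: "D \<in> borel_measurable borel" unfolding D_def by (rule convol_measurable) measurable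
    have S: "\<bar>U n x\<bar> \<le> S" "\<bar>D x\<bar> \<le> S" for x
      unfolding U_def D_def S_def using convol_bounded[OF u'(1)] Q by blast+
    have S0: "S \<ge> 0" using S(1)[of 0] by linarith
    have dU: "((\<lambda>t. U n (x + t *\<^sub>R b)) has_real_derivative D (x + t *\<^sub>R b)) (at t)" for x t
      unfolding U_def D_def
      by (rule convol_has_directional_derivative[OF u'(1) km kdm Q(2) _ Q(3)])
         (auto simp: kd_def intro!: smooth_fun_has_directional_derivative k_sm)
    \<comment> \<open>\<open>D\<close> and \<open>W n\<close> are identified only on
      \<open>K\<close>; elsewhere \<phi> vanishes, so the products agree everywhere.\<close>
    have DW: "D x * \<phi> x = W n x * \<phi> x" for x
    proof (cases "x \<in> K")
      case True
      have "cball x (1 / Suc n) \<subseteq> cball x \<epsilon>" using n by (intro subset_cball) simp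
      then have "cball x (1 / Suc n) \<subseteq> \<Omega>" using True \<epsilon>(2) by blast
      then have "D x = W n x" unfolding D_def W_def kd_def k_def
        by (intro is_weak_grad_convol_mollifier[OF \<Omega> w b _ _ u'm u'(2,3) g'm g'(2,3)]) auto
      then show ?thesis by simp
    qed (use K in auto)
    define p q where "p x = F' (U n x) * D x * \<phi> x" and "q x = F (U n x) * ?d x" for x
    define B where "B = \<bar>F 0\<bar> + M * S"
    have FU: "\<bar>F (U n x)\<bar> \<le> B" for x
      using Fb[of "U n x"] S(1)[of x] M0 unfolding B_def by (smt (verit) mult_left_mono)
    have B0: "B \<ge> 0" using FU[of 0] by linarith
    have pb: "\<bar>p x\<bar> \<le> M * S * P" and qb: "\<bar>q x\<bar> \<le> B * P" for x
      unfolding p_def q_def abs_mult using F'b S P FU M0 S0 B0 by (auto intro!: mult_mono)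
    have [measurable]: "p \<in> borel_measurable borel" "q \<in> borel_measurable borel" unfolding p_def q_def by measurable
    have out: "p x = 0" "q x = 0" "\<phi> x = 0" if "norm x > R" for x
      using that R[of x] K(3)[of x] dK[of x] by (force simp: p_def q_def)+
    have ip: "integrable lborel p" by (rule integrable_lborel_bounded_support[OF _ pb out(1)]) auto
    have iq: "integrable lborel q" by (rule integrable_lborel_bounded_support[OF _ qb out(2)]) auto
    have "(\<integral>x. p x + q x \<partial>lborel) = 0"
    proof (rule integral_directional_derivative_eq_0[where g="\<lambda>x. F (U n x) * \<phi> x" and M="M * S * P + B * P" and R=R and b=b])
      show "((\<lambda>t. F (U n (x + t *\<^sub>R b)) * \<phi> (x + t *\<^sub>R b)) has_real_derivative p (x + t *\<^sub>R b) + q (x + t *\<^sub>R b)) (at t)" for x t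
        unfolding p_def q_def
        by (rule DERIV_cong[OF DERIV_mult[OF DERIV_chain2[OF F dU] smooth_fun_has_directional_derivative[OF sm]]])
           (simp add: mult.commute)
      show "\<bar>p x + q x\<bar> \<le> M * S * P + B * P" for x using pb[of x] qb[of x] by linarith
      show "\<bar>F (U n x) * \<phi> x\<bar> \<le> M * S * P + B * P" for x
      proof -
        have "\<bar>F (U n x) * \<phi> x\<bar> \<le> B * P" unfolding abs_mult using FU P B0 by (auto intro!: mult_mono)
        moreover have "0 \<le> M * S * P" using M0 S0 P(1) by simp
        ultimately show ?thesis by linarith
      qed
    qed (use out b in auto)
    then have "(\<integral>x. q x \<partial>lborel) = - (\<integral>x. p x \<partial>lborel)" using ip iq by simp
    moreover have "p x = F' (U n x) * W n x * \<phi> x" for x unfolding p_def mult.assoc DW ..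
    ultimately show ?thesis by (simp add: q_def)
  qed
  \<comment> \<open>\<open>F'\<close> is merely continuous, so L^1 convergence of \<open>U n\<close>
    does not control \<open>F' (U n x)\<close>; a subsequence converging almost everywhere does. The
    Lipschitz function \<open>F\<close> gets by with L^1 convergence in \<open>lim1\<close>.\<close>
  obtain r where r: "strict_mono r" and rae: "AE x in lborel. (\<lambda>n. U (r n) x - u' x) \<longlonglongrightarrow> 0"
    using tendsto_L1_AE_subseq[of lborel "\<lambda>n x. U n x - u' x"] Ui u'(1) UL by auto
  have iFd: "integrable lborel (\<lambda>x. F (v x) * ?d x)" if v: "integrable lborel v" for v
  proof (rule Bochner_Integration.integrable_bound[of _ "\<lambda>x. \<bar>F 0\<bar> * \<bar>?d x\<bar> + M * P * \<bar>v x\<bar>"])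
    have "integrable lborel ?d" by (rule integrable_lborel_bounded_support[where R=R, OF _ P(3)], measurable) (use R dK in force)
    then show "integrable lborel (\<lambda>x. \<bar>F 0\<bar> * \<bar>?d x\<bar> + M * P * \<bar>v x\<bar>)" using v by auto
    show "AE x in lborel. norm (F (v x) * ?d x) \<le> norm (\<bar>F 0\<bar> * \<bar>?d x\<bar> + M * P * \<bar>v x\<bar>)"
    proof (rule AE_I2)
      fix x
      have "\<bar>F (v x)\<bar> * \<bar>?d x\<bar> \<le> (\<bar>F 0\<bar> + M * \<bar>v x\<bar>) * \<bar>?d x\<bar>" by (intro mult_right_mono Fb) simp
      also have "M * \<bar>v x\<bar> * \<bar>?d x\<bar> \<le> M * \<bar>v x\<bar> * P" using P(3) M0 by (intro mult_left_mono) auto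
      then have "(\<bar>F 0\<bar> + M * \<bar>v x\<bar>) * \<bar>?d x\<bar> \<le> \<bar>F 0\<bar> * \<bar>?d x\<bar> + M * P * \<bar>v x\<bar>" by (simp add: algebra_simps)
      finally show "norm (F (v x) * ?d x) \<le> norm (\<bar>F 0\<bar> * \<bar>?d x\<bar> + M * P * \<bar>v x\<bar>)"
        unfolding real_norm_def abs_mult by linarith
    qed
    have [measurable]: "v \<in> borel_measurable borel" using v by auto
    show "(\<lambda>x. F (v x) * ?d x) \<in> borel_measurable lborel" by measurable
  qed
  have lim1: "(\<lambda>n. \<integral>x. F (U (r n) x) * ?d x \<partial>lborel) \<longlonglongrightarrow> (\<integral>x. F (u' x) * ?d x \<partial>lborel)"
  proof (rule tendsto_integral_L1_perturb[where q="\<lambda>n x. F (u' x) * ?d x" and B="M * P" and d="\<lambda>n x. U (r n) x - u' x"])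
    show "\<bar>F (U (r n) x) * ?d x - F (u' x) * ?d x\<bar> \<le> M * P * \<bar>U (r n) x - u' x\<bar>" for n x
    proof -
      have "\<bar>F (U (r n) x) * ?d x - F (u' x) * ?d x\<bar> = \<bar>F (U (r n) x) - F (u' x)\<bar> * \<bar>?d x\<bar>"
        by (simp add: abs_mult[symmetric] left_diff_distrib)
      also have "\<dots> \<le> (M * \<bar>U (r n) x - u' x\<bar>) * P"
        using Flip P M0 by (intro mult_mono) auto
      finally show ?thesis by (simp add: mult_ac)
    qed
  qed (use iFd Ui u'(1) LIMSEQ_subseq_LIMSEQ[OF UL r] in \<open>auto simp: comp_def\<close>)
  have iF: "integrable lborel (\<lambda>x. F' (v x) * h x * \<phi> x)" 
    if [measurable]: "v \<in> borel_measurable borel" and h: "integrable lborel h" for v h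
  proof (rule Bochner_Integration.integrable_bound[of _ "\<lambda>x. M * P * \<bar>h x\<bar>"])
    show "AE x in lborel. norm (F' (v x) * h x * \<phi> x) \<le> norm (M * P * \<bar>h x\<bar>)"
    proof (rule AE_I2)
      fix x
      have "\<bar>F' (v x)\<bar> * \<bar>h x\<bar> * \<bar>\<phi> x\<bar> \<le> M * \<bar>h x\<bar> * P" using F'b P M0 by (intro mult_mono) auto
      then show "norm (F' (v x) * h x * \<phi> x) \<le> norm (M * P * \<bar>h x\<bar>)" using M0 P(1) by (simp add: abs_mult mult_ac)
    qed
    have [measurable]: "h \<in> borel_measurable borel" using h by auto
    show "(\<lambda>x. F' (v x) * h x * \<phi> x) \<in> borel_measurable lborel" by measurable
  qed (use h in auto)
  \<comment> \<open>Both factors of F'(U) W vary. Here W is frozen at its limit \<open>g'\<close>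
    and dominated convergence moves F'(U); \<open>lim2\<close> then restores W at a cost controlled
    in L^1.\<close>
  have lim2a: "(\<lambda>n. \<integral>x. F' (U (r n) x) * g' x * \<phi> x \<partial>lborel) \<longlonglongrightarrow> (\<integral>x. F' (u' x) * g' x * \<phi> x \<partial>lborel)"
  proof (rule integral_dominated_convergence[where w="\<lambda>x. M * P * \<bar>g' x\<bar>"])
    show "AE x in lborel. (\<lambda>n. F' (U (r n) x) * g' x * \<phi> x) \<longlonglongrightarrow> F' (u' x) * g' x * \<phi> x"
      using rae
    proof eventually_elim
      case (elim x)
      then have "(\<lambda>n. U (r n) x) \<longlonglongrightarrow> u' x" by (simp add: LIM_zero_iff)
      then show ?case by (intro tendsto_intros isCont_tendsto_compose[OF F'cont])
    qed
    show "AE x in lborel. norm (F' (U (r n) x) * g' x * \<phi> x) \<le> M * P * \<bar>g' x\<bar>" for n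
    proof (rule AE_I2)
      fix x
      have "\<bar>F' (U (r n) x)\<bar> * \<bar>g' x\<bar> * \<bar>\<phi> x\<bar> \<le> M * \<bar>g' x\<bar> * P" using F'b P M0 by (intro mult_mono) auto
      then show "norm (F' (U (r n) x) * g' x * \<phi> x) \<le> M * P * \<bar>g' x\<bar>" by (simp add: abs_mult mult_ac)
    qed
  qed (use g'(1) in auto)
  have lim2: "(\<lambda>n. \<integral>x. F' (U (r n) x) * W (r n) x * \<phi> x \<partial>lborel) \<longlonglongrightarrow> (\<integral>x. F' (u' x) * g' x * \<phi> x \<partial>lborel)"
  proof (rule tendsto_integral_L1_perturb[where q="\<lambda>n x. F' (U (r n) x) * g' x * \<phi> x" and B="M * P" and d="\<lambda>n x. W (r n) x - g' x"])
    show "\<bar>F' (U (r n) x) * W (r n) x * \<phi> x - F' (U (r n) x) * g' x * \<phi> x\<bar> \<le> M * P * \<bar>W (r n) x - g' x\<bar>" for n x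
    proof -
      have "\<bar>F' (U (r n) x) * W (r n) x * \<phi> x - F' (U (r n) x) * g' x * \<phi> x\<bar> = \<bar>F' (U (r n) x)\<bar> * \<bar>W (r n) x - g' x\<bar> * \<bar>\<phi> x\<bar>"
        unfolding abs_mult[symmetric] by (simp add: algebra_simps)
      also have "\<dots> \<le> M * \<bar>W (r n) x - g' x\<bar> * P" using F'b P M0 by (intro mult_mono) auto
      finally show ?thesis by (simp add: mult_ac)
    qed
  qed (use iF Wi g'(1) lim2a LIMSEQ_subseq_LIMSEQ[OF WL r] in \<open>auto simp: comp_def\<close>)
  have "\<forall>\<^sub>F n in sequentially. 1 / Suc (r n) < \<epsilon>"
    using order_tendstoD(2)[OF LIMSEQ_subseq_LIMSEQ[OF LIMSEQ_inverse_real_of_nat r] \<epsilon>(1)] by (simp add: inverse_eq_divide comp_def)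
  then have "\<forall>\<^sub>F n in sequentially. (\<integral>x. F (U (r n) x) * ?d x \<partial>lborel) = - (\<integral>x. F' (U (r n) x) * W (r n) x * \<phi> x \<partial>lborel)"
    by eventually_elim (rule parts)
  from Lim_transform_eventually[OF lim1 this] have eq: "(\<integral>x. F (u' x) * ?d x \<partial>lborel) = - (\<integral>x. F' (u' x) * g' x * \<phi> x \<partial>lborel)"
    using LIMSEQ_unique[OF _ tendsto_minus[OF lim2]] by blast
  have "(\<integral>x. F (u x) * ?d x \<partial>lebesgue_on \<Omega>) = (\<integral>x. F (u' x) * ?d x \<partial>lborel)"
    by (rule integral_lebesgue_on_eq_lborel[OF \<Omega>]) (use u'(3) dK K(2) in \<open>auto elim!: eventually_mono\<close>)
  moreover have "(\<integral>x. ((F' (u x) *\<^sub>R G x) \<bullet> b) * \<phi> x \<partial>lebesgue_on \<Omega>) = (\<integral>x. F' (u' x) * g' x * \<phi> x \<partial>lborel)"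
  proof (rule integral_lebesgue_on_eq_lborel[OF \<Omega>])
    show "AE x in lborel. x \<in> \<Omega> \<longrightarrow> ((F' (u x) *\<^sub>R G x) \<bullet> b) * \<phi> x = F' (u' x) * g' x * \<phi> x"
      using u'(3) g'(3) by eventually_elim auto
  qed (use g'(2) in auto)
  ultimately show "(\<integral>x. F (u x) * ?d x \<partial>lebesgue_on \<Omega>) = - (\<integral>x. ((F' (u x) *\<^sub>R G x) \<bullet> b) * \<phi> x \<partial>lebesgue_on \<Omega>)"
    using eq by simp
qed

section \<open>Weak compactness of balls in a semi-inner product space\<close>

lemma linear_term_eq_0:
  fixes b c :: real
  assumes "\<And>t. 2 * t * b + t\<^sup>2 * c \<ge> 0" "c \<ge> 0"
  shows "b = 0"
proof -
  \<comment> \<open>Adding 1 keeps the denominator positive when c = 0; the evaluation point t =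
    -b/a then serves both cases.\<close>
  define a where "a = c + 1"
  have a: "a > 0" "c = a - 1" using assms(2) by (auto simp: a_def)
  have "2 * (- b / a) * b + (- b / a)\<^sup>2 * c = - (b\<^sup>2 * (a + 1) / a\<^sup>2)"
    using a(1) unfolding a(2) by (simp add: field_simps power2_eq_square)
  then have "b\<^sup>2 * (a + 1) / a\<^sup>2 \<le> 0" using assms(1)[of "- b / a"] by linarith
  then have "b\<^sup>2 \<le> 0" using a(1) by (auto simp: divide_le_0_iff mult_le_0_iff)
  then show ?thesis by simp
qed

text \<open>Operations and carrier are parameters because X is a set of representatives with
  pointwise operations. Definiteness of \<open>ip\<close> is not among the axioms: functions equal
  almost everywhere have distance zero. Completeness is stated through \<open>ip\<close> alone, so
  limits are determined only up to such differences.\<close>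

locale semi_hilbert =
  fixes S :: "'b set" and add :: "'b \<Rightarrow> 'b \<Rightarrow> 'b" (infixl \<open>\<oplus>\<close> 65) and scale :: "real \<Rightarrow> 'b \<Rightarrow> 'b" (infixr \<open>\<odot>\<close> 75)
    and ip :: "'b \<Rightarrow> 'b \<Rightarrow> real"
  assumes nonempty: "S \<noteq> {}"
    and add_closed: "x \<in> S \<Longrightarrow> y \<in> S \<Longrightarrow> x \<oplus> y \<in> S"
    and scale_closed: "x \<in> S \<Longrightarrow> c \<odot> x \<in> S"
    and ip_sym: "x \<in> S \<Longrightarrow> y \<in> S \<Longrightarrow> ip x y = ip y x"
    and ip_add: "x \<in> S \<Longrightarrow> y \<in> S \<Longrightarrow> z \<in> S \<Longrightarrow> ip (x \<oplus> y) z = ip x z + ip y z"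
    and ip_scale: "x \<in> S \<Longrightarrow> z \<in> S \<Longrightarrow> ip (c \<odot> x) z = c * ip x z"
    and ip_nonneg: "x \<in> S \<Longrightarrow> ip x x \<ge> 0"
    and complete: "(\<And>n. s n \<in> S) \<Longrightarrow>
       (\<And>e. e > 0 \<Longrightarrow> \<exists>N. \<forall>m\<ge>N. \<forall>n\<ge>N. ip (s m \<oplus> (-1) \<odot> s n) (s m \<oplus> (-1) \<odot> s n) < e) \<Longrightarrow>
       \<exists>z\<in>S. (\<lambda>n. ip (s n \<oplus> (-1) \<odot> z) (s n \<oplus> (-1) \<odot> z)) \<longlonglongrightarrow> 0"
begin

lemma ip_add_right: "x \<in> S \<Longrightarrow> y \<in> S \<Longrightarrow> z \<in> S \<Longrightarrow> ip z (x \<oplus> y) = ip z x + ip z y"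
  by (metis ip_sym ip_add add_closed)

lemma ip_scale_right: "x \<in> S \<Longrightarrow> z \<in> S \<Longrightarrow> ip z (c \<odot> x) = c * ip z x"
  by (metis ip_sym ip_scale scale_closed)

lemma ip_expand:
  assumes "x \<in> S" "y \<in> S"
  shows "ip (x \<oplus> c \<odot> y) (x \<oplus> c \<odot> y) = ip x x + 2 * c * ip x y + c\<^sup>2 * ip y y"
  using assms ip_sym[OF assms]
  by (simp add: ip_add ip_add_right ip_scale ip_scale_right add_closed scale_closed algebra_simps power2_eq_square)

lemma Cauchy_Schwarz:
  assumes "x \<in> S" "y \<in> S"
  shows "(ip x y)\<^sup>2 \<le> ip x x * ip y y"
proof -
  have pos: "ip x x + 2 * t * ip x y + t\<^sup>2 * ip y y \<ge> 0" for t
    using ip_expand[OF assms, of t] ip_nonneg[of "x \<oplus> t \<odot> y"] assms add_closed scale_closed by metis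
  have a: "ip x x \<ge> 0" and c: "ip y y \<ge> 0" using assms ip_nonneg by auto
  show ?thesis
  proof (cases "ip y y = 0")
    case True
    have "ip x y = 0"
    proof (rule ccontr)
      assume "ip x y \<noteq> 0"
      \<comment> \<open>With \<open>ip y y = 0\<close> the quadratic in t is affine; at this t it
        equals -1.\<close>
      then show False using pos[of "- (ip x x + 1) / (2 * ip x y)"] True by (simp add: field_simps)
    qed
    then show ?thesis using True by simp
  next
    case False
    then have "ip y y > 0" using c by simp
    then show ?thesis using pos[of "- ip x y / ip y y"]
      by (simp add: field_simps power2_eq_square)
  qed
qed

text \<open>The representing vector is found by minimising \<Phi>(x) = <x,x> - 2 l(x). The
  parallelogram identity makes a minimising sequence Cauchy, and the first variation at its limit
  gives <z,x> = l(x). Putting x = z into the bound on \<open>l\<close> yields the norm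
  estimate.\<close>

lemma Riesz:
  assumes l_add: "\<And>x y. x \<in> S \<Longrightarrow> y \<in> S \<Longrightarrow> l (x \<oplus> y) = l x + l y"
    and l_scale: "\<And>x c. x \<in> S \<Longrightarrow> l (c \<odot> x) = c * l x"
    and bdd: "\<And>x. x \<in> S \<Longrightarrow> (l x)\<^sup>2 \<le> R * ip x x" and R: "R \<ge> 0"
  obtains z where "z \<in> S" "\<And>x. x \<in> S \<Longrightarrow> ip z x = l x" "ip z z \<le> R"
proof -
  define \<Phi> where "\<Phi> x = ip x x - 2 * l x" for x
  \<comment> \<open>From |l(x)|^2 \<le> R <x,x>, the arithmetic-geometric mean inequality gives 2
    |l(x)| \<le> R + <x,x>.\<close>
  have lower: "- R \<le> \<Phi> x" if "x \<in> S" for x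
  proof -
    have "(2 * l x)\<^sup>2 \<le> 4 * (R * ip x x)" using bdd[OF that] by (simp add: power_mult_distrib)
    also have "\<dots> \<le> (R + ip x x)\<^sup>2"
      using zero_le_power2[of "R - ip x x"] by (simp add: power2_eq_square algebra_simps)
    finally have "\<bar>2 * l x\<bar> \<le> \<bar>R + ip x x\<bar>" by (simp only: abs_le_square_iff)
    then show ?thesis using ip_nonneg[OF that] R unfolding \<Phi>_def by linarith
  qed
  define m where "m = Inf (\<Phi> ` S)"
  have bb: "bdd_below (\<Phi> ` S)" using lower by (auto intro!: bdd_belowI2)
  have m_le: "m \<le> \<Phi> x" if "x \<in> S" for x unfolding m_def using bb that by (intro cInf_lower) auto
  have "\<exists>x\<in>S. \<Phi> x < m + 1 / Suc n" for n
    using cInf_lessD[of "\<Phi> ` S" "m + 1 / Suc n"] nonempty by (auto simp: m_def)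
  then obtain x where xS: "\<And>n. x n \<in> S" and x: "\<And>n. \<Phi> (x n) < m + 1 / Suc n" by metis
  have \<Phi>_expand: "\<Phi> (a \<oplus> c \<odot> b) = \<Phi> a + 2 * c * (ip a b - l b) + c\<^sup>2 * ip b b" if "a \<in> S" "b \<in> S" for a b c
    unfolding \<Phi>_def using that by (simp add: ip_expand l_add l_scale scale_closed algebra_simps)
  have par: "ip (a \<oplus> (-1) \<odot> b) (a \<oplus> (-1) \<odot> b) = 2 * \<Phi> a + 2 * \<Phi> b - 4 * \<Phi> ((1/2) \<odot> (a \<oplus> b))" if "a \<in> S" "b \<in> S" for a b
  proof -
    have "ip ((1/2) \<odot> (a \<oplus> b)) ((1/2) \<odot> (a \<oplus> b)) = 1/4 * (ip a a + 2 * ip a b + ip b b)"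
      using that ip_sym[OF that] by (simp add: ip_scale ip_scale_right ip_add ip_add_right add_closed scale_closed add_divide_distrib)
    moreover have "l ((1/2) \<odot> (a \<oplus> b)) = 1/2 * (l a + l b)" using that by (simp add: l_scale l_add add_closed)
    ultimately show ?thesis using ip_expand[OF that, of "-1"] unfolding \<Phi>_def by simp
  qed
  have lim0: "(\<lambda>n. 1 / real (Suc n)) \<longlonglongrightarrow> 0" using LIMSEQ_inverse_real_of_nat by (simp add: inverse_eq_divide)
  obtain z where z: "z \<in> S" "(\<lambda>n. ip (x n \<oplus> (-1) \<odot> z) (x n \<oplus> (-1) \<odot> z)) \<longlonglongrightarrow> 0"
  proof -
    have "\<exists>N. \<forall>j\<ge>N. \<forall>n\<ge>N. ip (x j \<oplus> (-1) \<odot> x n) (x j \<oplus> (-1) \<odot> x n) < e" if "e > 0" for e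
    proof -
      obtain N where N: "\<And>n. n \<ge> N \<Longrightarrow> 1 / real (Suc n) < e / 4"
        using order_tendstoD(2)[OF lim0, of "e/4"] \<open>e > 0\<close> unfolding eventually_sequentially by auto
      show ?thesis
      proof (intro exI[of _ N] allI impI)
        fix j n assume "N \<le> j" "N \<le> n"
        then show "ip (x j \<oplus> (-1) \<odot> x n) (x j \<oplus> (-1) \<odot> x n) < e"
          using par[OF xS xS, of j n] x[of j] x[of n] N[of j] N[of n] m_le[OF scale_closed[OF add_closed[OF xS xS]], of "1/2" j n]
          by linarith
      qed
    qed
    from complete[of x, OF xS this] show ?thesis using that by blast
  qed
  have \<Phi>lim: "(\<lambda>n. \<Phi> (x n)) \<longlonglongrightarrow> m"
  proof (rule tendsto_sandwich[where f="\<lambda>_. m" and h="\<lambda>n. m + 1 / real (Suc n)"])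
    show "(\<lambda>n. m + 1 / real (Suc n)) \<longlonglongrightarrow> m" using tendsto_add[OF tendsto_const lim0, of m] by simp
    show "\<forall>\<^sub>F n in sequentially. m \<le> \<Phi> (x n)" by (intro always_eventually allI m_le xS)
    show "\<forall>\<^sub>F n in sequentially. \<Phi> (x n) \<le> m + 1 / real (Suc n)" by (intro always_eventually allI less_imp_le x)
  qed simp
  have iplim: "(\<lambda>n. ip (x n) y) \<longlonglongrightarrow> ip z y" if y: "y \<in> S" for y
  proof -
    have "(ip (x n) y - ip z y)\<^sup>2 \<le> ip (x n \<oplus> (-1) \<odot> z) (x n \<oplus> (-1) \<odot> z) * ip y y" for n
      using Cauchy_Schwarz[of "x n \<oplus> (-1) \<odot> z" y] xS z(1) y by (simp add: ip_add ip_scale add_closed scale_closed)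
    then have "(\<lambda>n. (ip (x n) y - ip z y)\<^sup>2) \<longlonglongrightarrow> 0"
      by (intro tendsto_sandwich[OF _ _ tendsto_const tendsto_mult_left_zero[OF z(2)]]) (auto intro!: always_eventually)
    then have "(\<lambda>n. ip (x n) y - ip z y) \<longlonglongrightarrow> 0" by simp
    then show ?thesis by (simp add: LIM_zero_iff)
  qed
  have zl: "ip z y = l y" if y: "y \<in> S" for y
  proof -
    \<comment> \<open>The variation is applied to the minimising sequence, not to its limit, so
      \<Phi>(z) = m need not be established separately.\<close>
    have "2 * t * (ip z y - l y) + t\<^sup>2 * ip y y \<ge> 0" for t
    proof -
      have "(\<lambda>n. \<Phi> (x n) + 2 * t * (ip (x n) y - l y) + t\<^sup>2 * ip y y) \<longlonglongrightarrow> m + 2 * t * (ip z y - l y) + t\<^sup>2 * ip y y"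
        by (intro tendsto_intros \<Phi>lim iplim y)
      moreover have "m \<le> \<Phi> (x n) + 2 * t * (ip (x n) y - l y) + t\<^sup>2 * ip y y" for n
        using m_le[OF add_closed[OF xS scale_closed[OF y]]] \<Phi>_expand[OF xS y] by metis
      ultimately have "m \<le> m + 2 * t * (ip z y - l y) + t\<^sup>2 * ip y y" by (intro LIMSEQ_le_const) auto
      then show ?thesis by simp
    qed
    then have "ip z y - l y = 0" using ip_nonneg[OF y] by (rule linear_term_eq_0)
    then show ?thesis by simp
  qed
  have "(ip z z)\<^sup>2 \<le> R * ip z z" using bdd[OF z(1)] zl[OF z(1)] by simp
  then have "ip z z \<le> R" using ip_nonneg[OF z(1)] R by (cases "ip z z = 0") (auto simp: power2_eq_square)
  then show ?thesis using that z(1) zl by blast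
qed

text \<open>Banach-Alaoglu combined with reflexivity. The map z \<mapsto> <z, .> sends the ball into
  a product of compact intervals (\<open>B\<close>, compact by Tychonoff). Its image consists
  exactly of the points of \<open>B\<close> that satisfy the closed linearity conditions
  \<open>C\<close>: Riesz provides the preimage of such a functional inside the ball.\<close>

lemma weakly_compact_ball:
  assumes R: "R \<ge> 0"
  shows "compactin (topology_generated_by {{z \<in> S. ip z w \<in> U} |w U. w \<in> S \<and> open U}) {z \<in> S. ip z z \<le> R}"
    (is "compactin ?T ?K")
proof -
  define PT where "PT = product_topology (\<lambda>_. euclideanreal) S"
  define e where "e z = restrict (ip z) S" for z
  define B where "B = PiE S (\<lambda>w. {- sqrt (R * ip w w)..sqrt (R * ip w w)})"
  define A1 where "A1 x y = {f \<in> topspace PT. f (x \<oplus> y) - f x - f y \<in> {0}}" for x y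
  define A2 where "A2 c x = {f \<in> topspace PT. f (c \<odot> x) - c * f x \<in> {0}}" for c x
  have proj: "continuous_map PT euclideanreal (\<lambda>f. f w)" if "w \<in> S" for w
    unfolding PT_def using that by (rule continuous_map_product_projection)
  have cl1: "closedin PT (A1 x y)" if "x \<in> S" "y \<in> S" for x y
    unfolding A1_def using that
    by (intro closedin_continuous_map_preimage[of PT euclideanreal] continuous_map_diff proj add_closed) auto
  have cl2: "closedin PT (A2 c x)" if "x \<in> S" for c x
    unfolding A2_def using that
    by (intro closedin_continuous_map_preimage[of PT euclideanreal] continuous_map_diff continuous_map_real_mult_left proj scale_closed) auto
  define C where "C = (\<Inter>x\<in>S. (\<Inter>y\<in>S. A1 x y) \<inter> (\<Inter>c. A2 c x))"
  have clC: "closedin PT C"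
    unfolding C_def using nonempty by (intro closedin_INT closedin_Int cl1 cl2) auto
  have cB: "compactin PT B"
    unfolding B_def PT_def by (simp add: compactin_PiE)
  have cBC: "compactin PT (C \<inter> B)" by (rule closed_Int_compactin[OF clC cB])
  have "C \<inter> B = e ` ?K"
  proof (intro equalityI subsetI)
    fix f assume f: "f \<in> C \<inter> B"
    have fadd: "f (x \<oplus> y) = f x + f y" if "x \<in> S" "y \<in> S" for x y
      using f that unfolding C_def A1_def by fastforce
    have fscale: "f (c \<odot> x) = c * f x" if "x \<in> S" for c x
      using f that unfolding C_def A2_def by fastforce
    have "(f x)\<^sup>2 \<le> R * ip x x" if "x \<in> S" for x
    proof -
      have "f x \<in> {- sqrt (R * ip x x)..sqrt (R * ip x x)}" using f that unfolding B_def by (auto elim: PiE_E)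
      then have "\<bar>f x\<bar> \<le> sqrt (R * ip x x)" by auto
      then have "(f x)\<^sup>2 \<le> (sqrt (R * ip x x))\<^sup>2" by (simp only: abs_le_square_iff[symmetric])
      then show ?thesis using R ip_nonneg[OF that] by simp
    qed
    then obtain z where z: "z \<in> S" "\<And>x. x \<in> S \<Longrightarrow> ip z x = f x" "ip z z \<le> R"
      using Riesz[of f R, OF fadd fscale _ R] by blast
    have "f = e z"
    proof
      fix w show "f w = e z w"
        using z(2) f unfolding e_def B_def by (cases "w \<in> S") (auto simp: PiE_def extensional_def)
    qed
    then show "f \<in> e ` ?K" using z by blast
  next
    fix f assume "f \<in> e ` ?K"
    then obtain z where z: "z \<in> S" "ip z z \<le> R" and f: "f = e z" by blast
    have "f \<in> B"
      unfolding f B_def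
    proof (rule PiE_I)
      fix w assume w: "w \<in> S"
      have "(ip z w)\<^sup>2 \<le> R * ip w w"
        using Cauchy_Schwarz[OF z(1) w] mult_right_mono[OF z(2) ip_nonneg[OF w]] by linarith
      then have "\<bar>ip z w\<bar> \<le> sqrt (R * ip w w)" by (simp add: real_le_rsqrt)
      then show "e z w \<in> {- sqrt (R * ip w w)..sqrt (R * ip w w)}" using w by (auto simp: e_def)
    qed (auto simp: e_def)
    moreover have "f \<in> C"
      unfolding C_def A1_def A2_def f using z(1)
      by (auto simp: e_def PT_def add_closed scale_closed ip_add_right ip_scale_right)
    ultimately show "f \<in> C \<inter> B" by blast
  qed
  with cBC have cK: "compactin PT (e ` ?K)" by simp
  \<comment> \<open>\<open>e\<close> may identify points, so compactness is not carried back by an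
    inverse. Instead each weakly open set is a preimage under \<open>e\<close>, and open covers of
    the ball are transported to covers of its image.\<close>
  have pull: "\<exists>V. openin PT V \<and> U \<inter> S = {z \<in> S. e z \<in> V}" if "openin ?T U" for U
  proof -
    have "generate_topology_on {{z \<in> S. ip z w \<in> U} |w U. w \<in> S \<and> open U} U"
      using that by (simp add: openin_topology_generated_by_iff)
    then show ?thesis
    proof induction
      case Empty
      show ?case by (intro exI[of _ "{}"]) auto
    next
      case (Int a b)
      then obtain V W where "openin PT V" "a \<inter> S = {z \<in> S. e z \<in> V}" "openin PT W" "b \<inter> S = {z \<in> S. e z \<in> W}" by blast
      then show ?case by (intro exI[of _ "V \<inter> W"]) auto
    next
      case (UN k)
      then obtain V where V: "\<And>a. a \<in> k \<Longrightarrow> openin PT (V a) \<and> a \<inter> S = {z \<in> S. e z \<in> V a}" by metis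
      have "\<Union>k \<inter> S = (\<Union>a\<in>k. a \<inter> S)" by blast
      also have "\<dots> = (\<Union>a\<in>k. {z \<in> S. e z \<in> V a})" using V by simp
      also have "\<dots> = {z \<in> S. e z \<in> \<Union> (V ` k)}" by blast
      finally show ?case using V by (intro exI[of _ "\<Union> (V ` k)"]) auto
    next
      case (Basis s)
      then obtain w U where w: "w \<in> S" "open U" "s = {z \<in> S. ip z w \<in> U}" by blast
      have "openin PT {f \<in> topspace PT. f w \<in> U}"
        using proj[OF w(1)] w(2) by (intro openin_continuous_map_preimage[of PT euclideanreal]) auto
      moreover have "s \<inter> S = {z \<in> S. e z \<in> {f \<in> topspace PT. f w \<in> U}}"
        using w by (auto simp: e_def PT_def)
      ultimately show ?case by blast
    qed
  qed
  show ?thesis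
    unfolding compactin_def
  proof (intro conjI allI impI)
    obtain w where "w \<in> S" using nonempty by blast
    then have "openin ?T {z \<in> S. ip z w \<in> UNIV}" by (intro topology_generated_by_Basis) blast
    then have "{z \<in> S. ip z w \<in> UNIV} \<subseteq> topspace ?T" by (rule openin_subset)
    then show "?K \<subseteq> topspace ?T" by blast
    fix \<U> assume \<U>: "Ball \<U> (openin ?T) \<and> ?K \<subseteq> \<Union>\<U>"
    then have "\<forall>U\<in>\<U>. \<exists>V. openin PT V \<and> U \<inter> S = {z \<in> S. e z \<in> V}" using pull by blast
    from bchoice[OF this] obtain V where V: "\<And>U. U \<in> \<U> \<Longrightarrow> openin PT (V U) \<and> U \<inter> S = {z \<in> S. e z \<in> V U}"
      by blast
    have "e ` ?K \<subseteq> \<Union> (V ` \<U>)"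
    proof
      fix f assume "f \<in> e ` ?K"
      then obtain z where z: "z \<in> ?K" "f = e z" by blast
      then obtain U where "U \<in> \<U>" "z \<in> U \<inter> S" using \<U> by blast
      then show "f \<in> \<Union> (V ` \<U>)" using V z by blast
    qed
    moreover have "Ball (V ` \<U>) (openin PT)" using V by blast
    ultimately obtain \<F> where \<F>: "finite \<F>" "\<F> \<subseteq> V ` \<U>" "e ` ?K \<subseteq> \<Union>\<F>"
      using cK unfolding compactin_def by meson
    then obtain \<G> where \<G>: "finite \<G>" "\<G> \<subseteq> \<U>" "\<F> = V ` \<G>" by (meson finite_subset_image)
    have "?K \<subseteq> \<Union>\<G>"
    proof
      fix z assume z: "z \<in> ?K"
      then have "e z \<in> \<Union> (V ` \<G>)" using \<F>(3) \<G>(3) by blast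
      then obtain U where U: "U \<in> \<G>" "e z \<in> V U" by blast
      then have "z \<in> U \<inter> S" using V[of U] \<G>(2) z by blast
      then show "z \<in> \<Union>\<G>" using U by blast
    qed
    then show "\<exists>\<F>. finite \<F> \<and> \<F> \<subseteq> \<U> \<and> ?K \<subseteq> \<Union>\<F>" using \<G> by blast
  qed
qed

end

section \<open>Square-integrable functions\<close>

text \<open>One notion for scalar functions, gradient fields and pairs of both, so that completeness
  is proved once and applied to pairs.\<close>

definition sq_int :: "'b measure \<Rightarrow> ('b \<Rightarrow> 'c::euclidean_space) \<Rightarrow> bool" where
  "sq_int M f \<longleftrightarrow> f \<in> borel_measurable M \<and> integrable M (\<lambda>x. (norm (f x))\<^sup>2)"

lemma L2_iff: "f \<in> L2 \<Omega> \<longleftrightarrow> sq_int (lebesgue_on \<Omega>) f"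
  by (simp add: L2_def sq_int_def)

lemma L2v_iff: "f \<in> L2v \<Omega> \<longleftrightarrow> sq_int (lebesgue_on \<Omega>) f"
  by (simp add: L2v_def sq_int_def)

lemma norm_add_power2_le: "(norm (a + b))\<^sup>2 \<le> 2 * (norm a)\<^sup>2 + 2 * (norm (b::'c::real_normed_vector))\<^sup>2"
proof -
  have "(norm (a + b))\<^sup>2 \<le> (norm a + norm b)\<^sup>2" by (intro power_mono norm_triangle_ineq) simp
  also have "\<dots> \<le> 2 * (norm a)\<^sup>2 + 2 * (norm b)\<^sup>2"
    using zero_le_power2[of "norm a - norm b"] by (simp add: power2_eq_square algebra_simps)
  finally show ?thesis .
qed

lemma sq_int_add: "sq_int M f \<Longrightarrow> sq_int M g \<Longrightarrow> sq_int M (\<lambda>x. f x + g x)"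
  unfolding sq_int_def
proof (intro conjI)
  assume f: "f \<in> borel_measurable M \<and> integrable M (\<lambda>x. (norm (f x))\<^sup>2)"
    and g: "g \<in> borel_measurable M \<and> integrable M (\<lambda>x. (norm (g x))\<^sup>2)"
  then show "(\<lambda>x. f x + g x) \<in> borel_measurable M" by auto
  show "integrable M (\<lambda>x. (norm (f x + g x))\<^sup>2)"
    by (rule Bochner_Integration.integrable_bound[of _ "\<lambda>x. 2 * (norm (f x))\<^sup>2 + 2 * (norm (g x))\<^sup>2"])
       (use f g in \<open>auto intro!: AE_I2 norm_add_power2_le\<close>)
qed

lemma sq_int_scaleR: "sq_int M f \<Longrightarrow> sq_int M (\<lambda>x. c *\<^sub>R f x)"
  by (auto simp: sq_int_def power_mult_distrib)

lemma sq_int_diff: "sq_int M f \<Longrightarrow> sq_int M g \<Longrightarrow> sq_int M (\<lambda>x. f x - g x)"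
  using sq_int_add[of M f "\<lambda>x. (-1) *\<^sub>R g x"] sq_int_scaleR[of M g "-1"] by simp

lemma sq_int_mult_bounded:
  assumes f: "sq_int M f" and a: "a \<in> borel_measurable M" "\<And>x. \<bar>a x\<bar> \<le> B"
  shows "sq_int M (\<lambda>x. a x *\<^sub>R f x)"
  unfolding sq_int_def
proof
  show "(\<lambda>x. a x *\<^sub>R f x) \<in> borel_measurable M" using f a by (auto simp: sq_int_def)
  show "integrable M (\<lambda>x. (norm (a x *\<^sub>R f x))\<^sup>2)"
  proof (rule Bochner_Integration.integrable_bound[of _ "\<lambda>x. B\<^sup>2 * (norm (f x))\<^sup>2"])
    show "AE x in M. norm ((norm (a x *\<^sub>R f x))\<^sup>2) \<le> norm (B\<^sup>2 * (norm (f x))\<^sup>2)"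
    proof (rule AE_I2)
      fix x
      have "\<bar>a x\<bar>\<^sup>2 \<le> B\<^sup>2" using a(2) by (intro power_mono) auto
      then show "norm ((norm (a x *\<^sub>R f x))\<^sup>2) \<le> norm (B\<^sup>2 * (norm (f x))\<^sup>2)"
        by (simp add: power_mult_distrib mult_right_mono)
    qed
  qed (use f a in \<open>auto simp: sq_int_def\<close>)
qed

lemma sq_int_inner: "sq_int M f \<Longrightarrow> sq_int M g \<Longrightarrow> integrable M (\<lambda>x. f x \<bullet> g x)"
proof -
  assume f: "sq_int M f" and g: "sq_int M g"
  show ?thesis
  proof (rule Bochner_Integration.integrable_bound[of _ "\<lambda>x. (norm (f x))\<^sup>2 + (norm (g x))\<^sup>2"])
    show "AE x in M. norm (f x \<bullet> g x) \<le> norm ((norm (f x))\<^sup>2 + (norm (g x))\<^sup>2)"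
    proof (rule AE_I2)
      fix x
      have "\<bar>f x \<bullet> g x\<bar> \<le> norm (f x) * norm (g x)" by (rule Cauchy_Schwarz_ineq2)
      also have "2 * (norm (f x) * norm (g x)) \<le> (norm (f x))\<^sup>2 + (norm (g x))\<^sup>2"
        using zero_le_power2[of "norm (f x) - norm (g x)"] by (simp add: power2_eq_square algebra_simps)
      then have "norm (f x) * norm (g x) \<le> (norm (f x))\<^sup>2 + (norm (g x))\<^sup>2"
        using mult_nonneg_nonneg[OF norm_ge_zero[of "f x"] norm_ge_zero[of "g x"]] by linarith
      finally show "norm (f x \<bullet> g x) \<le> norm ((norm (f x))\<^sup>2 + (norm (g x))\<^sup>2)" by simp
    qed
  qed (use f g in \<open>auto simp: sq_int_def\<close>)
qed

lemma norm_le_Young: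
  assumes "e > 0" shows "norm a \<le> e / 2 + (norm a)\<^sup>2 / (2 * e)"
proof -
  have "2 * e * norm a \<le> e\<^sup>2 + (norm a)\<^sup>2"
    using zero_le_power2[of "e - norm a"] by (simp add: power2_eq_square algebra_simps)
  then show ?thesis using assms by (simp add: field_simps power2_eq_square)
qed

context finite_measure begin

text \<open>Integrating Young's inequality |a| \<le> e/2 + |a|^2/(2e) bounds the L^1 norm on a
  finite measure space; the free parameter e is later tuned to the size of the L^2 norm.\<close>

lemma integrable_sq_int:
  assumes "sq_int M f" shows "integrable M f" "e > 0 \<Longrightarrow> (\<integral>x. norm (f x) \<partial>M) \<le> e / 2 * measure M (space M) + (\<integral>x. (norm (f x))\<^sup>2 \<partial>M) / (2 * e)"
proof -
  have i: "integrable M (\<lambda>x. e / 2 + (norm (f x))\<^sup>2 / (2 * e))" for e using assms by (auto simp: sq_int_def)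
  show I: "integrable M f"
    by (rule Bochner_Integration.integrable_bound[OF i[of 1]])
       (use assms norm_le_Young[of 1] in \<open>auto simp: sq_int_def intro!: AE_I2 order_trans[OF _ abs_ge_self]\<close>)
  assume e: "e > 0"
  have "(\<integral>x. norm (f x) \<partial>M) \<le> (\<integral>x. e / 2 + (norm (f x))\<^sup>2 / (2 * e) \<partial>M)"
    by (rule integral_mono[OF _ i norm_le_Young[OF e]]) (use I in auto)
  also have "\<dots> = e / 2 * measure M (space M) + (\<integral>x. (norm (f x))\<^sup>2 \<partial>M) / (2 * e)"
    using assms by (simp add: sq_int_def)
  finally show "(\<integral>x. norm (f x) \<partial>M) \<le> e / 2 * measure M (space M) + (\<integral>x. (norm (f x))\<^sup>2 \<partial>M) / (2 * e)" .
qed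

lemma tendsto_L1_of_L2:
  assumes "\<And>n. sq_int M (f n)" "(\<lambda>n. \<integral>x. (norm (f n x))\<^sup>2 \<partial>M) \<longlonglongrightarrow> 0"
  shows "(\<lambda>n. \<integral>x. norm (f n x) \<partial>M) \<longlonglongrightarrow> 0"
proof (rule tendstoI)
  fix d :: real assume d: "d > 0"
  \<comment> \<open>Makes the measure term of the Young bound at most d/2; the summand 1 covers a
    space of measure zero.\<close>
  define e where "e = d / (measure M (space M) + 1)"
  have e: "e > 0" using d by (simp add: e_def add_nonneg_pos)
  have em: "e / 2 * measure M (space M) \<le> d / 2"
  proof -
    have "e * (measure M (space M) + 1) = d" by (simp add: e_def add_nonneg_eq_0_iff)
    then show ?thesis using e by (simp add: algebra_simps)
  qed
  have "\<forall>\<^sub>F n in sequentially. (\<integral>x. (norm (f n x))\<^sup>2 \<partial>M) < d * e"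
    using assms(2) d e by (intro order_tendstoD) auto
  then show "\<forall>\<^sub>F n in sequentially. dist (\<integral>x. norm (f n x) \<partial>M) 0 < d"
  proof eventually_elim
    case (elim n)
    have "(\<integral>x. (norm (f n x))\<^sup>2 \<partial>M) / (2 * e) < d / 2" using elim e by (simp add: field_simps)
    then have "(\<integral>x. norm (f n x) \<partial>M) < d" using integrable_sq_int(2)[OF assms(1) e, of n] em by linarith
    moreover have "0 \<le> (\<integral>x. norm (f n x) \<partial>M)" by (intro Bochner_Integration.integral_nonneg) simp
    ultimately show ?case by simp
  qed
qed

lemma L2_fast_Cauchy_AE_convergent:
  fixes f :: "nat \<Rightarrow> 'a \<Rightarrow> 'c::euclidean_space"
  assumes f: "\<And>n. sq_int M (f n)" and c: "\<And>n. (\<integral>x. (norm (f (Suc n) x - f n x))\<^sup>2 \<partial>M) \<le> (1/4) ^ n"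
  shows "AE x in M. convergent (\<lambda>n. f n x)"
proof -
  let ?d = "\<lambda>n x. norm (f (Suc n) x - f n x)"
  have ds: "sq_int M (\<lambda>x. f (Suc n) x - f n x)" for n by (intro sq_int_diff f)
  have fm[measurable]: "f n \<in> borel_measurable M" for n using f by (simp add: sq_int_def)
  define B where "B = measure M (space M) + 1"
  have b: "(\<integral>x. ?d n x \<partial>M) \<le> B * (1/2) ^ n" for n
  proof -
    \<comment> \<open>The Young parameter (1/2)^n balances the hypothesis (1/4)^n: both terms are of
      order (1/2)^n, hence summable.\<close>
    have "(\<integral>x. ?d n x \<partial>M) \<le> (1/2)^n / 2 * measure M (space M) + (\<integral>x. (?d n x)\<^sup>2 \<partial>M) / (2 * (1/2)^n)"
      by (rule integrable_sq_int(2)[OF ds]) simp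
    also have "(\<integral>x. (?d n x)\<^sup>2 \<partial>M) / (2 * (1/2)^n) \<le> (1/4)^n / (2 * (1/2)^n)"
      using c by (intro divide_right_mono) auto
    also have "(1/4::real)^n / (2 * (1/2)^n) = (1/2)^n / 2"
    proof -
      have "(1/4::real)^n = (1/2)^n * (1/2)^n" by (simp add: power_mult_distrib[symmetric])
      then show ?thesis by simp
    qed
    also have "(1/2)^n / 2 * measure M (space M) + (1/2)^n / 2 = (1/2) * (B * (1/2)^n)" by (simp add: B_def algebra_simps)
    also have "\<dots> \<le> B * (1/2)^n" by (simp add: B_def)
    finally show ?thesis by simp
  qed
  have nn: "(\<integral>\<^sup>+x. ennreal (?d n x) \<partial>M) = ennreal (\<integral>x. ?d n x \<partial>M)" for n
    by (intro nn_integral_eq_integral integrable_norm integrable_sq_int(1)[OF ds]) simp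
  have "(\<integral>\<^sup>+x. (\<Sum>n. ennreal (?d n x)) \<partial>M) = (\<Sum>n. \<integral>\<^sup>+x. ennreal (?d n x) \<partial>M)"
    by (intro nn_integral_suminf) measurable
  also have "\<dots> \<le> (\<Sum>n. ennreal (B * (1/2)^n))"
    unfolding nn using b by (intro suminf_le ennreal_leI) auto
  also have "\<dots> = ennreal (\<Sum>n. B * (1/2)^n)"
    by (intro suminf_ennreal2) (auto simp: B_def intro!: summable_mult summable_geometric)
  finally have "(\<integral>\<^sup>+x. (\<Sum>n. ennreal (?d n x)) \<partial>M) \<noteq> \<infinity>" using neq_top_trans ennreal_neq_top by (metis infinity_ennreal_def)
  then have "AE x in M. (\<Sum>n. ennreal (?d n x)) \<noteq> \<infinity>"
    by (intro nn_integral_noteq_infinite) measurable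
  then show ?thesis
  proof eventually_elim
    case (elim x)
    then have "summable (\<lambda>n. ?d n x)" by (intro summable_suminf_not_top) auto
    then have "summable (\<lambda>n. f (Suc n) x - f n x)" by (rule summable_norm_cancel)
    then have "convergent (\<lambda>n. (\<Sum>i<n. f (Suc i) x - f i x))" by (simp add: summable_iff_convergent)
    then have "convergent (\<lambda>n. (\<Sum>i<n. f (Suc i) x - f i x) + f 0 x)"
      by (rule convergent_add[OF _ convergent_const])
    then show ?case by (simp add: sum_lessThan_telescope[where f="\<lambda>i. f i x"])
  qed
qed

text \<open>Riesz-Fischer: a rapidly Cauchy subsequence converges almost everywhere, and Fatou
  upgrades the pointwise limit to an L^2 limit of the whole sequence.\<close>

lemma L2_complete:
  fixes f :: "nat \<Rightarrow> 'a \<Rightarrow> 'c::euclidean_space"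
  assumes f: "\<And>n. sq_int M (f n)"
    and C: "\<And>e. e > 0 \<Longrightarrow> \<exists>N. \<forall>m\<ge>N. \<forall>n\<ge>N. (\<integral>x. (norm (f m x - f n x))\<^sup>2 \<partial>M) < e"
  obtains g where "sq_int M g" "(\<lambda>n. \<integral>x. (norm (f n x - g x))\<^sup>2 \<partial>M) \<longlonglongrightarrow> 0"
proof -
  have fm[measurable]: "f n \<in> borel_measurable M" for n using f by (simp add: sq_int_def)
  have "\<exists>N. \<forall>k. \<forall>m\<ge>N k. \<forall>n\<ge>N k. (\<integral>x. (norm (f m x - f n x))\<^sup>2 \<partial>M) < (1/4)^k"
    using C[of "(1/4)^_"] by (intro choice allI) simp
  then obtain N where N: "\<And>k m n. m \<ge> N k \<Longrightarrow> n \<ge> N k \<Longrightarrow> (\<integral>x. (norm (f m x - f n x))\<^sup>2 \<partial>M) < (1/4)^k" by blast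
  \<comment> \<open>An index choice without recursion: the sum makes r j at least N k for every j
    \<ge> k, and the summand k gives r k \<ge> k.\<close>
  define r where "r k = k + (\<Sum>i\<le>k. N i)" for k
  have rN: "r j \<ge> N k" if "j \<ge> k" for j k
  proof -
    have "N k \<le> (\<Sum>i\<le>j. N i)" using that by (intro member_le_sum) auto
    then show ?thesis by (simp add: r_def)
  qed
  have rk: "r k \<ge> k" for k by (simp add: r_def)
  have "AE x in M. convergent (\<lambda>k. f (r k) x)"
    by (rule L2_fast_Cauchy_AE_convergent[OF f]) (use N rN in \<open>simp add: less_imp_le\<close>)
  define g where "g x = lim (\<lambda>k. f (r k) x)" for x
  have gm[measurable]: "g \<in> borel_measurable M" unfolding g_def by measurable
  have lim: "AE x in M. (\<lambda>k. f (r k) x) \<longlonglongrightarrow> g x"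
    using \<open>AE x in M. convergent (\<lambda>k. f (r k) x)\<close> by eventually_elim (simp add: g_def convergent_LIMSEQ_iff)
  \<comment> \<open>Stated for an arbitrary threshold \<open>K\<close> and bound \<open>e\<close>,
    because it is used twice: with e = 1 to get square integrability of the limit, then with small e
    for convergence.\<close>
  have fatou: "(\<integral>\<^sup>+x. ennreal ((norm (f n x - g x))\<^sup>2) \<partial>M) \<le> ennreal e"
    if e: "\<And>m. m \<ge> K \<Longrightarrow> (\<integral>x. (norm (f n x - f m x))\<^sup>2 \<partial>M) \<le> e" for n K e
  proof -
    have "(\<integral>\<^sup>+x. ennreal ((norm (f n x - g x))\<^sup>2) \<partial>M) = (\<integral>\<^sup>+x. liminf (\<lambda>k. ennreal ((norm (f n x - f (r k) x))\<^sup>2)) \<partial>M)"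
    proof (rule nn_integral_cong_AE)
      show "AE x in M. ennreal ((norm (f n x - g x))\<^sup>2) = liminf (\<lambda>k. ennreal ((norm (f n x - f (r k) x))\<^sup>2))"
        using lim
      proof eventually_elim
        case (elim x)
        have "(\<lambda>k. ennreal ((norm (f n x - f (r k) x))\<^sup>2)) \<longlonglongrightarrow> ennreal ((norm (f n x - g x))\<^sup>2)"
          by (intro tendsto_ennrealI tendsto_intros elim)
        from lim_imp_Liminf[OF trivial_limit_sequentially this, symmetric] show ?case .
      qed
    qed
    also have "\<dots> \<le> liminf (\<lambda>k. \<integral>\<^sup>+x. ennreal ((norm (f n x - f (r k) x))\<^sup>2) \<partial>M)"
      by (intro nn_integral_liminf) measurable
    also have "\<dots> \<le> liminf (\<lambda>k. ennreal e)"
    proof (rule Liminf_mono)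
      show "\<forall>\<^sub>F k in sequentially. (\<integral>\<^sup>+x. ennreal ((norm (f n x - f (r k) x))\<^sup>2) \<partial>M) \<le> ennreal e"
        using eventually_ge_at_top[of K]
      proof eventually_elim
        case (elim k)
        have "(\<integral>\<^sup>+x. ennreal ((norm (f n x - f (r k) x))\<^sup>2) \<partial>M) = ennreal (\<integral>x. (norm (f n x - f (r k) x))\<^sup>2 \<partial>M)"
          using sq_int_diff[OF f f, of n "r k"] by (intro nn_integral_eq_integral) (auto simp: sq_int_def)
        then show ?case using e[of "r k"] rk[of k] elim by (auto intro!: ennreal_leI)
      qed
    qed
    finally show ?thesis by (simp add: Liminf_const)
  qed
  have sqd: "sq_int M (\<lambda>x. f n x - g x)" if "(\<integral>\<^sup>+x. ennreal ((norm (f n x - g x))\<^sup>2) \<partial>M) \<le> ennreal e" for n e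
  proof -
    have "integrable M (\<lambda>x. (norm (f n x - g x))\<^sup>2)"
      using that by (intro integrableI_bounded) (auto intro: le_less_trans)
    then show ?thesis by (simp add: sq_int_def)
  qed
  obtain N0 where N0: "\<And>m n. m \<ge> N0 \<Longrightarrow> n \<ge> N0 \<Longrightarrow> (\<integral>x. (norm (f m x - f n x))\<^sup>2 \<partial>M) < 1"
    using C[of 1] by auto
  have "sq_int M (\<lambda>x. f N0 x - g x)"
    by (rule sqd[where e=1], rule fatou[where K=N0]) (use N0[of N0] in \<open>auto intro: less_imp_le\<close>)
  from sq_int_diff[OF f[of N0] this] have gs: "sq_int M g" by simp
  moreover have "(\<lambda>n. \<integral>x. (norm (f n x - g x))\<^sup>2 \<partial>M) \<longlonglongrightarrow> 0"
  proof (rule tendstoI)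
    fix e :: real assume e: "e > 0"
    obtain N1 where N1: "\<And>m n. m \<ge> N1 \<Longrightarrow> n \<ge> N1 \<Longrightarrow> (\<integral>x. (norm (f m x - f n x))\<^sup>2 \<partial>M) < e/2"
      using C[of "e/2"] e by auto
    show "\<forall>\<^sub>F n in sequentially. dist (\<integral>x. (norm (f n x - g x))\<^sup>2 \<partial>M) 0 < e"
      using eventually_ge_at_top[of N1]
    proof eventually_elim
      case (elim n)
      have "(\<integral>\<^sup>+x. ennreal ((norm (f n x - g x))\<^sup>2) \<partial>M) \<le> ennreal (e/2)"
        by (rule fatou[where K=N1]) (use N1[OF elim] in \<open>auto intro: less_imp_le\<close>)
      moreover have "(\<integral>\<^sup>+x. ennreal ((norm (f n x - g x))\<^sup>2) \<partial>M) = ennreal (\<integral>x. (norm (f n x - g x))\<^sup>2 \<partial>M)"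
        using sq_int_diff[OF f gs, of n] by (intro nn_integral_eq_integral) (auto simp: sq_int_def)
      ultimately have "(\<integral>x. (norm (f n x - g x))\<^sup>2 \<partial>M) \<le> e/2" using e by simp
      moreover have "0 \<le> (\<integral>x. (norm (f n x - g x))\<^sup>2 \<partial>M)" by (intro Bochner_Integration.integral_nonneg) simp
      ultimately show ?case using e by simp
    qed
  qed
  ultimately show ?thesis using that by blast
qed

end

section \<open>The Hilbert space structure of H1\<close>

locale bounded_open =
  fixes \<Omega> :: "'a::euclidean_space set"
  assumes op: "open \<Omega>" and bdd: "bounded \<Omega>"
begin

sublocale finite_measure "lebesgue_on \<Omega>"
  using lmeasurable_open[OF bdd op] by (rule finite_measure_lebesgue_on)

lemma borel_measurable_lebesgue_onI: "f \<in> borel_measurable borel \<Longrightarrow> f \<in> borel_measurable (lebesgue_on \<Omega>)"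
  by (intro measurable_restrict_space1 measurable_completion) simp

lemma integrable_mult_bounded:
  fixes u h :: "'a \<Rightarrow> real"
  assumes u: "integrable (lebesgue_on \<Omega>) u" and h: "h \<in> borel_measurable (lebesgue_on \<Omega>)" "\<And>x. \<bar>h x\<bar> \<le> B"
  shows "integrable (lebesgue_on \<Omega>) (\<lambda>x. u x * h x)"
proof (rule Bochner_Integration.integrable_bound[of _ "\<lambda>x. B * u x"])
  show "AE x in lebesgue_on \<Omega>. norm (u x * h x) \<le> norm (B * u x)"
  proof (rule AE_I2)
    fix x
    have "\<bar>h x\<bar> \<le> \<bar>B\<bar>" using h(2)[of x] by linarith
    then show "norm (u x * h x) \<le> norm (B * u x)" unfolding real_norm_def abs_mult by (subst mult.commute) (rule mult_right_mono, simp_all)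
  qed
  show "integrable (lebesgue_on \<Omega>) (\<lambda>x. B * u x)" using u by (rule integrable_mult_right)
  show "(\<lambda>x. u x * h x) \<in> borel_measurable (lebesgue_on \<Omega>)"
    by (rule borel_measurable_times[OF borel_measurable_integrable[OF u] h(1)])
qed

lemma integrable_test:
  assumes u: "integrable (lebesgue_on \<Omega>) u" and t: "test_fun \<Omega> \<phi>" and b: "b \<in> Basis"
  shows "integrable (lebesgue_on \<Omega>) (\<lambda>x. u x * \<phi> x)"
    "integrable (lebesgue_on \<Omega>) (\<lambda>x. u x * frechet_derivative \<phi> (at x) b)"
proof -
  obtain P where "P \<ge> 0" and P: "\<And>x. \<bar>\<phi> x\<bar> \<le> P" "\<And>x. \<bar>frechet_derivative \<phi> (at x) b\<bar> \<le> P"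
    using test_fun_bounded[OF t b] by blast
  show "integrable (lebesgue_on \<Omega>) (\<lambda>x. u x * \<phi> x)"
    by (rule integrable_mult_bounded[OF u borel_measurable_lebesgue_onI[OF test_fun_measurable(1)[OF t]] P(1)])
  show "integrable (lebesgue_on \<Omega>) (\<lambda>x. u x * frechet_derivative \<phi> (at x) b)"
    by (rule integrable_mult_bounded[OF u borel_measurable_lebesgue_onI[OF test_fun_measurable(2)[OF t b]] P(2)])
qed

lemma L2_integrable: "u \<in> L2 \<Omega> \<Longrightarrow> integrable (lebesgue_on \<Omega>) u"
  by (simp add: L2_iff integrable_sq_int)

lemma L2v_integrable: "G \<in> L2v \<Omega> \<Longrightarrow> integrable (lebesgue_on \<Omega>) (\<lambda>x. G x \<bullet> b)"
  by (intro integrable_inner_left integrable_sq_int(1)) (simp add: L2v_iff)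

text \<open>Each component of the difference annihilates all test functions, so the fundamental
  lemma applies componentwise.\<close>

lemma weak_grad_unique:
  assumes G: "G \<in> L2v \<Omega>" "is_weak_grad \<Omega> u G" and H: "H \<in> L2v \<Omega>" "is_weak_grad \<Omega> u H"
  shows "AE x in lebesgue_on \<Omega>. G x = H x"
proof -
  have "AE x in lebesgue_on \<Omega>. (G x - H x) \<bullet> b = 0" if b: "b \<in> Basis" for b
  proof (rule fundamental_lemma_calculus_of_variations[OF op])
    show "integrable (lebesgue_on \<Omega>) (\<lambda>x. (G x - H x) \<bullet> b)"
      using L2v_integrable[OF G(1), of b] L2v_integrable[OF H(1), of b] by (simp add: inner_diff_left)
    fix \<phi> assume t: "test_fun \<Omega> \<phi>"
    have "(\<integral>x. (G x \<bullet> b) * \<phi> x \<partial>lebesgue_on \<Omega>) = (\<integral>x. (H x \<bullet> b) * \<phi> x \<partial>lebesgue_on \<Omega>)"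
      using G(2) H(2) t b unfolding is_weak_grad_def by fastforce
    then show "(\<integral>x. ((G x - H x) \<bullet> b) * \<phi> x \<partial>lebesgue_on \<Omega>) = 0"
      using integrable_test(1)[OF L2v_integrable[OF G(1)] t b] integrable_test(1)[OF L2v_integrable[OF H(1)] t b]
      by (simp add: inner_diff_left left_diff_distrib)
  qed
  then have "AE x in lebesgue_on \<Omega>. \<forall>b\<in>Basis. (G x - H x) \<bullet> b = 0" by (intro AE_finite_allI) auto
  then show ?thesis by eventually_elim (auto simp: inner_diff_left intro: euclidean_eqI)
qed

lemma H1_L2: "u \<in> H1 \<Omega> \<Longrightarrow> u \<in> L2 \<Omega>"
  by (simp add: H1_def)

lemma weak_gradD:
  assumes "u \<in> H1 \<Omega>" shows "weak_grad \<Omega> u \<in> L2v \<Omega>" "is_weak_grad \<Omega> u (weak_grad \<Omega> u)"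
proof -
  have "\<exists>G. G \<in> L2v \<Omega> \<and> is_weak_grad \<Omega> u G" using assms by (auto simp: H1_def)
  from someI_ex[OF this] show "weak_grad \<Omega> u \<in> L2v \<Omega>" "is_weak_grad \<Omega> u (weak_grad \<Omega> u)"
    unfolding weak_grad_def by blast+
qed

text \<open>The way to compute \<open>weak_grad\<close>, which is a choice: exhibit any
  square-integrable weak gradient; the chosen one agrees with it almost everywhere.\<close>

lemma weak_grad_AE_eq:
  assumes "u \<in> L2 \<Omega>" "G \<in> L2v \<Omega>" "is_weak_grad \<Omega> u G"
  shows "u \<in> H1 \<Omega>" "AE x in lebesgue_on \<Omega>. weak_grad \<Omega> u x = G x"
proof -
  show "u \<in> H1 \<Omega>" using assms by (auto simp: H1_def)
  from weak_gradD[OF this] show "AE x in lebesgue_on \<Omega>. weak_grad \<Omega> u x = G x"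
    using weak_grad_unique assms by blast
qed

lemma H1_lincomb:
  assumes u: "u \<in> H1 \<Omega>" and v: "v \<in> H1 \<Omega>"
  shows "(\<lambda>x. u x + c * v x) \<in> H1 \<Omega>"
    "AE x in lebesgue_on \<Omega>. weak_grad \<Omega> (\<lambda>x. u x + c * v x) x = weak_grad \<Omega> u x + c *\<^sub>R weak_grad \<Omega> v x"
proof -
  note gu = weak_gradD[OF u] and gv = weak_gradD[OF v]
  have 1: "(\<lambda>x. u x + c * v x) \<in> L2 \<Omega>"
    using sq_int_add[OF _ sq_int_scaleR[of _ v c]] H1_L2[OF u] H1_L2[OF v] by (simp add: L2_iff)
  have 2: "(\<lambda>x. weak_grad \<Omega> u x + c *\<^sub>R weak_grad \<Omega> v x) \<in> L2v \<Omega>"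
    using sq_int_add[OF _ sq_int_scaleR] gu(1) gv(1) by (simp add: L2v_iff)
  have 3: "is_weak_grad \<Omega> (\<lambda>x. u x + c * v x) (\<lambda>x. weak_grad \<Omega> u x + c *\<^sub>R weak_grad \<Omega> v x)"
    unfolding is_weak_grad_def
  proof (intro allI impI ballI)
    fix \<phi> and b :: 'a assume t: "test_fun \<Omega> \<phi>" and b: "b \<in> Basis"
    let ?d = "\<lambda>x. frechet_derivative \<phi> (at x) b"
    note iu = integrable_test(2)[OF L2_integrable[OF H1_L2[OF u]] t b]
      and iv = integrable_test(2)[OF L2_integrable[OF H1_L2[OF v]] t b]
      and igu = integrable_test(1)[OF L2v_integrable[OF gu(1), of b] t b]
      and igv = integrable_test(1)[OF L2v_integrable[OF gv(1), of b] t b]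
    have "(\<integral>x. (u x + c * v x) * ?d x \<partial>lebesgue_on \<Omega>) = (\<integral>x. u x * ?d x \<partial>lebesgue_on \<Omega>) + c * (\<integral>x. v x * ?d x \<partial>lebesgue_on \<Omega>)"
      using iu iv by (simp add: distrib_right mult.assoc)
    also have "\<dots> = - ((\<integral>x. (weak_grad \<Omega> u x \<bullet> b) * \<phi> x \<partial>lebesgue_on \<Omega>) + c * (\<integral>x. (weak_grad \<Omega> v x \<bullet> b) * \<phi> x \<partial>lebesgue_on \<Omega>))"
      using gu(2) gv(2) t b unfolding is_weak_grad_def by simp
    also have "(\<integral>x. (weak_grad \<Omega> u x \<bullet> b) * \<phi> x \<partial>lebesgue_on \<Omega>) + c * (\<integral>x. (weak_grad \<Omega> v x \<bullet> b) * \<phi> x \<partial>lebesgue_on \<Omega>)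
       = (\<integral>x. ((weak_grad \<Omega> u x + c *\<^sub>R weak_grad \<Omega> v x) \<bullet> b) * \<phi> x \<partial>lebesgue_on \<Omega>)"
      using igu igv by (simp add: distrib_right mult.assoc inner_add_left)
    finally show "(\<integral>x. (u x + c * v x) * ?d x \<partial>lebesgue_on \<Omega>) =
      - (\<integral>x. ((weak_grad \<Omega> u x + c *\<^sub>R weak_grad \<Omega> v x) \<bullet> b) * \<phi> x \<partial>lebesgue_on \<Omega>)" .
  qed
  from weak_grad_AE_eq[OF 1 2 3] show "(\<lambda>x. u x + c * v x) \<in> H1 \<Omega>"
    "AE x in lebesgue_on \<Omega>. weak_grad \<Omega> (\<lambda>x. u x + c * v x) x = weak_grad \<Omega> u x + c *\<^sub>R weak_grad \<Omega> v x" .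
qed

text \<open>|F(u)| \<le> |F(0)| + B |u|, and the constant is square integrable because \<Omega> has
  finite measure; the gradient is the chain rule.\<close>

lemma H1_compose:
  assumes u: "u \<in> H1 \<Omega>"
    and F: "\<And>s. (F has_real_derivative F' s) (at s)" "continuous_on UNIV F'" "\<And>s. \<bar>F' s\<bar> \<le> B"
  shows "(\<lambda>x. F (u x)) \<in> H1 \<Omega>"
    "AE x in lebesgue_on \<Omega>. weak_grad \<Omega> (\<lambda>x. F (u x)) x = F' (u x) *\<^sub>R weak_grad \<Omega> u x"
proof -
  note gu = weak_gradD[OF u]
  have uL: "sq_int (lebesgue_on \<Omega>) u" using H1_L2[OF u] by (simp add: L2_iff)
  have [measurable]: "u \<in> borel_measurable (lebesgue_on \<Omega>)" using uL by (simp add: sq_int_def)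
  have [measurable]: "F \<in> borel_measurable borel" "F' \<in> borel_measurable borel"
    by (intro borel_measurable_continuous_onI DERIV_continuous_on[OF F(1)] F(2))+
  have "integrable (lebesgue_on \<Omega>) (\<lambda>x. (F (u x))\<^sup>2)"
  proof (rule Bochner_Integration.integrable_bound[of _ "\<lambda>x. 2 * (F 0)\<^sup>2 + 2 * B\<^sup>2 * (u x)\<^sup>2"])
    show "AE x in lebesgue_on \<Omega>. norm ((F (u x))\<^sup>2) \<le> norm (2 * (F 0)\<^sup>2 + 2 * B\<^sup>2 * (u x)\<^sup>2)"
    proof (rule AE_I2)
      fix x
      have "\<bar>F (u x) - F 0\<bar> \<le> B * \<bar>u x\<bar>"
        using real_derivative_bound_imp_lipschitz[OF F(1,3), of "u x" 0] by simp
      then have "(F (u x) - F 0)\<^sup>2 \<le> (B * \<bar>u x\<bar>)\<^sup>2" by (metis abs_ge_zero power2_abs power_mono)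
      moreover have "(norm (F 0 + (F (u x) - F 0)))\<^sup>2 \<le> 2 * (norm (F 0))\<^sup>2 + 2 * (norm (F (u x) - F 0))\<^sup>2"
        by (rule norm_add_power2_le)
      ultimately show "norm ((F (u x))\<^sup>2) \<le> norm (2 * (F 0)\<^sup>2 + 2 * B\<^sup>2 * (u x)\<^sup>2)" by (simp add: power_mult_distrib)
    qed
    show "integrable (lebesgue_on \<Omega>) (\<lambda>x. 2 * (F 0)\<^sup>2 + 2 * B\<^sup>2 * (u x)\<^sup>2)"
      using uL by (auto simp: sq_int_def)
  qed measurable
  then have 1: "(\<lambda>x. F (u x)) \<in> L2 \<Omega>" by (simp add: L2_def)
  have 2: "(\<lambda>x. F' (u x) *\<^sub>R weak_grad \<Omega> u x) \<in> L2v \<Omega>"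
    unfolding L2v_iff by (rule sq_int_mult_bounded[OF _ _ F(3)]) (use gu(1) in \<open>auto simp: L2v_iff\<close>)
  have 3: "is_weak_grad \<Omega> (\<lambda>x. F (u x)) (\<lambda>x. F' (u x) *\<^sub>R weak_grad \<Omega> u x)"
    by (rule is_weak_grad_compose[OF op L2_integrable[OF H1_L2[OF u]] L2v_integrable[OF gu(1)] gu(2) F])
  show "(\<lambda>x. F (u x)) \<in> H1 \<Omega>" by (rule weak_grad_AE_eq(1)[OF 1 2 3])
  show "AE x in lebesgue_on \<Omega>. weak_grad \<Omega> (\<lambda>x. F (u x)) x = F' (u x) *\<^sub>R weak_grad \<Omega> u x"
    by (rule weak_grad_AE_eq(2)[OF 1 2 3])
qed

text \<open>Pairing a function with its gradient turns the H^1 inner product into an L^2 inner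
  product of vector-valued functions, where \<open>L2_complete\<close> applies.\<close>

definition jet :: "('a \<Rightarrow> real) \<Rightarrow> 'a \<Rightarrow> real \<times> 'a" where
  "jet u x = (u x, weak_grad \<Omega> u x)"

lemma sq_int_Pair:
  "sq_int (lebesgue_on \<Omega>) (\<lambda>x. (u x, G x)) \<longleftrightarrow> u \<in> L2 \<Omega> \<and> G \<in> L2v \<Omega>"
proof
  assume p: "sq_int (lebesgue_on \<Omega>) (\<lambda>x. (u x, G x))"
  have pm: "(\<lambda>x. (u x, G x)) \<in> borel_measurable (lebesgue_on \<Omega>)" using p by (simp add: sq_int_def)
  have "fst \<in> borel_measurable (borel :: (real \<times> 'a) measure)" "snd \<in> borel_measurable (borel :: (real \<times> 'a) measure)"
    by (intro borel_measurable_continuous_onI continuous_on_fst continuous_on_snd continuous_on_id)+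
  from this[THEN measurable_compose[OF pm]]
  have m: "u \<in> borel_measurable (lebesgue_on \<Omega>)" "G \<in> borel_measurable (lebesgue_on \<Omega>)" by simp_all
  have i: "integrable (lebesgue_on \<Omega>) (\<lambda>x. (u x)\<^sup>2 + (norm (G x))\<^sup>2)"
    using p by (simp add: sq_int_def norm_Pair)
  have "integrable (lebesgue_on \<Omega>) (\<lambda>x. (u x)\<^sup>2)" "integrable (lebesgue_on \<Omega>) (\<lambda>x. (norm (G x))\<^sup>2)"
    by (rule Bochner_Integration.integrable_bound[OF i]; use m in \<open>auto\<close>)+
  then show "u \<in> L2 \<Omega> \<and> G \<in> L2v \<Omega>" using m by (simp add: L2_def L2v_def)
next
  assume "u \<in> L2 \<Omega> \<and> G \<in> L2v \<Omega>"
  then show "sq_int (lebesgue_on \<Omega>) (\<lambda>x. (u x, G x))"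
    by (auto simp: sq_int_def L2_def L2v_def norm_Pair)
qed

lemma sq_int_jet: "u \<in> H1 \<Omega> \<Longrightarrow> sq_int (lebesgue_on \<Omega>) (jet u)"
  unfolding jet_def[abs_def] sq_int_Pair using H1_L2 weak_gradD by blast

lemma H1_inner_jet:
  assumes "u \<in> H1 \<Omega>" "v \<in> H1 \<Omega>"
  shows "H1_inner \<Omega> u v = (\<integral>x. jet u x \<bullet> jet v x \<partial>lebesgue_on \<Omega>)"
proof -
  have "integrable (lebesgue_on \<Omega>) (\<lambda>x. u x * v x)"
    using sq_int_inner[of "lebesgue_on \<Omega>" u v] H1_L2[OF assms(1)] H1_L2[OF assms(2)] by (simp add: L2_iff)
  moreover have "integrable (lebesgue_on \<Omega>) (\<lambda>x. weak_grad \<Omega> u x \<bullet> weak_grad \<Omega> v x)"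
    by (rule sq_int_inner) (use weak_gradD(1)[OF assms(1)] weak_gradD(1)[OF assms(2)] in \<open>simp_all add: L2v_iff\<close>)
  ultimately show ?thesis by (simp add: H1_inner_def jet_def)
qed

lemma jet_lincomb:
  assumes "u \<in> H1 \<Omega>" "v \<in> H1 \<Omega>"
  shows "AE x in lebesgue_on \<Omega>. jet (\<lambda>x. u x + c * v x) x = jet u x + c *\<^sub>R jet v x"
  using H1_lincomb(2)[OF assms, of c] by eventually_elim (simp add: jet_def)

lemma H1_inner_lincomb:
  assumes u: "u \<in> H1 \<Omega>" and v: "v \<in> H1 \<Omega>" and w: "w \<in> H1 \<Omega>"
  shows "H1_inner \<Omega> (\<lambda>x. u x + c * v x) w = H1_inner \<Omega> u w + c * H1_inner \<Omega> v w"
proof -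
  have i: "integrable (lebesgue_on \<Omega>) (\<lambda>x. jet u x \<bullet> jet w x)" "integrable (lebesgue_on \<Omega>) (\<lambda>x. jet v x \<bullet> jet w x)"
    using sq_int_inner sq_int_jet u v w by blast+
  have "H1_inner \<Omega> (\<lambda>x. u x + c * v x) w = (\<integral>x. jet (\<lambda>x. u x + c * v x) x \<bullet> jet w x \<partial>lebesgue_on \<Omega>)"
    by (rule H1_inner_jet[OF H1_lincomb(1)[OF u v] w])
  also have "\<dots> = (\<integral>x. jet u x \<bullet> jet w x + c * (jet v x \<bullet> jet w x) \<partial>lebesgue_on \<Omega>)"
  proof (rule integral_cong_AE)
    show "(\<lambda>x. jet (\<lambda>x. u x + c * v x) x \<bullet> jet w x) \<in> borel_measurable (lebesgue_on \<Omega>)"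
      by (intro borel_measurable_integrable sq_int_inner sq_int_jet H1_lincomb(1) u v w)
    show "AE x in lebesgue_on \<Omega>. jet (\<lambda>x. u x + c * v x) x \<bullet> jet w x = jet u x \<bullet> jet w x + c * (jet v x \<bullet> jet w x)"
      using jet_lincomb[OF u v, of c] by eventually_elim (simp only: inner_add_left inner_scaleR_left)
  qed (use i in auto)
  also have "\<dots> = H1_inner \<Omega> u w + c * H1_inner \<Omega> v w"
    using i by (simp add: H1_inner_jet u v w)
  finally show ?thesis .
qed

lemma H1_inner_sym: "H1_inner \<Omega> u v = H1_inner \<Omega> v u"
  by (simp add: H1_inner_def mult.commute inner_commute)

lemma H1_inner_nonneg: "H1_inner \<Omega> u u \<ge> 0"
  unfolding H1_inner_def by (intro add_nonneg_nonneg Bochner_Integration.integral_nonneg) auto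

lemma H1_inner_diff:
  assumes "u \<in> H1 \<Omega>" "v \<in> H1 \<Omega>"
  shows "H1_inner \<Omega> (\<lambda>x. u x + (-1) * v x) (\<lambda>x. u x + (-1) * v x) = (\<integral>x. (norm (jet u x - jet v x))\<^sup>2 \<partial>lebesgue_on \<Omega>)"
proof -
  have s: "(\<lambda>x. u x + (-1) * v x) \<in> H1 \<Omega>" by (rule H1_lincomb(1)[OF assms])
  have "H1_inner \<Omega> (\<lambda>x. u x + (-1) * v x) (\<lambda>x. u x + (-1) * v x) =
     (\<integral>x. jet (\<lambda>x. u x + (-1) * v x) x \<bullet> jet (\<lambda>x. u x + (-1) * v x) x \<partial>lebesgue_on \<Omega>)"
    by (rule H1_inner_jet[OF s s])
  also have "\<dots> = (\<integral>x. (norm (jet u x - jet v x))\<^sup>2 \<partial>lebesgue_on \<Omega>)"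
  proof (rule integral_cong_AE)
    show "(\<lambda>x. jet (\<lambda>x. u x + (-1) * v x) x \<bullet> jet (\<lambda>x. u x + (-1) * v x) x) \<in> borel_measurable (lebesgue_on \<Omega>)"
      by (intro borel_measurable_integrable sq_int_inner sq_int_jet s)
    show "(\<lambda>x. (norm (jet u x - jet v x))\<^sup>2) \<in> borel_measurable (lebesgue_on \<Omega>)"
      using sq_int_jet[OF assms(1)] sq_int_jet[OF assms(2)] by (auto simp: sq_int_def)
    show "AE x in lebesgue_on \<Omega>. jet (\<lambda>x. u x + (-1) * v x) x \<bullet> jet (\<lambda>x. u x + (-1) * v x) x = (norm (jet u x - jet v x))\<^sup>2"
      using jet_lincomb[OF assms, of "-1"] by eventually_elim (simp add: power2_norm_eq_inner)
  qed
  finally show ?thesis .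
qed

text \<open>The jets converge in L^2 to some pair (v, G). Test integrals are continuous under L^1
  convergence, so the defining identity survives and G is a weak gradient of v.\<close>

lemma H1_complete:
  assumes u: "\<And>n. u n \<in> H1 \<Omega>"
    and C: "\<And>e. e > 0 \<Longrightarrow> \<exists>N. \<forall>m\<ge>N. \<forall>n\<ge>N. H1_inner \<Omega> (\<lambda>x. u m x + (-1) * u n x) (\<lambda>x. u m x + (-1) * u n x) < e"
  obtains v where "v \<in> H1 \<Omega>" "(\<lambda>n. H1_inner \<Omega> (\<lambda>x. u n x + (-1) * v x) (\<lambda>x. u n x + (-1) * v x)) \<longlonglongrightarrow> 0"
proof -
  have "\<exists>N. \<forall>m\<ge>N. \<forall>n\<ge>N. (\<integral>x. (norm (jet (u m) x - jet (u n) x))\<^sup>2 \<partial>lebesgue_on \<Omega>) < e" if "e > 0" for e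
    using C[OF that] unfolding H1_inner_diff[OF u u] .
  then obtain g where g: "sq_int (lebesgue_on \<Omega>) g"
    and lim: "(\<lambda>n. \<integral>x. (norm (jet (u n) x - g x))\<^sup>2 \<partial>lebesgue_on \<Omega>) \<longlonglongrightarrow> 0"
    using L2_complete[of "\<lambda>n. jet (u n)", OF sq_int_jet[OF u]] by blast
  define v where "v x = fst (g x)" for x
  define G where "G x = snd (g x)" for x
  have gP: "g x = (v x, G x)" for x by (simp add: v_def G_def)
  have vL: "v \<in> L2 \<Omega>" and GL: "G \<in> L2v \<Omega>" using g sq_int_Pair[of v G] unfolding gP[abs_def] by auto
  have sd: "sq_int (lebesgue_on \<Omega>) (\<lambda>x. jet (u n) x - g x)" for n by (intro sq_int_diff sq_int_jet u g)
  have L1: "(\<lambda>n. \<integral>x. norm (jet (u n) x - g x) \<partial>lebesgue_on \<Omega>) \<longlonglongrightarrow> 0"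
    by (rule tendsto_L1_of_L2[OF sd lim])
  have w: "is_weak_grad \<Omega> v G"
    unfolding is_weak_grad_def
  proof (intro allI impI ballI)
    fix \<phi> and b :: 'a assume t: "test_fun \<Omega> \<phi>" and b: "b \<in> Basis"
    let ?d = "\<lambda>x. frechet_derivative \<phi> (at x) b"
    obtain P where P: "P \<ge> 0" "\<And>x. \<bar>\<phi> x\<bar> \<le> P" "\<And>x. \<bar>?d x\<bar> \<le> P" using test_fun_bounded[OF t b] by blast
    have L1': "(\<lambda>n. \<integral>x. \<bar>norm (jet (u n) x - g x)\<bar> \<partial>lebesgue_on \<Omega>) \<longlonglongrightarrow> 0" using L1 by simp
    have ni: "integrable (lebesgue_on \<Omega>) (\<lambda>x. norm (jet (u n) x - g x))" for n
      by (intro integrable_norm integrable_sq_int(1) sd)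
    have 1: "(\<lambda>n. \<integral>x. u n x * ?d x \<partial>lebesgue_on \<Omega>) \<longlonglongrightarrow> (\<integral>x. v x * ?d x \<partial>lebesgue_on \<Omega>)"
    proof (rule tendsto_integral_L1_perturb[where q="\<lambda>n x. v x * ?d x" and B=P, OF _ _ ni _ L1'])
      show "integrable (lebesgue_on \<Omega>) (\<lambda>x. u n x * ?d x)" for n
        by (rule integrable_test(2)[OF L2_integrable[OF H1_L2[OF u]] t b])
      show "integrable (lebesgue_on \<Omega>) (\<lambda>x. v x * ?d x)"
        by (rule integrable_test(2)[OF L2_integrable[OF vL] t b])
      fix n x
      have "\<bar>u n x - v x\<bar> \<le> norm (jet (u n) x - g x)"
        using norm_fst_le[of "u n x - v x" "weak_grad \<Omega> (u n) x - G x"] by (simp add: jet_def gP)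
      then have "\<bar>u n x - v x\<bar> * \<bar>?d x\<bar> \<le> norm (jet (u n) x - g x) * P" using P by (intro mult_mono) auto
      then show "\<bar>u n x * ?d x - v x * ?d x\<bar> \<le> P * \<bar>norm (jet (u n) x - g x)\<bar>"
        by (simp only: left_diff_distrib[symmetric] abs_mult abs_norm_cancel mult.commute[of P])
    qed simp
    have 2: "(\<lambda>n. \<integral>x. (weak_grad \<Omega> (u n) x \<bullet> b) * \<phi> x \<partial>lebesgue_on \<Omega>) \<longlonglongrightarrow> (\<integral>x. (G x \<bullet> b) * \<phi> x \<partial>lebesgue_on \<Omega>)"
    proof (rule tendsto_integral_L1_perturb[where q="\<lambda>n x. (G x \<bullet> b) * \<phi> x" and B=P, OF _ _ ni _ L1'])
      show "integrable (lebesgue_on \<Omega>) (\<lambda>x. (weak_grad \<Omega> (u n) x \<bullet> b) * \<phi> x)" for n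
        by (rule integrable_test(1)[OF L2v_integrable[OF weak_gradD(1)[OF u]] t b])
      show "integrable (lebesgue_on \<Omega>) (\<lambda>x. (G x \<bullet> b) * \<phi> x)"
        by (rule integrable_test(1)[OF L2v_integrable[OF GL] t b])
      fix n x
      have "\<bar>(weak_grad \<Omega> (u n) x - G x) \<bullet> b\<bar> \<le> norm (weak_grad \<Omega> (u n) x - G x)"
        using Basis_le_norm[OF b] .
      also have "\<dots> \<le> norm (jet (u n) x - g x)"
        using norm_snd_le[of "weak_grad \<Omega> (u n) x - G x" "u n x - v x"] by (simp add: jet_def gP)
      finally have "\<bar>(weak_grad \<Omega> (u n) x - G x) \<bullet> b\<bar> * \<bar>\<phi> x\<bar> \<le> norm (jet (u n) x - g x) * P" using P by (intro mult_mono) auto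
      then show "\<bar>(weak_grad \<Omega> (u n) x \<bullet> b) * \<phi> x - (G x \<bullet> b) * \<phi> x\<bar> \<le> P * \<bar>norm (jet (u n) x - g x)\<bar>"
        by (simp only: left_diff_distrib[symmetric] inner_diff_left[symmetric] abs_mult abs_norm_cancel mult.commute[of P])
    qed simp
    have "(\<integral>x. u n x * ?d x \<partial>lebesgue_on \<Omega>) = - (\<integral>x. (weak_grad \<Omega> (u n) x \<bullet> b) * \<phi> x \<partial>lebesgue_on \<Omega>)" for n
      using weak_gradD(2)[OF u] t b unfolding is_weak_grad_def by blast
    from LIMSEQ_unique[OF 1[unfolded this] tendsto_minus[OF 2]]
    show "(\<integral>x. v x * ?d x \<partial>lebesgue_on \<Omega>) = - (\<integral>x. (G x \<bullet> b) * \<phi> x \<partial>lebesgue_on \<Omega>)" .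
  qed
  note v = weak_grad_AE_eq[OF vL GL w]
  have "H1_inner \<Omega> (\<lambda>x. u n x + (-1) * v x) (\<lambda>x. u n x + (-1) * v x) = (\<integral>x. (norm (jet (u n) x - g x))\<^sup>2 \<partial>lebesgue_on \<Omega>)" for n
    unfolding H1_inner_diff[OF u v(1)]
  proof (rule integral_cong_AE)
    show "AE x in lebesgue_on \<Omega>. (norm (jet (u n) x - jet v x))\<^sup>2 = (norm (jet (u n) x - g x))\<^sup>2"
      using v(2) by eventually_elim (simp add: jet_def gP)
  qed (use sq_int_jet[OF u[of n]] sq_int_jet[OF v(1)] g in \<open>auto simp: sq_int_def\<close>)
  then show ?thesis using that v(1) lim by simp
qed

lemma H1_zero: "(\<lambda>_. 0) \<in> H1 \<Omega>"
proof -
  have "(\<lambda>_. 0) \<in> L2v \<Omega>" "is_weak_grad \<Omega> (\<lambda>_. 0) (\<lambda>_. 0)"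
    by (auto simp: L2v_def is_weak_grad_def)
  then show ?thesis by (auto simp: H1_def L2_def)
qed

lemma H1_add: "u \<in> H1 \<Omega> \<Longrightarrow> v \<in> H1 \<Omega> \<Longrightarrow> (\<lambda>x. u x + v x) \<in> H1 \<Omega>"
  using H1_lincomb(1)[of u v 1] by simp

lemma H1_scale: "u \<in> H1 \<Omega> \<Longrightarrow> (\<lambda>x. c * u x) \<in> H1 \<Omega>"
  using H1_lincomb(1)[OF H1_zero, of u c] by simp

lemma H1_inner_add:
  "u \<in> H1 \<Omega> \<Longrightarrow> v \<in> H1 \<Omega> \<Longrightarrow> w \<in> H1 \<Omega> \<Longrightarrow> H1_inner \<Omega> (\<lambda>x. u x + v x) w = H1_inner \<Omega> u w + H1_inner \<Omega> v w"
  using H1_inner_lincomb[of u v w 1] by simp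

lemma H1_inner_scale:
  assumes "u \<in> H1 \<Omega>" "w \<in> H1 \<Omega>" shows "H1_inner \<Omega> (\<lambda>x. c * u x) w = c * H1_inner \<Omega> u w"
proof -
  have "H1_inner \<Omega> (\<lambda>_. 0) w = 0" using H1_inner_add[OF H1_zero H1_zero assms(2)] by simp
  then show ?thesis using H1_inner_lincomb[OF H1_zero assms, of c] by simp
qed

text \<open>Only completeness needs an argument: both H^1 summands are nonnegative, so a Cauchy
  sequence in X is Cauchy in each component.\<close>

sublocale X: semi_hilbert "Xsp \<Omega>" "\<lambda>z w. (\<lambda>x. fst z x + fst w x, \<lambda>x. snd z x + snd w x)"
  "\<lambda>c z. (\<lambda>x. c * fst z x, \<lambda>x. c * snd z x)" "X_inner \<Omega>"
proof
  fix s :: "nat \<Rightarrow> ('a \<Rightarrow> real) \<times> ('a \<Rightarrow> real)" assume s: "\<And>n. s n \<in> Xsp \<Omega>"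
  let ?i = "\<lambda>u v. H1_inner \<Omega> (\<lambda>x. u x + (-1) * v x) (\<lambda>x. u x + (-1) * v x)"
  assume C: "\<And>e. e > 0 \<Longrightarrow> \<exists>N. \<forall>m\<ge>N. \<forall>n\<ge>N.
    X_inner \<Omega> (\<lambda>x. fst (s m) x + fst (\<lambda>x. -1 * fst (s n) x, \<lambda>x. -1 * snd (s n) x) x, \<lambda>x. snd (s m) x + snd (\<lambda>x. -1 * fst (s n) x, \<lambda>x. -1 * snd (s n) x) x)
      (\<lambda>x. fst (s m) x + fst (\<lambda>x. -1 * fst (s n) x, \<lambda>x. -1 * snd (s n) x) x, \<lambda>x. snd (s m) x + snd (\<lambda>x. -1 * fst (s n) x, \<lambda>x. -1 * snd (s n) x) x) < e"
  have C': "\<exists>N. \<forall>m\<ge>N. \<forall>n\<ge>N. ?i (fst (s m)) (fst (s n)) + ?i (snd (s m)) (snd (s n)) < e" if "e > 0" for e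
    using C[OF that] by (simp only: X_inner_def fst_conv snd_conv)
  have sH: "fst (s n) \<in> H1 \<Omega>" "snd (s n) \<in> H1 \<Omega>" for n using s[of n] by (auto simp: Xsp_def)
  have C1: "\<exists>N. \<forall>m\<ge>N. \<forall>n\<ge>N. ?i (fst (s m)) (fst (s n)) < e" if "e > 0" for e
    using C'[OF that] H1_inner_nonneg by (meson add_increasing2 le_less_trans order_refl)
  have C2: "\<exists>N. \<forall>m\<ge>N. \<forall>n\<ge>N. ?i (snd (s m)) (snd (s n)) < e" if "e > 0" for e
    using C'[OF that] H1_inner_nonneg by (meson add_increasing le_less_trans order_refl)
  obtain v where v: "v \<in> H1 \<Omega>" "(\<lambda>n. ?i (fst (s n)) v) \<longlonglongrightarrow> 0" using H1_complete[of "\<lambda>n. fst (s n)", OF sH(1) C1] by blast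
  obtain w where w: "w \<in> H1 \<Omega>" "(\<lambda>n. ?i (snd (s n)) w) \<longlonglongrightarrow> 0" using H1_complete[of "\<lambda>n. snd (s n)", OF sH(2) C2] by blast
  show "\<exists>z\<in>Xsp \<Omega>. (\<lambda>n. X_inner \<Omega> (\<lambda>x. fst (s n) x + fst (\<lambda>x. -1 * fst z x, \<lambda>x. -1 * snd z x) x, \<lambda>x. snd (s n) x + snd (\<lambda>x. -1 * fst z x, \<lambda>x. -1 * snd z x) x)
      (\<lambda>x. fst (s n) x + fst (\<lambda>x. -1 * fst z x, \<lambda>x. -1 * snd z x) x, \<lambda>x. snd (s n) x + snd (\<lambda>x. -1 * fst z x, \<lambda>x. -1 * snd z x) x)) \<longlonglongrightarrow> 0"
  proof (rule bexI[of _ "(v, w)"])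
    show "(v, w) \<in> Xsp \<Omega>" using v w by (simp add: Xsp_def)
    show "(\<lambda>n. X_inner \<Omega> (\<lambda>x. fst (s n) x + fst (\<lambda>x. -1 * fst (v, w) x, \<lambda>x. -1 * snd (v, w) x) x, \<lambda>x. snd (s n) x + snd (\<lambda>x. -1 * fst (v, w) x, \<lambda>x. -1 * snd (v, w) x) x)
      (\<lambda>x. fst (s n) x + fst (\<lambda>x. -1 * fst (v, w) x, \<lambda>x. -1 * snd (v, w) x) x, \<lambda>x. snd (s n) x + snd (\<lambda>x. -1 * fst (v, w) x, \<lambda>x. -1 * snd (v, w) x) x)) \<longlonglongrightarrow> 0"
      using tendsto_add_zero[OF v(2) w(2)] by (simp only: X_inner_def fst_conv snd_conv)
  qed
next
  show "Xsp \<Omega> \<noteq> {}" using H1_zero by (auto simp: Xsp_def)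
next
  show "X_inner \<Omega> z w = X_inner \<Omega> w z" for z w
    unfolding X_inner_def by (simp only: H1_inner_sym[of "fst z"] H1_inner_sym[of "snd z"])
qed (auto simp: Xsp_def X_inner_def H1_add H1_scale H1_inner_add H1_inner_scale H1_inner_nonneg algebra_simps)

end

section \<open>A priori bounds for stationary states\<close>

lemma sq_int_mult_norm:
  assumes "sq_int M f" "sq_int M g" shows "integrable M (\<lambda>x. norm (f x) * norm (g x))"
proof -
  have "sq_int M (\<lambda>x. norm (f x))" "sq_int M (\<lambda>x. norm (g x))" using assms by (auto simp: sq_int_def)
  from sq_int_inner[OF this] show ?thesis by simp
qed

lemma truncation_derivative:
  assumes "k > 0"
  shows "((\<lambda>s. k * arctan (s / k)) has_real_derivative 1 / (1 + (s / k)\<^sup>2)) (at s)"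
  using assms by (auto intro!: derivative_eq_intros simp: add_nonneg_eq_0_iff field_simps)

text \<open>With T increasing and odd, T(s) + T(t) = T(s) - T(-t) has the sign of s - (-t).\<close>

lemma truncation_monotone_product:
  assumes "k > 0"
  shows "(s + t) * (k * arctan (s / k) + k * arctan (t / k)) \<ge> (0::real)"
proof -
  have mono: "arctan (x / k) \<le> arctan (y / k)" if "x \<le> y" for x y
    using that assms by (simp add: arctan_le_iff divide_right_mono)
  have neg: "arctan (- t / k) = - arctan (t / k)" by (simp add: arctan_minus)
  show ?thesis
  proof (cases "s + t \<ge> 0")
    case True
    then have "arctan (s / k) + arctan (t / k) \<ge> 0" using mono[of "-t" s] neg by simp
    then show ?thesis using True assms by (simp add: distrib_left[symmetric])
  next
    case False
    then have "arctan (s / k) + arctan (t / k) \<le> 0" using mono[of s "-t"] neg by simp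
    then show ?thesis using False assms by (simp add: distrib_left[symmetric] mult_nonpos_nonpos mult_nonneg_nonpos)
  qed
qed

text \<open>A single stationary state for one fixed \<open>lam\<close>. The bounds extracted from it
  contain no \<open>lam\<close>, which is what makes them uniform along the sequence.\<close>

locale stationary = bounded_open \<Omega> for \<Omega> :: "'a::euclidean_space set" +
  fixes \<delta> lam :: real and V C :: "'a \<Rightarrow> real"
  assumes ne: "\<Omega> \<noteq> {}" and \<delta>: "\<delta> > 0" and lam: "lam > 0"
    and V: "V \<in> H1 \<Omega>" and C: "C \<in> H1 \<Omega>" and V_mean: "(\<integral>x. V x \<partial>lebesgue_on \<Omega>) = 0"
    and exp_int: "integrable (lebesgue_on \<Omega>) (\<lambda>x. exp (- V x))" "integrable (lebesgue_on \<Omega>) (\<lambda>x. exp (V x))"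
    and e0: "e_zero \<Omega> \<delta> lam V C"
begin

abbreviation "L \<equiv> lebesgue_on \<Omega>"
abbreviation "n \<equiv> nV \<Omega> \<delta> C V"
abbreviation "p \<equiv> pV \<Omega> \<delta> C V"
definition "vol = measure lebesgue \<Omega>"
definition "cn = Nc \<Omega> \<delta> C / (\<integral>x. exp (- V x) \<partial>L)"
definition "cp = Pc \<Omega> \<delta> C / (\<integral>x. exp (V x) \<partial>L)"
definition "\<kappa> = cn * cp"

lemma integral_const_vol: "(\<integral>x. c \<partial>L) = c * vol"
  using op by (simp add: vol_def measure_restrict_space)

lemma vol_pos: "vol > 0"
proof -
  have "\<not> negligible \<Omega>" using open_not_negligible[OF op ne] .
  then have "vol \<noteq> 0" unfolding vol_def using negligible_iff_measure[of \<Omega>] lmeasurable_open[OF bdd op] by auto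
  then show ?thesis using measure_nonneg[of lebesgue \<Omega>] unfolding vol_def by linarith
qed

lemma V_int: "integrable L V" and C_int: "integrable L C"
  using V C H1_L2 L2_integrable by blast+

text \<open>exp s \<ge> 1 + s and the zero mean of \<open>V\<close> even bound both integrals below
  by the volume.\<close>

lemma exp_integral_pos: "(\<integral>x. exp (- V x) \<partial>L) > 0" "(\<integral>x. exp (V x) \<partial>L) > 0"
proof -
  have "(\<integral>x. 1 + (- V x) \<partial>L) \<le> (\<integral>x. exp (- V x) \<partial>L)"
    by (rule integral_mono) (use V_int exp_int in \<open>auto intro: exp_ge_add_one_self[of "- _", simplified]\<close>)
  moreover have "(\<integral>x. 1 + (- V x) \<partial>L) = vol" using V_int V_mean integral_const_vol[of 1] by simp
  ultimately show "(\<integral>x. exp (- V x) \<partial>L) > 0" using vol_pos by linarith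
  have "(\<integral>x. 1 + V x \<partial>L) \<le> (\<integral>x. exp (V x) \<partial>L)"
    by (rule integral_mono) (use V_int exp_int in auto)
  moreover have "(\<integral>x. 1 + V x \<partial>L) = vol" using V_int V_mean integral_const_vol[of 1] by simp
  ultimately show "(\<integral>x. exp (V x) \<partial>L) > 0" using vol_pos by linarith
qed

lemma N_ge: "Nc \<Omega> \<delta> C \<ge> \<delta>\<^sup>2" and P_ge: "Pc \<Omega> \<delta> C \<ge> \<delta>\<^sup>2"
proof -
  have "(\<integral>x. max (C x) 0 \<partial>L) \<ge> 0" by (intro Bochner_Integration.integral_nonneg) simp
  then show "Nc \<Omega> \<delta> C \<ge> \<delta>\<^sup>2" by (simp add: Nc_def)
  have "(\<integral>x. - min (C x) 0 \<partial>L) \<ge> 0" by (intro Bochner_Integration.integral_nonneg) simp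
  then show "Pc \<Omega> \<delta> C \<ge> \<delta>\<^sup>2" by (simp add: Pc_def)
qed

lemma cn_pos: "cn > 0" and cp_pos: "cp > 0"
proof -
  have "\<delta>\<^sup>2 > 0" using \<delta> by simp
  then have "Nc \<Omega> \<delta> C > 0" "Pc \<Omega> \<delta> C > 0" using N_ge P_ge by linarith+
  then show "cn > 0" "cp > 0" unfolding cn_def cp_def using exp_integral_pos by simp_all
qed

lemma kappa_pos: "\<kappa> > 0" using cn_pos cp_pos by (simp add: \<kappa>_def)

lemma n_eq: "n x = cn * exp (- V x)" and p_eq: "p x = cp * exp (V x)"
  by (simp_all add: nV_def pV_def cn_def cp_def)

lemma n_pos: "n x > 0" and p_pos: "p x > 0"
  using cn_pos cp_pos by (simp_all add: n_eq p_eq)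

lemma n_p: "n x * p x = \<kappa>"
  by (simp add: n_eq p_eq \<kappa>_def exp_minus)

lemma n_int: "integrable L n" "(\<integral>x. n x \<partial>L) = Nc \<Omega> \<delta> C"
proof -
  have e: "n = (\<lambda>x. cn * exp (- V x))" by (rule ext) (rule n_eq)
  show "integrable L n" unfolding e using exp_int by simp
  show "(\<integral>x. n x \<partial>L) = Nc \<Omega> \<delta> C" unfolding e using exp_integral_pos by (simp add: cn_def)
qed

lemma V_meas: "V \<in> borel_measurable L" using V_int by auto

lemma test_equation:
  assumes "\<phi> \<in> H1 \<Omega>"
  shows "integrable L (\<lambda>x. (- n x + p x + C x) * \<phi> x)"
    "lam\<^sup>2 * (\<integral>x. weak_grad \<Omega> V x \<bullet> weak_grad \<Omega> \<phi> x \<partial>L) = - (\<integral>x. (- n x + p x + C x) * \<phi> x \<partial>L)"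
  using e0 assms unfolding e_zero_def by force+

text \<open>The charge excess \<delta>^2 cannot sit where \<open>n\<close> is small, so it forces
  \<open>n p\<close> up. The weight n/(n + \<epsilon>) is nearly 1 where \<open>n\<close> is large
  and damps \<open>p\<close> = \<kappa>/n where \<open>n\<close> is small.\<close>

lemma kappa_lower: "\<kappa> \<ge> (\<delta>\<^sup>2 / (2 * vol))\<^sup>2"
proof -
  \<comment> \<open>With \<delta>^2 = 2 \<epsilon> \<open>vol\<close>, the error \<epsilon>
    \<open>vol\<close> made in the estimate consumes half of the excess; the other half is left for
    \<kappa>.\<close>
  define \<epsilon> where "\<epsilon> = \<delta>\<^sup>2 / (2 * vol)"
  have \<epsilon>: "\<epsilon> > 0" using vol_pos \<delta> by (simp add: \<epsilon>_def)
  \<comment> \<open>This is n/(n + \<epsilon>) written as a function of V, with numerator and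
    denominator multiplied by exp V: a decreasing logistic function with bounded derivative.\<close>
  define F where "F s = cn / (cn + \<epsilon> * exp s)" for s
  define F' where "F' s = - (cn * (\<epsilon> * exp s)) / (cn + \<epsilon> * exp s)\<^sup>2" for s
  have den: "cn + \<epsilon> * exp s > 0" for s using cn_pos \<epsilon> by (simp add: add_pos_pos)
  have dF: "(F has_real_derivative F' s) (at s)" for s
    unfolding F_def F'_def using den[of s]
    by (auto intro!: derivative_eq_intros simp: power2_eq_square divide_simps)
  have cF': "continuous_on UNIV F'"
    unfolding F'_def using den by (intro continuous_intros) (auto simp: less_imp_neq[symmetric])
  have bF': "\<bar>F' s\<bar> \<le> 1" and F'neg: "F' s \<le> 0" for s
  proof -
    define y where "y = \<epsilon> * exp s"
    have y: "y > 0" using \<epsilon> by (simp add: y_def)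
    have "cn * y \<le> (cn + y)\<^sup>2" using cn_pos y by (simp add: power2_eq_square algebra_simps add_nonneg_nonneg)
    moreover have "F' s = - (cn * y / (cn + y)\<^sup>2)" by (simp add: F'_def y_def)
    moreover have "cn * y \<ge> 0" "(cn + y)\<^sup>2 > 0" using cn_pos y by auto
    ultimately show "\<bar>F' s\<bar> \<le> 1" "F' s \<le> 0" by (auto simp: divide_le_eq_1)
  qed
  note \<phi> = H1_compose[OF V dF cF' bF']
  \<comment> \<open>By the chain rule the integrand is -F'(V) |grad V|^2, nonnegative because F
    decreases.\<close>
  have "(\<integral>x. - (weak_grad \<Omega> V x \<bullet> weak_grad \<Omega> (\<lambda>x. F (V x)) x) \<partial>L) \<ge> 0"
  proof (rule integral_nonneg_AE)
    show "AE x in L. 0 \<le> - (weak_grad \<Omega> V x \<bullet> weak_grad \<Omega> (\<lambda>x. F (V x)) x)"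
      using \<phi>(2) by eventually_elim (use F'neg in \<open>simp add: mult_nonpos_nonneg\<close>)
  qed
  then have "lam\<^sup>2 * (\<integral>x. weak_grad \<Omega> V x \<bullet> weak_grad \<Omega> (\<lambda>x. F (V x)) x \<partial>L) \<le> 0"
    by (simp add: mult_nonneg_nonpos)
  then have "0 \<le> (\<integral>x. (- n x + p x + C x) * F (V x) \<partial>L)" using test_equation(2)[OF \<phi>(1)] by linarith
  \<comment> \<open>Pointwise n F(V) \<ge> n - \<epsilon>, p F(V) = \<kappa>/(n + \<epsilon>) \<le>
    \<kappa>/\<epsilon>, and C F(V) is at most the positive part of C. After integration N cancels
    that positive part up to \<delta>^2.\<close>
  also have "\<dots> \<le> (\<integral>x. (- n x + max (C x) 0) + (\<epsilon> + \<kappa> / \<epsilon>) \<partial>L)"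
  proof (rule integral_mono)
    show "integrable L (\<lambda>x. (- n x + p x + C x) * F (V x))" by (rule test_equation(1)[OF \<phi>(1)])
    show "integrable L (\<lambda>x. (- n x + max (C x) 0) + (\<epsilon> + \<kappa> / \<epsilon>))" using n_int(1) C_int by auto
    fix x
    have Fn: "F (V x) = n x / (n x + \<epsilon>)"
      using den[of "V x"] n_pos[of x] \<epsilon> cn_pos by (simp add: F_def n_eq exp_minus field_simps)
    have F01: "0 \<le> F (V x)" "F (V x) \<le> 1" unfolding Fn using n_pos[of x] \<epsilon> by auto
    have "n x * F (V x) \<ge> n x - \<epsilon>"
      unfolding Fn using n_pos[of x] \<epsilon> by (simp add: field_simps)
    moreover have "p x * F (V x) \<le> \<kappa> / \<epsilon>"
    proof -
      have "p x * F (V x) = \<kappa> / (n x + \<epsilon>)" unfolding Fn n_p[of x, symmetric] by simp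
      also have "\<dots> \<le> \<kappa> / \<epsilon>" using n_pos[of x] \<epsilon> kappa_pos by (intro divide_left_mono) auto
      finally show ?thesis .
    qed
    moreover have "C x * F (V x) \<le> max (C x) 0"
    proof -
      have "C x * F (V x) \<le> max (C x) 0 * F (V x)" using F01 by (intro mult_right_mono) auto
      also have "\<dots> \<le> max (C x) 0 * 1" using F01 by (intro mult_left_mono) auto
      finally show ?thesis by simp
    qed
    moreover have "(- n x + p x + C x) * F (V x) = - (n x * F (V x)) + p x * F (V x) + C x * F (V x)" by (simp add: algebra_simps)
    ultimately show "(- n x + p x + C x) * F (V x) \<le> (- n x + max (C x) 0) + (\<epsilon> + \<kappa> / \<epsilon>)" by linarith
  qed
  also have "\<dots> = - \<delta>\<^sup>2 + (\<epsilon> + \<kappa> / \<epsilon>) * vol"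
  proof -
    have "(\<integral>x. (- n x + max (C x) 0) + (\<epsilon> + \<kappa> / \<epsilon>) \<partial>L) = (\<integral>x. - n x + max (C x) 0 \<partial>L) + (\<integral>x. \<epsilon> + \<kappa> / \<epsilon> \<partial>L)"
      using n_int(1) C_int by (intro Bochner_Integration.integral_add) auto
    also have "(\<integral>x. - n x + max (C x) 0 \<partial>L) = - (\<integral>x. n x \<partial>L) + (\<integral>x. max (C x) 0 \<partial>L)"
      using n_int(1) C_int by simp
    finally show ?thesis unfolding integral_const_vol n_int(2) by (simp add: Nc_def)
  qed
  finally have "\<delta>\<^sup>2 \<le> (\<epsilon> + \<kappa> / \<epsilon>) * vol" by simp
  moreover have "\<delta>\<^sup>2 = 2 * \<epsilon> * vol" using vol_pos by (simp add: \<epsilon>_def)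
  ultimately have "2 * \<epsilon> \<le> \<epsilon> + \<kappa> / \<epsilon>" using vol_pos by simp
  then have "\<epsilon> * \<epsilon> \<le> \<kappa>" using \<epsilon> by (simp add: field_simps)
  then show ?thesis by (simp add: \<epsilon>_def power2_eq_square)
qed

text \<open>Arithmetic-geometric mean: n + p \<ge> 2 sqrt(n p) = 2 sqrt \<kappa>, which doubles the
  constant of \<open>kappa_lower\<close>.\<close>

lemma n_plus_p_ge: "n x + p x \<ge> \<delta>\<^sup>2 / vol"
proof -
  have "(\<delta>\<^sup>2 / vol)\<^sup>2 = 4 * (\<delta>\<^sup>2 / (2 * vol))\<^sup>2" by (simp add: power_divide power_mult_distrib)
  also have "\<dots> \<le> 4 * (n x * p x)" using kappa_lower n_p[of x] by simp
  also have "\<dots> \<le> (n x + p x)\<^sup>2"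
    using zero_le_power2[of "n x - p x"] by (simp add: power2_eq_square algebra_simps)
  finally show ?thesis by (rule power2_le_imp_le) (use n_pos[of x] p_pos[of x] in simp)
qed

text \<open>Without truncation the test function p - n + C would give the estimate at once, but its
  gradient (n + p) grad V + grad C need not be square integrable. The damping factor 1/(1 + ((p -
  n)/k)^2) on the left is the price of truncating at level k.\<close>

lemma truncated_gradient_estimate:
  fixes k :: real
  assumes k: "k > 0"
  shows "(\<integral>x. \<delta>\<^sup>2 / vol / (1 + ((p x - n x) / k)\<^sup>2) * (norm (weak_grad \<Omega> V x))\<^sup>2 \<partial>L)
     \<le> (\<integral>x. norm (weak_grad \<Omega> V x) * norm (weak_grad \<Omega> C x) \<partial>L)"
proof -
  define q where "q s = cp * exp s - cn * exp (- s)" for s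
  define q' where "q' s = cp * exp s + cn * exp (- s)" for s
  define T where "T s = k * arctan (s / k)" for s
  define T' where "T' s = 1 / (1 + (s / k)\<^sup>2)" for s
  have den: "1 + (s / k)\<^sup>2 > 0" for s by (simp add: add_pos_nonneg)
  have dT: "(T has_real_derivative T' s) (at s)" for s
    unfolding T_def T'_def by (rule truncation_derivative[OF k])
  have dq: "(q has_real_derivative q' s) (at s)" for s
    unfolding q_def q'_def by (auto intro!: derivative_eq_intros)
  have cT': "continuous_on UNIV T'"
    unfolding T'_def using den k by (intro continuous_intros) (auto simp: less_imp_neq[symmetric])
  have cq: "continuous_on UNIV q" "continuous_on UNIV q'" unfolding q_def q'_def by (intro continuous_intros)+
  have T'b: "0 < T' s" "T' s \<le> 1" for s using den[of s] by (auto simp: T'_def divide_le_eq_1)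
  have dF: "((\<lambda>s. T (q s)) has_real_derivative T' (q s) * q' s) (at s)" for s
    by (rule DERIV_chain2[OF dT dq])
  have cF': "continuous_on UNIV (\<lambda>s. T' (q s) * q' s)"
    by (intro continuous_intros continuous_on_compose2[OF cT' cq(1)] cq(2)) auto
  \<comment> \<open>q is a difference and q' the sum of two exponentials with product \<kappa>, so
    q'^2 = q^2 + 4 \<kappa> and q' grows only linearly in |q|, while T'(q) decays quadratically. The
    factor k comes from r \<le> 1 + r^2 with r = |q|/k.\<close>
  have bF': "\<bar>T' (q s) * q' s\<bar> \<le> k + 2 * sqrt \<kappa>" for s
  proof -
    have q'pos: "q' s > 0" using cn_pos cp_pos by (simp add: q'_def add_pos_pos)
    have "(q' s)\<^sup>2 = (q s)\<^sup>2 + 4 * \<kappa>"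
      by (simp add: q_def q'_def \<kappa>_def power2_eq_square algebra_simps exp_minus)
    also have "\<dots> \<le> (\<bar>q s\<bar> + 2 * sqrt \<kappa>)\<^sup>2"
      using kappa_pos by (simp add: power2_sum power_mult_distrib)
    finally have "q' s \<le> \<bar>q s\<bar> + 2 * sqrt \<kappa>" by (rule power2_le_imp_le) (use kappa_pos in simp)
    also have "\<bar>q s\<bar> \<le> k * (1 + (q s / k)\<^sup>2)"
    proof -
      define r where "r = \<bar>q s\<bar> / k"
      have "r \<le> 1 + r\<^sup>2" using sum_power2_ge_zero[of "r - 1" r] by (simp add: power2_diff)
      then have "k * r \<le> k * (1 + r\<^sup>2)" using k by simp
      then show ?thesis using k by (simp add: r_def power_divide)
    qed
    also have "2 * sqrt \<kappa> \<le> 2 * sqrt \<kappa> * (1 + (q s / k)\<^sup>2)"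
      using kappa_pos by (simp add: distrib_left)
    finally have "q' s \<le> (k + 2 * sqrt \<kappa>) * (1 + (q s / k)\<^sup>2)" by (simp add: algebra_simps)
    then have "T' (q s) * q' s \<le> k + 2 * sqrt \<kappa>"
      using den[of "q s"] by (simp add: T'_def divide_le_eq)
    then show ?thesis using q'pos T'b(1)[of "q s"] by simp
  qed
  note F = H1_compose[OF V dF cF' bF']
  have T'abs: "\<bar>T' s\<bar> \<le> 1" for s using T'b[of s] by simp
  note TC = H1_compose[OF C dT cT' T'abs]
  note \<phi> = H1_lincomb[OF F(1) TC(1), of 1]
  define \<phi> where "\<phi> x = T (q (V x)) + 1 * T (C x)" for x
  have \<phi>H: "\<phi> \<in> H1 \<Omega>" unfolding \<phi>_def by (rule \<phi>(1))
  let ?g = "weak_grad \<Omega> V" and ?h = "weak_grad \<Omega> C"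
  have grad: "AE x in L. weak_grad \<Omega> \<phi> x = (T' (q (V x)) * q' (V x)) *\<^sub>R ?g x + T' (C x) *\<^sub>R ?h x"
    unfolding \<phi>_def[abs_def] using \<phi>(2) F(2) TC(2) by eventually_elim simp
  have qV: "q (V x) = p x - n x" and q'V: "q' (V x) = n x + p x" for x
    by (simp_all add: q_def q'_def n_eq p_eq)
  \<comment> \<open>The zero-order factor is q(V) + C and the test function T(q(V)) + T(C).
    Truncating the summands separately, not their sum, lets the chain rule act on V and C
    individually.\<close>
  have "(\<integral>x. (- n x + p x + C x) * \<phi> x \<partial>L) \<ge> 0"
  proof (rule Bochner_Integration.integral_nonneg)
    fix x
    have "- n x + p x + C x = q (V x) + C x" by (simp add: qV)
    then show "0 \<le> (- n x + p x + C x) * \<phi> x"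
      using truncation_monotone_product[OF k, of "q (V x)" "C x"] by (simp add: \<phi>_def T_def)
  qed
  then have "lam\<^sup>2 * (\<integral>x. ?g x \<bullet> weak_grad \<Omega> \<phi> x \<partial>L) \<le> 0" using test_equation(2)[OF \<phi>H] by linarith
  then have le0: "(\<integral>x. ?g x \<bullet> weak_grad \<Omega> \<phi> x \<partial>L) \<le> 0" using lam by (simp add: mult_le_0_iff)
  have sg: "sq_int L ?g" and sh: "sq_int L ?h" and s\<phi>: "sq_int L (weak_grad \<Omega> \<phi>)"
    using weak_gradD(1) V C \<phi>H L2v_iff by blast+
  have igh: "integrable L (\<lambda>x. norm (?g x) * norm (?h x))"
    by (rule sq_int_mult_norm[OF sg sh])
  have i\<phi>: "integrable L (\<lambda>x. ?g x \<bullet> weak_grad \<Omega> \<phi> x)" by (rule sq_int_inner[OF sg s\<phi>])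
  have "(\<integral>x. \<delta>\<^sup>2 / vol / (1 + ((p x - n x) / k)\<^sup>2) * (norm (?g x))\<^sup>2 \<partial>L)
     \<le> (\<integral>x. ?g x \<bullet> weak_grad \<Omega> \<phi> x + norm (?g x) * norm (?h x) \<partial>L)"
  \<comment> \<open>Only the majorant has to be integrable and nonnegative; its nonnegativity
    follows from the pointwise estimate itself.\<close>
  proof (rule integral_mono_AE')
    show "integrable L (\<lambda>x. ?g x \<bullet> weak_grad \<Omega> \<phi> x + norm (?g x) * norm (?h x))" using igh i\<phi> by auto
    have le: "\<delta>\<^sup>2 / vol / (1 + ((p x - n x) / k)\<^sup>2) * (norm (?g x))\<^sup>2 \<le> ?g x \<bullet> weak_grad \<Omega> \<phi> x + norm (?g x) * norm (?h x)"
      if e: "weak_grad \<Omega> \<phi> x = (T' (q (V x)) * q' (V x)) *\<^sub>R ?g x + T' (C x) *\<^sub>R ?h x" for x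
    proof -
      have "\<delta>\<^sup>2 / vol / (1 + ((p x - n x) / k)\<^sup>2) = T' (q (V x)) * (\<delta>\<^sup>2 / vol)" by (simp add: T'_def qV)
      also have "\<dots> \<le> T' (q (V x)) * q' (V x)" unfolding q'V using T'b(1)[of "q (V x)"] by (intro mult_left_mono n_plus_p_ge) simp
      finally have 1: "\<delta>\<^sup>2 / vol / (1 + ((p x - n x) / k)\<^sup>2) * (norm (?g x))\<^sup>2 \<le> T' (q (V x)) * q' (V x) * (norm (?g x))\<^sup>2"
        by (rule mult_right_mono) simp
      have "\<bar>T' (C x) * (?g x \<bullet> ?h x)\<bar> \<le> 1 * (norm (?g x) * norm (?h x))"
        unfolding abs_mult by (intro mult_mono T'abs Cauchy_Schwarz_ineq2) auto
      then have 2: "T' (C x) * (?g x \<bullet> ?h x) \<ge> - (norm (?g x) * norm (?h x))" by simp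
      have "?g x \<bullet> weak_grad \<Omega> \<phi> x = T' (q (V x)) * q' (V x) * (norm (?g x))\<^sup>2 + T' (C x) * (?g x \<bullet> ?h x)"
        unfolding e by (simp add: inner_add_right power2_norm_eq_inner)
      then show ?thesis using 1 2 by linarith
    qed
    show "AE x in L. \<delta>\<^sup>2 / vol / (1 + ((p x - n x) / k)\<^sup>2) * (norm (?g x))\<^sup>2 \<le> ?g x \<bullet> weak_grad \<Omega> \<phi> x + norm (?g x) * norm (?h x)"
      using grad by eventually_elim (rule le)
    have nonneg: "0 \<le> \<delta>\<^sup>2 / vol / (1 + ((p x - n x) / k)\<^sup>2) * (norm (?g x))\<^sup>2" for x
      using vol_pos by (intro mult_nonneg_nonneg divide_nonneg_nonneg add_nonneg_nonneg) auto
    show "AE x in L. 0 \<le> ?g x \<bullet> weak_grad \<Omega> \<phi> x + norm (?g x) * norm (?h x)"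
      using grad by eventually_elim (rule order_trans[OF nonneg le])
  qed
  also have "\<dots> = (\<integral>x. ?g x \<bullet> weak_grad \<Omega> \<phi> x \<partial>L) + (\<integral>x. norm (?g x) * norm (?h x) \<partial>L)"
    by (rule Bochner_Integration.integral_add[OF i\<phi> igh])
  finally show ?thesis using le0 by linarith
qed

text \<open>The damping factors tend to 1 as k = j + 1 grows, dominated by c |grad V|^2. What
  remains is c |grad V|^2 against |grad V| |grad C|, closed by Young's inequality.\<close>

lemma gradient_bound:
  "(\<integral>x. (norm (weak_grad \<Omega> V x))\<^sup>2 \<partial>L) \<le> (vol / \<delta>\<^sup>2)\<^sup>2 * (\<integral>x. (norm (weak_grad \<Omega> C x))\<^sup>2 \<partial>L)"
proof -
  let ?g = "weak_grad \<Omega> V" and ?h = "weak_grad \<Omega> C"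
  define c where "c = \<delta>\<^sup>2 / vol"
  have c: "c > 0" using vol_pos \<delta> by (simp add: c_def)
  have sg: "sq_int L ?g" and sh: "sq_int L ?h" using weak_gradD(1) V C L2v_iff by blast+
  have ig: "integrable L (\<lambda>x. (norm (?g x))\<^sup>2)" and ih: "integrable L (\<lambda>x. (norm (?h x))\<^sup>2)" using sg sh by (auto simp: sq_int_def)
  have igh: "integrable L (\<lambda>x. norm (?g x) * norm (?h x))"
    by (rule sq_int_mult_norm[OF sg sh])
  have [measurable]: "V \<in> borel_measurable L" "?g \<in> borel_measurable L" using V_meas sg by (auto simp: sq_int_def)
  have [measurable]: "n \<in> borel_measurable L" "p \<in> borel_measurable L"
    unfolding n_eq[abs_def] p_eq[abs_def] by measurable
  have "(\<lambda>j. \<integral>x. c / (1 + ((p x - n x) / real (Suc j))\<^sup>2) * (norm (?g x))\<^sup>2 \<partial>L) \<longlonglongrightarrow> (\<integral>x. c / (1 + 0\<^sup>2) * (norm (?g x))\<^sup>2 \<partial>L)"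
  proof (rule integral_dominated_convergence[where w="\<lambda>x. c * (norm (?g x))\<^sup>2"])
    show "AE x in L. (\<lambda>j. c / (1 + ((p x - n x) / real (Suc j))\<^sup>2) * (norm (?g x))\<^sup>2) \<longlonglongrightarrow> c / (1 + 0\<^sup>2) * (norm (?g x))\<^sup>2"
    proof (rule AE_I2)
      fix x
      have "(\<lambda>j. (p x - n x) * inverse (real (Suc j))) \<longlonglongrightarrow> 0"
        using tendsto_mult_right_zero[OF LIMSEQ_inverse_real_of_nat] .
      then have "(\<lambda>j. (p x - n x) / real (Suc j)) \<longlonglongrightarrow> 0" by (simp add: divide_inverse)
      then show "(\<lambda>j. c / (1 + ((p x - n x) / real (Suc j))\<^sup>2) * (norm (?g x))\<^sup>2) \<longlonglongrightarrow> c / (1 + 0\<^sup>2) * (norm (?g x))\<^sup>2"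
        by (intro tendsto_intros) auto
    qed
    show "AE x in L. norm (c / (1 + ((p x - n x) / real (Suc j))\<^sup>2) * (norm (?g x))\<^sup>2) \<le> c * (norm (?g x))\<^sup>2" for j
    proof (rule AE_I2)
      fix x
      have "0 \<le> c / (1 + r\<^sup>2)" "c / (1 + r\<^sup>2) \<le> c" for r :: real
        using c by (simp_all add: divide_le_eq mult_le_cancel_left1 add_pos_nonneg add_nonneg_nonneg)
      from this[of "(p x - n x) / real (Suc j)"]
      have "0 \<le> c / (1 + ((p x - n x) / real (Suc j))\<^sup>2)" "c / (1 + ((p x - n x) / real (Suc j))\<^sup>2) \<le> c" .
      then show "norm (c / (1 + ((p x - n x) / real (Suc j))\<^sup>2) * (norm (?g x))\<^sup>2) \<le> c * (norm (?g x))\<^sup>2"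
        unfolding real_norm_def abs_mult by (simp only: abs_of_nonneg abs_power2 zero_le_power2 abs_norm_cancel power_abs[symmetric]) (rule mult_right_mono, simp_all)
    qed
  qed (use ig in auto)
  then have "(\<integral>x. c / (1 + 0\<^sup>2) * (norm (?g x))\<^sup>2 \<partial>L) \<le> (\<integral>x. norm (?g x) * norm (?h x) \<partial>L)"
    by (rule LIMSEQ_le_const2) (use truncated_gradient_estimate in \<open>auto simp: c_def\<close>)
  \<comment> \<open>Young with weight c, so that exactly half of the left-hand side is
    absorbed.\<close>
  also have "\<dots> \<le> (\<integral>x. c / 2 * (norm (?g x))\<^sup>2 + 1 / (2 * c) * (norm (?h x))\<^sup>2 \<partial>L)"
  proof (rule integral_mono[OF igh])
    show "integrable L (\<lambda>x. c / 2 * (norm (?g x))\<^sup>2 + 1 / (2 * c) * (norm (?h x))\<^sup>2)" using ig ih by auto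
    fix x
    have "2 * c * (norm (?g x) * norm (?h x)) \<le> (c * norm (?g x))\<^sup>2 + (norm (?h x))\<^sup>2"
      using zero_le_power2[of "c * norm (?g x) - norm (?h x)"] by (simp add: power2_eq_square algebra_simps)
    then show "norm (?g x) * norm (?h x) \<le> c / 2 * (norm (?g x))\<^sup>2 + 1 / (2 * c) * (norm (?h x))\<^sup>2"
      using c by (simp add: field_simps power2_eq_square)
  qed
  also have "\<dots> = c / 2 * (\<integral>x. (norm (?g x))\<^sup>2 \<partial>L) + 1 / (2 * c) * (\<integral>x. (norm (?h x))\<^sup>2 \<partial>L)"
    using ig ih by simp
  finally have "c * (\<integral>x. (norm (?g x))\<^sup>2 \<partial>L) \<le> c / 2 * (\<integral>x. (norm (?g x))\<^sup>2 \<partial>L) + 1 / (2 * c) * (\<integral>x. (norm (?h x))\<^sup>2 \<partial>L)" by simp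
  then have "(\<integral>x. (norm (?g x))\<^sup>2 \<partial>L) \<le> (1 / c)\<^sup>2 * (\<integral>x. (norm (?h x))\<^sup>2 \<partial>L)"
    using c by (simp add: field_simps power2_eq_square)
  then show ?thesis by (simp add: c_def)
qed

lemma L2_bound:
  assumes n2: "integrable L (\<lambda>x. (n x)\<^sup>2)" and p2: "integrable L (\<lambda>x. (p x)\<^sup>2)"
  shows "(\<integral>x. (V x)\<^sup>2 \<partial>L) \<le> 2 / (\<delta>\<^sup>2 / (2 * vol))\<^sup>2 * ((\<integral>x. (n x)\<^sup>2 \<partial>L) + (\<integral>x. (p x)\<^sup>2 \<partial>L))"
proof -
  \<comment> \<open>The shift that balances the exponentials: exp(V + t) = p/sqrt \<kappa> and
    exp(-(V + t)) = n/sqrt \<kappa>. Then |w| \<le> exp w + exp(-w) applies to w = V + t.\<close>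
  define t where "t = ln (cp / sqrt \<kappa>)"
  have V2: "integrable L (\<lambda>x. (V x)\<^sup>2)" using H1_L2[OF V] by (simp add: L2_def)
  have sk: "sqrt \<kappa> > 0" using kappa_pos by simp
  have ept: "exp t = cp / sqrt \<kappa>" using cp_pos sk by (simp add: t_def)
  have pt: "(V x + t)\<^sup>2 \<le> 2 / \<kappa> * ((n x)\<^sup>2 + (p x)\<^sup>2)" for x
  proof -
    let ?w = "V x + t"
    have ep: "exp ?w = p x / sqrt \<kappa>" by (simp add: exp_add ept p_eq)
    have en: "exp (- ?w) = n x / sqrt \<kappa>"
    proof -
      have "exp (- ?w) = sqrt \<kappa> / p x" unfolding exp_minus ep by (simp add: inverse_eq_divide)
      also have "\<dots> = n x / sqrt \<kappa>"
        using sk p_pos[of x] n_p[of x] kappa_pos by (simp add: field_simps)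
      finally show ?thesis .
    qed
    have "\<bar>?w\<bar> \<le> exp ?w + exp (- ?w)"
      using exp_ge_add_one_self[of ?w] exp_ge_add_one_self[of "- ?w"] exp_gt_zero[of ?w] exp_gt_zero[of "- ?w"] by linarith
    also have "\<dots> = (n x + p x) / sqrt \<kappa>" unfolding ep en by (simp add: add_divide_distrib)
    finally have "?w\<^sup>2 \<le> ((n x + p x) / sqrt \<kappa>)\<^sup>2" by (metis abs_ge_zero power2_abs power_mono)
    also have "\<dots> = (n x + p x)\<^sup>2 / \<kappa>" using kappa_pos by (simp add: power_divide)
    also have "\<dots> \<le> (2 * (n x)\<^sup>2 + 2 * (p x)\<^sup>2) / \<kappa>"
      using kappa_pos norm_add_power2_le[of "n x" "p x"] by (intro divide_right_mono) auto
    finally show ?thesis by (simp add: algebra_simps add_divide_distrib)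
  qed
  \<comment> \<open>The unknown shift costs nothing: the mean of \<open>V\<close> is zero, so the
    cross term vanishes and adding a constant can only increase the L^2 norm.\<close>
  have "(\<integral>x. (V x)\<^sup>2 \<partial>L) \<le> (\<integral>x. (V x)\<^sup>2 \<partial>L) + t\<^sup>2 * vol" using vol_pos by simp
  also have "\<dots> = (\<integral>x. (V x + t)\<^sup>2 \<partial>L)"
  proof -
    have "(\<integral>x. (V x + t)\<^sup>2 \<partial>L) = (\<integral>x. ((V x)\<^sup>2 + 2 * t * V x) + t\<^sup>2 \<partial>L)"
      by (simp add: power2_sum algebra_simps)
    also have "\<dots> = (\<integral>x. (V x)\<^sup>2 + 2 * t * V x \<partial>L) + (\<integral>x. t\<^sup>2 \<partial>L)"
      using V2 V_int by (intro Bochner_Integration.integral_add) auto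
    also have "(\<integral>x. (V x)\<^sup>2 + 2 * t * V x \<partial>L) = (\<integral>x. (V x)\<^sup>2 \<partial>L)"
      using V2 V_int V_mean by simp
    finally show ?thesis unfolding integral_const_vol by simp
  qed
  also have "\<dots> \<le> (\<integral>x. 2 / \<kappa> * ((n x)\<^sup>2 + (p x)\<^sup>2) \<partial>L)"
  proof (rule integral_mono[OF _ _ pt])
    have "(\<lambda>x. (V x + t)\<^sup>2) = (\<lambda>x. (V x)\<^sup>2 + 2 * t * V x + t\<^sup>2)" by (auto simp: power2_sum algebra_simps)
    then show "integrable L (\<lambda>x. (V x + t)\<^sup>2)" using V2 V_int by simp
  qed (use n2 p2 in auto)
  also have "\<dots> = 2 / \<kappa> * ((\<integral>x. (n x)\<^sup>2 \<partial>L) + (\<integral>x. (p x)\<^sup>2 \<partial>L))" using n2 p2 by simp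
  also have "\<dots> \<le> 2 / (\<delta>\<^sup>2 / (2 * vol))\<^sup>2 * ((\<integral>x. (n x)\<^sup>2 \<partial>L) + (\<integral>x. (p x)\<^sup>2 \<partial>L))"
    using kappa_lower kappa_pos vol_pos \<delta>
    by (intro mult_right_mono divide_left_mono add_nonneg_nonneg Bochner_Integration.integral_nonneg mult_pos_pos) auto
  finally show ?thesis .
qed

end

section \<open>Equi-coercivity\<close>

lemma ereal_mult_enn2ereal_le:
  assumes "c > 0" "ereal c * enn2ereal X \<le> ereal t"
  shows "X \<le> ennreal (t / c)"
proof (cases X)
  case (real r)
  then have "c * r \<le> t" using assms(2) by (simp add: enn2ereal_ennreal)
  then have "r \<le> t / c" using assms(1) by (simp add: field_simps)
  then show ?thesis using real by (simp add: ennreal_leI)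
next
  case top
  then show ?thesis using assms by simp
qed

text \<open>\<open>ennreal\<close> sends negative numbers to 0, so the bound is phrased with |r|;
  this avoids a case distinction on the sign of the level t.\<close>

lemma sq_int_of_nn_integral_le:
  assumes f: "f \<in> borel_measurable M" and le: "(\<integral>\<^sup>+x. ennreal ((norm (f x))\<^sup>2) \<partial>M) \<le> ennreal r"
  shows "sq_int M f" "(\<integral>x. (norm (f x))\<^sup>2 \<partial>M) \<le> \<bar>r\<bar>"
proof -
  have i: "integrable M (\<lambda>x. (norm (f x))\<^sup>2)"
    by (rule integrableI_bounded) (use f le in \<open>auto intro: le_less_trans\<close>)
  then show "sq_int M f" using f by (simp add: sq_int_def)
  have "ennreal (\<integral>x. (norm (f x))\<^sup>2 \<partial>M) = (\<integral>\<^sup>+x. ennreal ((norm (f x))\<^sup>2) \<partial>M)"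
    using i by (intro nn_integral_eq_integral[symmetric]) auto
  also have "\<dots> \<le> ennreal \<bar>r\<bar>" using le by (rule order_trans) (simp add: ennreal_leI)
  finally show "(\<integral>x. (norm (f x))\<^sup>2 \<partial>M) \<le> \<bar>r\<bar>" by simp
qed

lemma sq_int_add_bound:
  assumes "sq_int M f" "sq_int M g"
  shows "(\<integral>x. (norm (f x + g x))\<^sup>2 \<partial>M) \<le> 2 * (\<integral>x. (norm (f x))\<^sup>2 \<partial>M) + 2 * (\<integral>x. (norm (g x))\<^sup>2 \<partial>M)"
proof -
  have i: "integrable M (\<lambda>x. (norm (f x))\<^sup>2)" "integrable M (\<lambda>x. (norm (g x))\<^sup>2)" using assms by (auto simp: sq_int_def)
  have "(\<integral>x. (norm (f x + g x))\<^sup>2 \<partial>M) \<le> (\<integral>x. 2 * (norm (f x))\<^sup>2 + 2 * (norm (g x))\<^sup>2 \<partial>M)"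
    by (rule integral_mono[OF _ _ norm_add_power2_le]) (use sq_int_add[OF assms] i in \<open>auto simp: sq_int_def\<close>)
  then show ?thesis using i by simp
qed

text \<open>Finiteness of \<open>b_fun\<close> is what provides the integrable exponentials.
  \<open>Sigma_set\<close> gives \<open>V\<close> an L^1 bound and a gradient only, so H^1
  membership is taken from \<open>Xsp \<Omega>\<close>.\<close>

lemma (in bounded_open) Pi_lam_stationary:
  assumes "\<Omega> \<noteq> {}" "\<delta> > 0" "lam > 0" and z: "(V, C) \<in> Xsp \<Omega>" "(V, C) \<in> Pi_lam \<Omega> \<delta> Uad lam"
  shows "stationary \<Omega> \<delta> lam V C"
proof -
  have VC: "V \<in> H1 \<Omega>" "C \<in> H1 \<Omega>" using z(1) by (auto simp: Xsp_def)
  have S: "V \<in> Sigma_set \<Omega> \<delta> C" and e: "e_zero \<Omega> \<delta> lam V C" using z(2) by (auto simp: Pi_lam_def)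
  have "V \<in> Pset \<Omega>" and b: "b_fun \<Omega> \<delta> C V < \<infinity>" using S by (auto simp: Sigma_set_def)
  then have V: "integrable (lebesgue_on \<Omega>) V" "(\<integral>x. V x \<partial>lebesgue_on \<Omega>) = 0" by (auto simp: Pset_def L1_def)
  have [measurable]: "V \<in> borel_measurable (lebesgue_on \<Omega>)" using V by auto
  have fin: "(\<integral>\<^sup>+x. ennreal (exp (- V x)) \<partial>lebesgue_on \<Omega>) < \<infinity>" "(\<integral>\<^sup>+x. ennreal (exp (V x)) \<partial>lebesgue_on \<Omega>) < \<infinity>"
    using b unfolding b_fun_def by (auto split: if_splits)
  have "integrable (lebesgue_on \<Omega>) (\<lambda>x. exp (- V x))" "integrable (lebesgue_on \<Omega>) (\<lambda>x. exp (V x))"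
    by (rule integrableI_bounded; use fin in simp)+
  then show ?thesis using assms VC V e by unfold_locales auto
qed

text \<open>Each of the three nonnegative cost terms is at most t. Hence the squared L^2 distance of
  n to \<open>nd\<close> is at most 2 |t|, and adding \<open>nd\<close> back doubles it to 4 |t|;
  likewise for p, which explains 8 |t|. The constant \<open>M\<close> arises in the same way from
  the gradient term and \<open>Cref\<close>.\<close>

lemma (in bounded_open) level_set_bounds:
  assumes "\<Omega> \<noteq> {}" "\<delta> > 0" "\<sigma> > 0" "nd \<in> L2 \<Omega>" "pd \<in> L2 \<Omega>" "Cref \<in> H1 \<Omega>" "lam > 0"
    and z: "(V, C) \<in> Xsp \<Omega>" and J: "J_lam \<Omega> \<delta> Uad nd pd \<sigma> Cref lam (V, C) \<le> ereal t"
  defines "M \<equiv> 2 * \<bar>t / (\<sigma>/2)\<bar> + 2 * (grad_norm \<Omega> Cref)\<^sup>2"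
  shows "C \<in> Uad" "(grad_norm \<Omega> C)\<^sup>2 \<le> M"
    "H1_inner \<Omega> V V \<le> 2 / (\<delta>\<^sup>2 / (2 * measure lebesgue \<Omega>))\<^sup>2 * (8 * \<bar>t\<bar> + 2 * (L2norm \<Omega> nd)\<^sup>2 + 2 * (L2norm \<Omega> pd)\<^sup>2)
       + (measure lebesgue \<Omega> / \<delta>\<^sup>2)\<^sup>2 * M"
proof -
  have Pi: "(V, C) \<in> Pi_lam \<Omega> \<delta> Uad lam" using J by (auto simp: J_lam_def split: if_splits)
  then show "C \<in> Uad" by (simp add: Pi_lam_def)
  interpret stationary \<Omega> \<delta> lam V C by (rule Pi_lam_stationary[OF assms(1,2,7) z Pi])
  let ?n = "enn2ereal (\<integral>\<^sup>+x. ennreal ((norm (n x - nd x))\<^sup>2) \<partial>L)"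
  let ?p = "enn2ereal (\<integral>\<^sup>+x. ennreal ((norm (p x - pd x))\<^sup>2) \<partial>L)"
  let ?c = "enn2ereal (\<integral>\<^sup>+x. ennreal ((norm (weak_grad \<Omega> (\<lambda>x. C x - Cref x) x))\<^sup>2) \<partial>L)"
  have sum: "ereal (1/2) * ?n + ereal (1/2) * ?p + ereal (\<sigma>/2) * ?c \<le> ereal t"
    using J Pi by (simp add: J_lam_def Jcost_def sqnorm_def grad_sqnorm_def)
  have nonneg: "0 \<le> ereal (1/2) * ?n" "0 \<le> ereal (1/2) * ?p" "0 \<le> ereal (\<sigma>/2) * ?c"
    using assms(3) by (auto intro!: ereal_0_le_mult)
  have le: "ereal (1/2) * ?n \<le> ereal t" "ereal (1/2) * ?p \<le> ereal t" "ereal (\<sigma>/2) * ?c \<le> ereal t"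
    using nonneg sum by (meson add_increasing add_increasing2 add_nonneg_nonneg order_refl order_trans)+
  have nn: "(\<integral>\<^sup>+x. ennreal ((norm (n x - nd x))\<^sup>2) \<partial>L) \<le> ennreal (t / (1/2))"
    "(\<integral>\<^sup>+x. ennreal ((norm (p x - pd x))\<^sup>2) \<partial>L) \<le> ennreal (t / (1/2))"
    "(\<integral>\<^sup>+x. ennreal ((norm (weak_grad \<Omega> (\<lambda>x. C x - Cref x) x))\<^sup>2) \<partial>L) \<le> ennreal (t / (\<sigma>/2))"
    by (rule ereal_mult_enn2ereal_le[OF _ le(1)], simp) (rule ereal_mult_enn2ereal_le[OF _ le(2)], simp,
        rule ereal_mult_enn2ereal_le[OF _ le(3)], use assms(3) in simp)
  have [measurable]: "V \<in> borel_measurable L" by (rule V_meas)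
  have [measurable]: "n \<in> borel_measurable L" "p \<in> borel_measurable L"
    unfolding n_eq[abs_def] p_eq[abs_def] by measurable
  have snd: "sq_int L nd" and spd: "sq_int L pd" using assms(4,5) by (auto simp: L2_iff)
  have [measurable]: "nd \<in> borel_measurable L" "pd \<in> borel_measurable L" using snd spd by (auto simp: sq_int_def)
  have nm: "(\<lambda>x. n x - nd x) \<in> borel_measurable L" and pm: "(\<lambda>x. p x - pd x) \<in> borel_measurable L" by measurable
  note nb = sq_int_of_nn_integral_le[OF nm nn(1)] and pb = sq_int_of_nn_integral_le[OF pm nn(2)]
  have sn: "sq_int L n" and sp: "sq_int L p" using sq_int_add[OF nb(1) snd] sq_int_add[OF pb(1) spd] by simp_all
  have L2n: "(L2norm \<Omega> f)\<^sup>2 = (\<integral>x. (norm (f x))\<^sup>2 \<partial>L)" for f by (simp add: L2norm_def)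
  have gn: "(grad_norm \<Omega> f)\<^sup>2 = (\<integral>x. (norm (weak_grad \<Omega> f x))\<^sup>2 \<partial>L)" for f by (simp add: grad_norm_def)
  have n2: "(\<integral>x. (n x)\<^sup>2 \<partial>L) \<le> 4 * \<bar>t\<bar> + 2 * (L2norm \<Omega> nd)\<^sup>2"
    using sq_int_add_bound[OF nb(1) snd] nb(2) by (simp add: L2n)
  have p2: "(\<integral>x. (p x)\<^sup>2 \<partial>L) \<le> 4 * \<bar>t\<bar> + 2 * (L2norm \<Omega> pd)\<^sup>2"
    using sq_int_add_bound[OF pb(1) spd] pb(2) by (simp add: L2n)
  \<comment> \<open>The cost bounds the gradient chosen for C - Cref, which agrees with the
    difference of the chosen gradients only almost everywhere.\<close>
  have D: "(\<lambda>x. C x - Cref x) \<in> H1 \<Omega>"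
    "AE x in L. weak_grad \<Omega> (\<lambda>x. C x - Cref x) x = weak_grad \<Omega> C x - weak_grad \<Omega> Cref x"
    using H1_lincomb[OF C assms(6), of "-1"] by simp_all
  have sD: "sq_int L (weak_grad \<Omega> (\<lambda>x. C x - Cref x))" and sR: "sq_int L (weak_grad \<Omega> Cref)" and sC: "sq_int L (weak_grad \<Omega> C)"
    using weak_gradD(1) D(1) assms(6) C L2v_iff by blast+
  have "(\<integral>x. (norm (weak_grad \<Omega> C x))\<^sup>2 \<partial>L) = (\<integral>x. (norm (weak_grad \<Omega> (\<lambda>x. C x - Cref x) x + weak_grad \<Omega> Cref x))\<^sup>2 \<partial>L)"
  proof (rule integral_cong_AE)
    show "AE x in L. (norm (weak_grad \<Omega> C x))\<^sup>2 = (norm (weak_grad \<Omega> (\<lambda>x. C x - Cref x) x + weak_grad \<Omega> Cref x))\<^sup>2"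
      using D(2) by eventually_elim simp
  qed (use sq_int_add[OF sD sR] sC in \<open>auto simp: sq_int_def\<close>)
  also have "\<dots> \<le> 2 * (\<integral>x. (norm (weak_grad \<Omega> (\<lambda>x. C x - Cref x) x))\<^sup>2 \<partial>L) + 2 * (grad_norm \<Omega> Cref)\<^sup>2"
    unfolding gn by (rule sq_int_add_bound[OF sD sR])
  also have "\<dots> \<le> M"
  proof -
    have "weak_grad \<Omega> (\<lambda>x. C x - Cref x) \<in> borel_measurable L" using sD by (simp add: sq_int_def)
    from sq_int_of_nn_integral_le(2)[OF this nn(3)] show ?thesis unfolding M_def by linarith
  qed
  finally have gC: "(\<integral>x. (norm (weak_grad \<Omega> C x))\<^sup>2 \<partial>L) \<le> M" .
  then show "(grad_norm \<Omega> C)\<^sup>2 \<le> M" unfolding gn .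
  have "H1_inner \<Omega> V V = (\<integral>x. (V x)\<^sup>2 \<partial>L) + (\<integral>x. (norm (weak_grad \<Omega> V x))\<^sup>2 \<partial>L)"
    by (simp add: H1_inner_def power2_eq_square[symmetric] power2_norm_eq_inner)
  also have "\<dots> \<le> 2 / (\<delta>\<^sup>2 / (2 * vol))\<^sup>2 * ((\<integral>x. (n x)\<^sup>2 \<partial>L) + (\<integral>x. (p x)\<^sup>2 \<partial>L)) + (vol / \<delta>\<^sup>2)\<^sup>2 * (\<integral>x. (norm (weak_grad \<Omega> C x))\<^sup>2 \<partial>L)"
    using sn sp by (intro add_mono L2_bound gradient_bound) (auto simp: sq_int_def)
  also have "\<dots> \<le> 2 / (\<delta>\<^sup>2 / (2 * vol))\<^sup>2 * (8 * \<bar>t\<bar> + 2 * (L2norm \<Omega> nd)\<^sup>2 + 2 * (L2norm \<Omega> pd)\<^sup>2) + (vol / \<delta>\<^sup>2)\<^sup>2 * M"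
    by (rule add_mono[OF mult_left_mono mult_left_mono]) (use n2 p2 gC in auto)
  finally show "H1_inner \<Omega> V V \<le> 2 / (\<delta>\<^sup>2 / (2 * measure lebesgue \<Omega>))\<^sup>2 * (8 * \<bar>t\<bar> + 2 * (L2norm \<Omega> nd)\<^sup>2 + 2 * (L2norm \<Omega> pd)\<^sup>2)
       + (measure lebesgue \<Omega> / \<delta>\<^sup>2)\<^sup>2 * M" by (simp add: vol_def)
qed

theorem theorem4p4:
  fixes \<Omega> :: "'a::euclidean_space set"
    and \<delta> \<sigma> :: real
    and nd pd Cref :: "'a \<Rightarrow> real"
    and Uad :: "('a \<Rightarrow> real) set"
    and lam :: "nat \<Rightarrow> real"
  assumes "DIM('a) \<in> {1, 2, 3}"
    and "lipschitz_domain \<Omega>"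
    and "\<delta> > 0"
    and "\<sigma> > 0"
    and "nd \<in> L2 \<Omega>" and "pd \<in> L2 \<Omega>"
    and "Cref \<in> H1 \<Omega>"
    and "admissible \<Omega> Uad"
    and "\<forall>k. lam k > 0"
    and "lam \<longlonglongrightarrow> 0"
  shows "\<forall>t::real. \<exists>K \<subseteq> Xsp \<Omega>. compactin (weak_top_X \<Omega>) K \<and>
           (\<forall>k. {z \<in> Xsp \<Omega>. J_lam \<Omega> \<delta> Uad nd pd \<sigma> Cref (lam k) z \<le> ereal t} \<subseteq> K)"
proof
  fix t :: real
  have ne: "\<Omega> \<noteq> {}" using assms(2) by (simp add: lipschitz_domain_def)
  interpret bounded_open \<Omega> using assms(2) by unfold_locales (simp_all add: lipschitz_domain_def)
  define M where "M = 2 * \<bar>t / (\<sigma>/2)\<bar> + 2 * (grad_norm \<Omega> Cref)\<^sup>2"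
  define R1 where "R1 = 2 / (\<delta>\<^sup>2 / (2 * measure lebesgue \<Omega>))\<^sup>2 * (8 * \<bar>t\<bar> + 2 * (L2norm \<Omega> nd)\<^sup>2 + 2 * (L2norm \<Omega> pd)\<^sup>2)
       + (measure lebesgue \<Omega> / \<delta>\<^sup>2)\<^sup>2 * M"
  \<comment> \<open>Admissibility is applied to the single set of all u in \<open>Uad\<close> with
    gradient norm at most sqrt M; this set contains the second component of every sublevel point and
    depends on neither k nor \<open>lam\<close>.\<close>
  obtain R2 where R2: "\<And>u. u \<in> Uad \<Longrightarrow> grad_norm \<Omega> u \<le> sqrt M \<Longrightarrow> H1_norm \<Omega> u \<le> R2"
  proof -
    have "\<exists>R. \<forall>u\<in>{u \<in> Uad. grad_norm \<Omega> u \<le> sqrt M}. H1_norm \<Omega> u \<le> R"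
      using assms(8) unfolding admissible_def by (metis (mono_tags, lifting) mem_Collect_eq subsetI)
    then show ?thesis using that by blast
  qed
  \<comment> \<open>Fixed before any k is chosen. The absolute value and the square make R
    nonnegative, as \<open>weakly_compact_ball\<close> requires.\<close>
  define R where "R = \<bar>R1\<bar> + R2\<^sup>2"
  have bound: "X_inner \<Omega> z z \<le> R" if z: "z \<in> Xsp \<Omega>" and J: "J_lam \<Omega> \<delta> Uad nd pd \<sigma> Cref (lam k) z \<le> ereal t" for z k
  proof -
    obtain V C where VC: "z = (V, C)" by force
    note b = level_set_bounds[OF ne assms(3-7) assms(9)[rule_format] z[unfolded VC] J[unfolded VC], folded M_def, folded R1_def]
    have "grad_norm \<Omega> C \<le> sqrt M" using b(2) by (rule real_le_rsqrt)
    then have "sqrt (H1_inner \<Omega> C C) \<le> R2" using R2[OF b(1)] by (simp add: H1_norm_def)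
    then have "(sqrt (H1_inner \<Omega> C C))\<^sup>2 \<le> R2\<^sup>2" using H1_inner_nonneg by (intro power_mono) auto
    then have "H1_inner \<Omega> C C \<le> R2\<^sup>2" using H1_inner_nonneg by simp
    then show ?thesis using b(3) by (simp add: VC X_inner_def R_def)
  qed
  show "\<exists>K \<subseteq> Xsp \<Omega>. compactin (weak_top_X \<Omega>) K \<and>
     (\<forall>k. {z \<in> Xsp \<Omega>. J_lam \<Omega> \<delta> Uad nd pd \<sigma> Cref (lam k) z \<le> ereal t} \<subseteq> K)"
  proof (intro exI[of _ "{z \<in> Xsp \<Omega>. X_inner \<Omega> z z \<le> R}"] conjI allI)
    show "compactin (weak_top_X \<Omega>) {z \<in> Xsp \<Omega>. X_inner \<Omega> z z \<le> R}"
      unfolding weak_top_X_def by (rule X.weakly_compact_ball) (simp add: R_def)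
  qed (use bound in auto)
qed

end
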